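(* Let $m,n\ge1$ be integers and let $(a,b,c)\in\mathbb{R}_+^3$ with $a\leq1$ and $ab+c\leq1$. Let $(L_\varepsilon)_\varepsilon\in\mathcal{L}(\mathcal{S}(\mathbb{R}^n),\mathcal{O}_M(\mathbb{R}^m))^{(0,1]}$ be an $\mathcal{L}_{b,c}$-strongly moderate net of linear maps, and let $L\in\mathbf{L}(\mathcal{G}_{\mathcal S}(\mathbb{R}^n),\mathcal{G}_\tau(\mathbb{R}^m))$ be its canonical extension. Then there exists $H_L\in\mathcal{G}_\tau(\mathbb{R}^{m+n})$ such that $$\forall f\in\mathcal{G}_{\mathcal S}^{\mathcal{L}_a}(\mathbb{R}^n),\qquad L(f)=\Big[\Big(x\mapsto\int_{\mathbb{R}^n} H_{L,\varepsilon}(x,y)f_\varepsilon(y)\,dy\Big)_\varepsilon\Big]_\tau,$$ where $(H_{L,\varepsilon})_\varepsilon$ (resp. $(f_\varepsilon)_\varepsilon$) is any representative of $H_L$ (resp. $f$).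
   Context: $\mathbb{R}_+=[0,+\infty)$. For $f\in C^\infty(\mathbb{R}^d)$, $r\in\mathbb{Z}$ and $l\geq 0$ put $\mu_{r,l}(f)=\sup_{x\in\mathbb{R}^d,\,|\alpha|\leq l}(1+|x|)^r|\partial^\alpha f(x)|\in[0,+\infty]$. All $\mathrm{O}(\cdot)$ are as $\varepsilon\to0$; nets are indexed by $\varepsilon\in(0,1]$. $\mathcal{G}_{\mathcal S}(\mathbb{R}^d)=\mathcal{E}_{\mathcal S}(\mathbb{R}^d)/\mathcal{N}_{\mathcal S}(\mathbb{R}^d)$, where $\mathcal{E}_{\mathcal S}(\mathbb{R}^d)$ (resp. $\mathcal{N}_{\mathcal S}(\mathbb{R}^d)$) is the set of nets $(f_\varepsilon)_\varepsilon\in\mathcal{S}(\mathbb{R}^d)^{(0,1]}$ such that for all $(q,l)\in\mathbb{N}^2$ there exists $N\in\mathbb{N}$ with $\mu_{q,l}(f_\varepsilon)=\mathrm{O}(\varepsilon^{-N})$ (resp. for all $(q,l)\in\mathbb{N}^2$ and all $p\in\mathbb{N}$, $\mu_{q,l}(f_\varepsilon)=\mathrm{O}(\varepsilon^{p})$). $\mathcal{O}_M(\mathbb{R}^d)=\{f\in C^\infty(\mathbb{R}^d): \forall l\in\mathbb{N}\ \exists q\in\mathbb{N},\ \mu_{-q,l}(f)<+\infty\}$ with its usual topology. $\mathcal{G}_\tau(\mathbb{R}^d)=\mathcal{E}_\tau(\mathbb{R}^d)/\mathcal{N}_\tau(\mathbb{R}^d)$, where $\mathcal{E}_\tau(\mathbb{R}^d)$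 (resp. $\mathcal{N}_\tau(\mathbb{R}^d)$) is the set of nets $(f_\varepsilon)_\varepsilon\in\mathcal{O}_M(\mathbb{R}^d)^{(0,1]}$ such that $\forall l\in\mathbb{N}\ \exists q\in\mathbb{N}\ \exists N\in\mathbb{N}$, $\mu_{-q,l}(f_\varepsilon)=\mathrm{O}(\varepsilon^{-N})$ (resp. $\forall l\in\mathbb{N}\ \exists q\in\mathbb{N}\ \forall p\in\mathbb{N}$, $\mu_{-q,l}(f_\varepsilon)=\mathrm{O}(\varepsilon^{p})$). Classes in $\mathcal{G}_\tau$ are denoted $[\cdot]_\tau$. $\overline{\mathbb{C}}$ is the quotient ring of nets $(x_\varepsilon)_\varepsilon\in\mathbb{C}^{(0,1]}$ with $|x_\varepsilon|=\mathrm{O}(\varepsilon^{-N})$ for some $N\in\mathbb{N}$ modulo those with $|x_\varepsilon|=\mathrm{O}(\varepsilon^p)$ for all $p\in\mathbb{N}$. $\mathbf{L}(\cdot,\cdot)$ denotes $\overline{\mathbb{C}}$-linear maps, $\mathcal{L}(\cdot,\cdot)$ continuous linear maps between classical spaces. Sequence sets: $\mathcal{L}_0=\{q\in\mathbb{R}_+^{\mathbb{N}}:\lim_{l\to+\infty}q(l)/l=0\}$; for $a>0$, $\mathcal{L}_a=\{q\in\mathbb{R}_+^{\mathbb{N}}:\limsup_{l\to+\infty}q(l)/l<a\}$. $\mathcal{G}_{\mathcal S}^{\mathcal{L}_a}(\mathbb{R}^d)$ is the set of classes in $\mathcal{G}_{\mathcal S}(\mathbb{R}^d)$ of nets in $$\mathcal{E}_{\mathcal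 S}^{\mathcal{L}_a}(\mathbb{R}^d)=\{(f_\varepsilon)_\varepsilon\in\mathcal{E}_{\mathcal S}(\mathbb{R}^d):\exists N\in\mathcal{L}_a\ \forall q\in\mathbb{N}\ \forall l\in\mathbb{N},\ \mu_{q,l}(f_\varepsilon)=\mathrm{O}(\varepsilon^{-N(l)})\}.$$ A net $(L_\varepsilon)_\varepsilon\in\mathcal{L}(\mathcal{S}(\mathbb{R}^n),\mathcal{O}_M(\mathbb{R}^m))^{(0,1]}$ is $\mathcal{L}_{b,c}$-strongly moderate if there exist $\lambda\in\mathcal{L}_b$ and $r\in\mathcal{L}_c$ such that for all $l\in\mathbb{N}$ there exist $C\in\mathbb{R}_+$ and $(p,q)\in\mathbb{N}^2$ such that, for $\varepsilon$ small enough (uniformly in $f$), $\mu_{-p,l}(L_\varepsilon(f))\leq C\varepsilon^{-r(l)}\mu_{q,\lambda(l)}(f)$ for all $f\in\mathcal{S}(\mathbb{R}^n)$. The canonical extension of such a net is the well-defined map $L:\mathcal{G}_{\mathcal S}(\mathbb{R}^n)\to\mathcal{G}_\tau(\mathbb{R}^m)$, $L(f)=[(L_\varepsilon(f_\varepsilon))_\varepsilon]_\tau$, with $(f_\varepsilon)_\varepsilon$ any representative of $f$. *)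

theory Defs
  imports "HOL-Analysis.Analysis"
begin

section \<open>Smooth functions and weighted seminorms\<close>

definition partial_deriv ::
  "'a::euclidean_space \<Rightarrow> ('a \<Rightarrow> complex) \<Rightarrow> 'a \<Rightarrow> complex" where
  "partial_deriv b f x = vector_derivative (\<lambda>t::real. f (x + t *\<^sub>R b)) (at 0)"

primrec Ck :: "nat \<Rightarrow> ('a::euclidean_space \<Rightarrow> complex) \<Rightarrow> bool" where
  "Ck 0 f \<longleftrightarrow> continuous_on UNIV f"
| "Ck (Suc k) f \<longleftrightarrow> f differentiable_on UNIV \<and> (\<forall>b\<in>Basis. Ck k (partial_deriv b f))"

definition smooth :: "('a::euclidean_space \<Rightarrow> complex) \<Rightarrow> bool" where
  "smooth f \<longleftrightarrow> (\<forall>k. Ck k f)"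

text \<open>A multi-index is a function \<open>\<alpha> :: 'a \<Rightarrow> nat\<close>, of which only the values on \<open>Basis\<close> matter.
  A Euclidean space carries no canonical order of its coordinates, so one enumeration
  of \<open>Basis\<close> is chosen for the order of differentiation; for smooth functions the choice is
  irrelevant by the symmetry of iterated partial derivatives.\<close>

definition basis_enum :: "'a::euclidean_space list" where
  "basis_enum = (SOME bs. distinct bs \<and> set bs = Basis)"

definition multi_deriv ::
  "('a::euclidean_space \<Rightarrow> nat) \<Rightarrow> ('a \<Rightarrow> complex) \<Rightarrow> 'a \<Rightarrow> complex" where
  "multi_deriv \<alpha> f = foldr (\<lambda>b g. (partial_deriv b ^^ \<alpha> b) g) basis_enum f"

definition multi_order :: "('a::euclidean_space \<Rightarrow> nat) \<Rightarrow> nat" where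
  "multi_order \<alpha> = (\<Sum>b\<in>Basis. \<alpha> b)"

text \<open>The order bound \<open>l\<close> is real because it is instantiated below with the terms of
  real-valued sequences.\<close>

definition mu :: "int \<Rightarrow> real \<Rightarrow> ('a::euclidean_space \<Rightarrow> complex) \<Rightarrow> ennreal" where
  "mu r l f = (SUP (x, \<alpha>) \<in> UNIV \<times> {\<alpha>. real (multi_order \<alpha>) \<le> l}.
     ennreal ((1 + norm x) powi r * norm (multi_deriv \<alpha> f x)))"


section \<open>Rapidly decreasing functions and multipliers\<close>

definition schwartz :: "('a::euclidean_space \<Rightarrow> complex) set" where
  "schwartz = {f. smooth f \<and> (\<forall>q l::nat. mu (int q) (real l) f < \<infinity>)}"

definition mult_space :: "('a::euclidean_space \<Rightarrow> complex) set" where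
  "mult_space = {f. smooth f \<and> (\<forall>l::nat. \<exists>q::nat. mu (- int q) (real l) f < \<infinity>)}"

definition seminorm_topology ::
  "('a \<Rightarrow> complex) set \<Rightarrow> (('a \<Rightarrow> complex) \<Rightarrow> ennreal) set \<Rightarrow> ('a \<Rightarrow> complex) topology" where
  "seminorm_topology V P = topology_generated_by
     {{g \<in> V. p (\<lambda>x. g x - f x) < ennreal e} | f p e. f \<in> V \<and> p \<in> P \<and> 0 < e}"

definition schwartz_topology :: "('a::euclidean_space \<Rightarrow> complex) topology" where
  "schwartz_topology = seminorm_topology schwartz {mu (int q) (real l) | q l :: nat. True}"

text \<open>The usual topology of the space of multipliers: that of the seminorms
  \<open>f \<mapsto> sup |\<phi> \<partial>\<^sup>\<alpha> f|\<close>, where \<open>\<phi>\<close> is rapidly decreasing.\<close>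

definition mult_topology :: "('a::euclidean_space \<Rightarrow> complex) topology" where
  "mult_topology = seminorm_topology mult_space
     {(\<lambda>f. SUP x. ennreal (norm (\<phi> x * multi_deriv \<alpha> f x))) | \<phi> \<alpha>. \<phi> \<in> schwartz}"

definition cont_linear_maps ::
  "(('a::euclidean_space \<Rightarrow> complex) \<Rightarrow> ('b::euclidean_space \<Rightarrow> complex)) set" where
  "cont_linear_maps = {T. T \<in> schwartz \<rightarrow> mult_space \<and>
     (\<forall>f\<in>schwartz. \<forall>g\<in>schwartz. T (\<lambda>x. f x + g x) = (\<lambda>y. T f y + T g y)) \<and>
     (\<forall>z. \<forall>f\<in>schwartz. T (\<lambda>x. z * f x) = (\<lambda>y. z * T f y)) \<and>
     continuous_map schwartz_topology mult_topology T}"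


section \<open>Generalized functions and generalized numbers\<close>

text \<open>A net indexed by \<open>{0<..1}\<close> is a function on \<open>real\<close> whose values outside \<open>{0<..1}\<close> are
  unconstrained. All the equivalence relations below ignore these values, so the quotients are
  the same as for nets defined on \<open>{0<..1}\<close> only.\<close>

type_synonym 'a fnet = "real \<Rightarrow> 'a \<Rightarrow> complex"

text \<open>\<open>bigO_eps u s\<close> means \<open>u \<epsilon> = O(\<epsilon>\<^sup>s)\<close> as \<open>\<epsilon> \<rightarrow> 0\<close>, for a net with values in \<open>[0,\<infinity>]\<close>.\<close>

definition bigO_eps :: "(real \<Rightarrow> ennreal) \<Rightarrow> real \<Rightarrow> bool" where
  "bigO_eps u s \<longleftrightarrow>
     (\<exists>C\<ge>0. \<forall>\<^sub>F \<epsilon> in at_right 0. u \<epsilon> \<le> ennreal (C * \<epsilon> powr s))"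

definition E_S :: "'a::euclidean_space fnet set" where
  "E_S = {f. (\<forall>\<epsilon>\<in>{0<..1}. f \<epsilon> \<in> schwartz) \<and>
     (\<forall>q l::nat. \<exists>N::nat. bigO_eps (\<lambda>\<epsilon>. mu (int q) (real l) (f \<epsilon>)) (- real N))}"

definition N_S :: "'a::euclidean_space fnet set" where
  "N_S = {f. (\<forall>\<epsilon>\<in>{0<..1}. f \<epsilon> \<in> schwartz) \<and>
     (\<forall>q l::nat. \<forall>p::nat. bigO_eps (\<lambda>\<epsilon>. mu (int q) (real l) (f \<epsilon>)) (real p))}"

definition E_tau :: "'a::euclidean_space fnet set" where
  "E_tau = {f. (\<forall>\<epsilon>\<in>{0<..1}. f \<epsilon> \<in> mult_space) \<and>
     (\<forall>l::nat. \<exists>q::nat. \<exists>N::nat.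
        bigO_eps (\<lambda>\<epsilon>. mu (- int q) (real l) (f \<epsilon>)) (- real N))}"

definition N_tau :: "'a::euclidean_space fnet set" where
  "N_tau = {f. (\<forall>\<epsilon>\<in>{0<..1}. f \<epsilon> \<in> mult_space) \<and>
     (\<forall>l::nat. \<exists>q::nat. \<forall>p::nat.
        bigO_eps (\<lambda>\<epsilon>. mu (- int q) (real l) (f \<epsilon>)) (real p))}"

definition E_C :: "(real \<Rightarrow> complex) set" where
  "E_C = {x. \<exists>N::nat. bigO_eps (\<lambda>\<epsilon>. ennreal (norm (x \<epsilon>))) (- real N)}"

definition N_C :: "(real \<Rightarrow> complex) set" where
  "N_C = {x. \<forall>p::nat. bigO_eps (\<lambda>\<epsilon>. ennreal (norm (x \<epsilon>))) (real p)}"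

definition rel_S :: "'a::euclidean_space fnet rel" where
  "rel_S = {(f, g). f \<in> E_S \<and> g \<in> E_S \<and> (\<lambda>\<epsilon> x. f \<epsilon> x - g \<epsilon> x) \<in> N_S}"

definition rel_tau :: "'a::euclidean_space fnet rel" where
  "rel_tau = {(f, g). f \<in> E_tau \<and> g \<in> E_tau \<and> (\<lambda>\<epsilon> x. f \<epsilon> x - g \<epsilon> x) \<in> N_tau}"

definition rel_C :: "(real \<Rightarrow> complex) rel" where
  "rel_C = {(x, y). x \<in> E_C \<and> y \<in> E_C \<and> (\<lambda>\<epsilon>. x \<epsilon> - y \<epsilon>) \<in> N_C}"

definition G_S :: "'a::euclidean_space fnet set set" where
  "G_S = E_S // rel_S"

definition G_tau :: "'a::euclidean_space fnet set set" where
  "G_tau = E_tau // rel_tau"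

definition C_bar :: "(real \<Rightarrow> complex) set set" where
  "C_bar = E_C // rel_C"

definition class_tau :: "'a::euclidean_space fnet \<Rightarrow> 'a fnet set" where
  "class_tau f = rel_tau `` {f}"

text \<open>Addition and scalar multiplication on a quotient space of nets, for an arbitrary
  equivalence relation \<open>R\<close>, in representatives.\<close>

definition class_add :: "'a fnet rel \<Rightarrow> 'a fnet set \<Rightarrow> 'a fnet set \<Rightarrow> 'a fnet set" where
  "class_add R F G = (\<Union>f\<in>F. \<Union>g\<in>G. R `` {\<lambda>\<epsilon> x. f \<epsilon> x + g \<epsilon> x})"

definition class_scale ::
  "'a fnet rel \<Rightarrow> (real \<Rightarrow> complex) set \<Rightarrow> 'a fnet set \<Rightarrow> 'a fnet set" where
  "class_scale R Z F = (\<Union>z\<in>Z. \<Union>f\<in>F. R `` {\<lambda>\<epsilon> x. z \<epsilon> * f \<epsilon> x})"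

definition C_bar_linear_maps ::
  "('a::euclidean_space fnet set \<Rightarrow> 'b::euclidean_space fnet set) set" where
  "C_bar_linear_maps = {L. L \<in> G_S \<rightarrow> G_tau \<and>
     (\<forall>F\<in>G_S. \<forall>G\<in>G_S. L (class_add rel_S F G) = class_add rel_tau (L F) (L G)) \<and>
     (\<forall>Z\<in>C_bar. \<forall>F\<in>G_S. L (class_scale rel_S Z F) = class_scale rel_tau Z (L F))}"


section \<open>Regular subspaces and strongly moderate nets\<close>

definition seq_set :: "real \<Rightarrow> (nat \<Rightarrow> real) set" where
  "seq_set a = {q. (\<forall>l. 0 \<le> q l) \<and>
     (if a = 0 then (\<lambda>l. q l / real l) \<longlonglongrightarrow> 0
      else limsup (\<lambda>l. ereal (q l / real l)) < ereal a)}"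

definition E_S_reg :: "real \<Rightarrow> 'a::euclidean_space fnet set" where
  "E_S_reg a = {f \<in> E_S. \<exists>N\<in>seq_set a. \<forall>q l::nat.
     bigO_eps (\<lambda>\<epsilon>. mu (int q) (real l) (f \<epsilon>)) (- N l)}"

definition G_S_reg :: "real \<Rightarrow> 'a::euclidean_space fnet set set" where
  "G_S_reg a = E_S_reg a // rel_S"

definition strongly_moderate :: "real \<Rightarrow> real \<Rightarrow>
    (real \<Rightarrow> ('a::euclidean_space \<Rightarrow> complex) \<Rightarrow> ('b::euclidean_space \<Rightarrow> complex)) \<Rightarrow> bool" where
  "strongly_moderate b c T \<longleftrightarrow> (\<exists>lam\<in>seq_set b. \<exists>r\<in>seq_set c. \<forall>l::nat. \<exists>C\<ge>0. \<exists>p q::nat.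
     \<forall>\<^sub>F \<epsilon> in at_right 0. \<forall>f\<in>schwartz.
       mu (- int p) (real l) (T \<epsilon> f) \<le> ennreal (C * \<epsilon> powr (- r l)) * mu (int q) (lam l) f)"

definition canonical_extension ::
  "(real \<Rightarrow> ('a::euclidean_space \<Rightarrow> complex) \<Rightarrow> ('b::euclidean_space \<Rightarrow> complex)) \<Rightarrow>
   ('a fnet set \<Rightarrow> 'b fnet set) \<Rightarrow> bool" where
  "canonical_extension T L \<longleftrightarrow>
     (\<forall>F\<in>G_S. \<forall>f\<in>F. L F = class_tau (\<lambda>\<epsilon>. T \<epsilon> (f \<epsilon>)))"


section \<open>The canonical extension is well defined and linear\<close>

lemma basis_enum: "set (basis_enum :: 'a::euclidean_space list) = Basis"
  unfolding basis_enum_def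
  by (metis (mono_tags, lifting) someI_ex finite_Basis finite_distinct_list)

lemma Ck_Suc_D: "Ck (Suc k) f \<Longrightarrow> Ck k f"
proof (induction k arbitrary: f)
  case 0 then show ?case by (simp add: differentiable_imp_continuous_on)
next
  case (Suc k) then show ?case by (metis Ck.simps(2))
qed

lemma smooth_differentiable: "smooth f \<Longrightarrow> f differentiable_on UNIV"
  unfolding smooth_def by (metis Ck.simps(2))

lemma smooth_partial_deriv: "smooth f \<Longrightarrow> b \<in> Basis \<Longrightarrow> smooth (partial_deriv b f)"
  unfolding smooth_def by (metis Ck.simps(2))

lemma partial_deriv_works:
  assumes "f differentiable_on UNIV"
  shows "((\<lambda>t::real. f (x + t *\<^sub>R b)) has_vector_derivative partial_deriv b f x) (at 0)"
proof -
  have "(\<lambda>t::real. f (x + t *\<^sub>R b)) differentiable at 0"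
    using assms unfolding differentiable_on_def
    by (intro differentiable_chain_at[of "\<lambda>t::real. x + t *\<^sub>R b" 0 f, unfolded o_def])
       (auto intro!: derivative_intros)
  then show ?thesis
    unfolding partial_deriv_def by (simp add: vector_derivative_works)
qed

lemma partial_deriv_lincomb:
  assumes "f differentiable_on UNIV" "g differentiable_on UNIV"
  shows "partial_deriv b (\<lambda>x. z * f x + w * g x) =
    (\<lambda>x. z * partial_deriv b f x + w * partial_deriv b g x)"
proof
  fix x
  have "((\<lambda>t::real. z * f (x + t *\<^sub>R b) + w * g (x + t *\<^sub>R b)) has_vector_derivative
     z * partial_deriv b f x + w * partial_deriv b g x) (at 0)"
    using assms by (intro derivative_intros partial_deriv_works has_vector_derivative_mult_right)
  then show "partial_deriv b (\<lambda>x. z * f x + w * g x) x = z * partial_deriv b f x + w * partial_deriv b g x"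
    unfolding partial_deriv_def[of b "\<lambda>x. z * f x + w * g x"] by (rule vector_derivative_at)
qed

lemma Ck_lincomb: "Ck k f \<Longrightarrow> Ck k g \<Longrightarrow> Ck k (\<lambda>x. z * f x + w * g x)"
proof (induction k arbitrary: f g)
  case 0 then show ?case by (auto intro!: continuous_intros)
next
  case (Suc k)
  then have d: "f differentiable_on UNIV" "g differentiable_on UNIV" by auto
  have "(\<lambda>x. z * f x + w * g x) differentiable_on UNIV"
    using d by (intro differentiable_on_add differentiable_on_mult differentiable_on_const)
  moreover have "Ck k (partial_deriv b (\<lambda>x. z * f x + w * g x))" if "b \<in> Basis" for b
    unfolding partial_deriv_lincomb[OF d] using Suc that by simp
  ultimately show ?case by simp
qed

lemma smooth_lincomb: "smooth f \<Longrightarrow> smooth g \<Longrightarrow> smooth (\<lambda>x. z * f x + w * g x)"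
  by (simp add: smooth_def Ck_lincomb)

lemma partial_deriv_pow_lincomb:
  assumes "smooth f" "smooth g" "b \<in> Basis"
  shows "(partial_deriv b ^^ k) (\<lambda>x. z * f x + w * g x) =
    (\<lambda>x. z * (partial_deriv b ^^ k) f x + w * (partial_deriv b ^^ k) g x)"
    and "smooth ((partial_deriv b ^^ k) f)" and "smooth ((partial_deriv b ^^ k) g)"
proof (induction k)
  case 0
  case 1 show ?case using assms by simp
  case 2 show ?case using assms by simp
  case 3 show ?case using assms by simp
next
  case (Suc k)
  case 1 show ?case
    unfolding funpow.simps o_apply Suc.IH(1)
    by (rule partial_deriv_lincomb) (rule smooth_differentiable, rule Suc.IH)+
  case 2 show ?case using smooth_partial_deriv[OF Suc.IH(2) assms(3)] by simp
  case 3 show ?case using smooth_partial_deriv[OF Suc.IH(3) assms(3)] by simp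
qed

lemma foldr_partial_lincomb:
  fixes f g :: "'a::euclidean_space \<Rightarrow> complex" and \<alpha> :: "'a \<Rightarrow> nat"
  assumes "smooth f" "smooth g" "set bs \<subseteq> Basis"
  defines "D \<equiv> foldr (\<lambda>b. partial_deriv b ^^ \<alpha> b)"
  shows "D bs (\<lambda>x. z * f x + w * g x) = (\<lambda>x. z * D bs f x + w * D bs g x)
    \<and> smooth (D bs f) \<and> smooth (D bs g)"
  using assms(3)
proof (induction bs)
  case Nil
  show ?case using assms(1,2) by (simp add: D_def)
next
  case (Cons b bs)
  have b: "b \<in> Basis" and "set bs \<subseteq> Basis" using Cons.prems by auto
  note IH = Cons.IH[OF this(2)]
  have D: "D (b # bs) h = (partial_deriv b ^^ \<alpha> b) (D bs h)" for h by (simp add: D_def)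
  show ?case
    unfolding D conjunct1[OF IH]
    using partial_deriv_pow_lincomb[of "D bs f" "D bs g" b] IH b by blast
qed

lemma multi_deriv_lincomb:
  assumes "smooth f" "smooth g"
  shows "multi_deriv \<alpha> (\<lambda>x. z * f x + w * g x) =
    (\<lambda>x. z * multi_deriv \<alpha> f x + w * multi_deriv \<alpha> g x)"
  unfolding multi_deriv_def
  by (rule conjunct1[OF foldr_partial_lincomb[OF assms]]) (simp add: basis_enum)

lemma mu_le_iff: "mu r l f \<le> B \<longleftrightarrow>
  (\<forall>x \<alpha>. real (multi_order \<alpha>) \<le> l \<longrightarrow> ennreal ((1 + norm x) powi r * norm (multi_deriv \<alpha> f x)) \<le> B)"
  unfolding mu_def by (auto simp: SUP_le_iff)

lemma mu_upper: "real (multi_order \<alpha>) \<le> l \<Longrightarrow>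
   ennreal ((1 + norm x) powi r * norm (multi_deriv \<alpha> f x)) \<le> mu r l f"
  using mu_le_iff[of r l f "mu r l f"] by auto

lemma mu_mono: "r \<le> r' \<Longrightarrow> l \<le> l' \<Longrightarrow> mu r l f \<le> mu r' l' f"
  unfolding mu_le_iff
  by (auto intro!: order_trans[OF _ mu_upper[of _ l']] ennreal_leI mult_right_mono power_int_increasing)

lemma mu_lincomb:
  fixes f g :: "'a::euclidean_space \<Rightarrow> complex"
  assumes "smooth f" "smooth g"
  shows "mu r l (\<lambda>x. z * f x + w * g x) \<le> ennreal (norm z) * mu r l f + ennreal (norm w) * mu r l g"
  unfolding mu_le_iff
proof (intro allI impI)
  fix x :: 'a and \<alpha> :: "'a \<Rightarrow> nat" assume a: "real (multi_order \<alpha>) \<le> l"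
  let ?k = "(1 + norm x) powi r"
  have k: "?k \<ge> 0" by (simp add: zero_le_power_int)
  let ?F = "norm (multi_deriv \<alpha> f x)" and ?G = "norm (multi_deriv \<alpha> g x)"
  have "norm (multi_deriv \<alpha> (\<lambda>x. z * f x + w * g x) x) \<le> norm z * ?F + norm w * ?G"
    unfolding multi_deriv_lincomb[OF assms] by (rule norm_triangle_le) (simp add: norm_mult)
  from mult_left_mono[OF this k]
  have "?k * norm (multi_deriv \<alpha> (\<lambda>x. z * f x + w * g x) x) \<le> norm z * (?k * ?F) + norm w * (?k * ?G)"
    by (simp add: algebra_simps)
  then have "ennreal (?k * norm (multi_deriv \<alpha> (\<lambda>x. z * f x + w * g x) x)) \<le>
     ennreal (norm z * (?k * ?F) + norm w * (?k * ?G))" by (rule ennreal_leI)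
  also have "\<dots> = ennreal (norm z) * ennreal (?k * ?F) + ennreal (norm w) * ennreal (?k * ?G)"
    using k by (simp add: ennreal_mult ennreal_plus)
  also have "\<dots> \<le> ennreal (norm z) * mu r l f + ennreal (norm w) * mu r l g"
    by (intro add_mono mult_left_mono mu_upper a) auto
  finally show "ennreal (?k * norm (multi_deriv \<alpha> (\<lambda>x. z * f x + w * g x) x)) \<le> \<dots>" .
qed

lemma mu_lincomb_finite:
  assumes "smooth f" "smooth g" "mu r l f < \<infinity>" "mu r l g < \<infinity>"
  shows "mu r l (\<lambda>x. z * f x + w * g x) < \<infinity>"
  by (rule order_le_less_trans[OF mu_lincomb[OF assms(1,2)]])
    (use assms(3,4) in \<open>simp add: ennreal_add_eq_top ennreal_mult_less_top less_top[symmetric] ennreal_mult_eq_top_iff\<close>)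

lemma schwartz_lincomb:
  assumes "f \<in> schwartz" "g \<in> schwartz"
  shows "(\<lambda>x. z * f x + w * g x) \<in> schwartz"
  using smooth_lincomb mu_lincomb_finite assms unfolding schwartz_def mem_Collect_eq by blast

lemma mult_space_lincomb:
  assumes "f \<in> mult_space" "g \<in> mult_space"
  shows "(\<lambda>x. z * f x + w * g x) \<in> mult_space"
  unfolding mult_space_def
proof (safe)
  show "smooth (\<lambda>x. z * f x + w * g x)" using assms by (simp add: mult_space_def smooth_lincomb)
  fix l :: nat
  obtain q q' :: nat where q: "mu (- int q) l f < \<infinity>" "mu (- int q') l g < \<infinity>"
    using assms unfolding mult_space_def by blast
  let ?q = "max q q'"
  have f: "mu (- int ?q) l f < \<infinity>"
    by (rule order_le_less_trans[OF mu_mono q(1)]) simp_all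
  have g: "mu (- int ?q) l g < \<infinity>"
    by (rule order_le_less_trans[OF mu_mono q(2)]) simp_all
  show "\<exists>q::nat. mu (- int q) l (\<lambda>x. z * f x + w * g x) < \<infinity>"
    using mu_lincomb_finite[OF _ _ f g] assms unfolding mult_space_def by blast
qed

lemma bigO_eps_mono:
  assumes "bigO_eps u s" "s' \<le> s" "\<forall>\<^sub>F \<epsilon> in at_right 0. v \<epsilon> \<le> u \<epsilon>"
  shows "bigO_eps v s'"
proof -
  obtain C where C: "C \<ge> 0" "\<forall>\<^sub>F \<epsilon> in at_right 0. u \<epsilon> \<le> ennreal (C * \<epsilon> powr s)"
    using assms unfolding bigO_eps_def by blast
  have 1: "\<forall>\<^sub>F \<epsilon> in at_right (0::real). \<epsilon> \<in> {0<..<1}" by (rule eventually_at_right_real) simp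
  have "\<forall>\<^sub>F \<epsilon> in at_right 0. v \<epsilon> \<le> ennreal (C * \<epsilon> powr s')"
    using C(2) assms(3) 1
  proof eventually_elim
    case (elim \<epsilon>)
    have "\<epsilon> powr s \<le> \<epsilon> powr s'" using elim assms by (intro powr_mono') auto
    then show ?case using elim C(1) by (meson ennreal_leI mult_left_mono order_trans)
  qed
  then show ?thesis using C unfolding bigO_eps_def by blast
qed

lemma bigO_eps_add:
  assumes "bigO_eps u s" "bigO_eps v s"
  shows "bigO_eps (\<lambda>\<epsilon>. u \<epsilon> + v \<epsilon>) s"
proof -
  obtain C D where C: "C \<ge> 0" "\<forall>\<^sub>F \<epsilon> in at_right 0. u \<epsilon> \<le> ennreal (C * \<epsilon> powr s)"
    and D: "D \<ge> 0" "\<forall>\<^sub>F \<epsilon> in at_right 0. v \<epsilon> \<le> ennreal (D * \<epsilon> powr s)"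
    using assms unfolding bigO_eps_def by blast
  have "\<forall>\<^sub>F \<epsilon> in at_right 0. u \<epsilon> + v \<epsilon> \<le> ennreal ((C + D) * \<epsilon> powr s)"
    using C(2) D(2)
  proof eventually_elim
    case (elim \<epsilon>)
    then have "u \<epsilon> + v \<epsilon> \<le> ennreal (C * \<epsilon> powr s) + ennreal (D * \<epsilon> powr s)" by (rule add_mono)
    also have "\<dots> = ennreal ((C + D) * \<epsilon> powr s)"
      using C(1) D(1) by (simp flip: ennreal_plus add: distrib_right)
    finally show ?case .
  qed
  then show ?thesis unfolding bigO_eps_def by (intro exI[of _ "C + D"] conjI) (use C(1) D(1) in simp)
qed

lemma bigO_eps_mult:
  assumes "bigO_eps u s" "bigO_eps v t"
  shows "bigO_eps (\<lambda>\<epsilon>. u \<epsilon> * v \<epsilon>) (s + t)"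
proof -
  obtain C D where C: "C \<ge> 0" "\<forall>\<^sub>F \<epsilon> in at_right 0. u \<epsilon> \<le> ennreal (C * \<epsilon> powr s)"
    and D: "D \<ge> 0" "\<forall>\<^sub>F \<epsilon> in at_right 0. v \<epsilon> \<le> ennreal (D * \<epsilon> powr t)"
    using assms unfolding bigO_eps_def by blast
  have "\<forall>\<^sub>F \<epsilon> in at_right 0. u \<epsilon> * v \<epsilon> \<le> ennreal ((C * D) * \<epsilon> powr (s + t))"
    using C(2) D(2)
  proof eventually_elim
    case (elim \<epsilon>)
    have "u \<epsilon> * v \<epsilon> \<le> ennreal (C * \<epsilon> powr s) * ennreal (D * \<epsilon> powr t)"
      using elim by (intro mult_mono) auto
    also have "\<dots> = ennreal ((C * D) * \<epsilon> powr (s + t))"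
      using C(1) D(1) by (simp flip: ennreal_mult add: powr_add mult_ac)
    finally show ?case .
  qed
  then show ?thesis unfolding bigO_eps_def by (intro exI[of _ "C * D"] conjI) (use C(1) D(1) in simp)
qed

lemma bigO_lincomb:
  assumes "\<forall>\<epsilon>\<in>{0<..1}. smooth (f \<epsilon>) \<and> smooth (g \<epsilon>)"
    "bigO_eps (\<lambda>\<epsilon>. ennreal (norm (z \<epsilon>))) s" "bigO_eps (\<lambda>\<epsilon>. mu r l (f \<epsilon>)) t"
    "bigO_eps (\<lambda>\<epsilon>. ennreal (norm (w \<epsilon>))) s'" "bigO_eps (\<lambda>\<epsilon>. mu r l (g \<epsilon>)) t'"
    "k \<le> s + t" "k \<le> s' + t'"
  shows "bigO_eps (\<lambda>\<epsilon>. mu r l (\<lambda>x. z \<epsilon> * f \<epsilon> x + w \<epsilon> * g \<epsilon> x)) k"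
proof -
  have "\<forall>\<^sub>F \<epsilon> in at_right (0::real). \<epsilon> \<in> {0<..<1}" by (rule eventually_at_right_real) simp
  then have ev: "\<forall>\<^sub>F \<epsilon> in at_right 0. mu r l (\<lambda>x. z \<epsilon> * f \<epsilon> x + w \<epsilon> * g \<epsilon> x)
     \<le> ennreal (norm (z \<epsilon>)) * mu r l (f \<epsilon>) + ennreal (norm (w \<epsilon>)) * mu r l (g \<epsilon>)"
  proof eventually_elim
    case (elim \<epsilon>)
    then have "smooth (f \<epsilon>)" "smooth (g \<epsilon>)" using assms(1) by auto
    then show ?case by (rule mu_lincomb)
  qed
  have 1: "bigO_eps (\<lambda>\<epsilon>. ennreal (norm (z \<epsilon>)) * mu r l (f \<epsilon>)) k"
    by (rule bigO_eps_mono[OF bigO_eps_mult[OF assms(2,3)] assms(6)]) simp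
  have 2: "bigO_eps (\<lambda>\<epsilon>. ennreal (norm (w \<epsilon>)) * mu r l (g \<epsilon>)) k"
    by (rule bigO_eps_mono[OF bigO_eps_mult[OF assms(4,5)] assms(7)]) simp
  show ?thesis by (rule bigO_eps_mono[OF bigO_eps_add[OF 1 2] order_refl ev])
qed

lemma E_C_const: "(\<lambda>\<epsilon>. c) \<in> E_C"
  unfolding E_C_def bigO_eps_def
proof (intro CollectI exI conjI)
  show "\<forall>\<^sub>F \<epsilon> in at_right 0. ennreal (norm c) \<le> ennreal (norm c * \<epsilon> powr - real 0)"
    by (rule eventually_mono[OF eventually_at_right_real[of 0 1]]) auto
qed simp

lemma N_C_E_C: "z \<in> N_C \<Longrightarrow> z \<in> E_C"
  unfolding N_C_def E_C_def by (force dest: spec[of _ 0] intro: exI[of _ 0])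

lemma E_S_lincomb:
  assumes "f \<in> E_S" "g \<in> E_S" "z \<in> E_C" "w \<in> E_C"
  shows "(\<lambda>\<epsilon> x. z \<epsilon> * f \<epsilon> x + w \<epsilon> * g \<epsilon> x) \<in> E_S"
  unfolding E_S_def
proof (intro CollectI conjI allI ballI)
  fix q l :: nat
  obtain M N where 1: "bigO_eps (\<lambda>\<epsilon>. mu (int q) (real l) (f \<epsilon>)) (- real N)"
     "bigO_eps (\<lambda>\<epsilon>. mu (int q) (real l) (g \<epsilon>)) (- real M)"
    using assms(1,2) unfolding E_S_def by blast
  obtain M' N' where 2: "bigO_eps (\<lambda>\<epsilon>. ennreal (norm (z \<epsilon>))) (- real N')" "bigO_eps (\<lambda>\<epsilon>. ennreal (norm (w \<epsilon>))) (- real M')"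
    using assms(3,4) unfolding E_C_def by blast
  have sm: "\<forall>\<epsilon>\<in>{0<..1}. smooth (f \<epsilon>) \<and> smooth (g \<epsilon>)" using assms(1,2) by (auto simp: E_S_def schwartz_def)
  have *: "bigO_eps (\<lambda>\<epsilon>. mu (int q) (real l) (\<lambda>x. z \<epsilon> * f \<epsilon> x + w \<epsilon> * g \<epsilon> x)) (- real (N + M + N' + M'))"
    by (rule bigO_lincomb[OF sm 2(1) 1(1) 2(2) 1(2)]) simp_all
  show "\<exists>N. bigO_eps (\<lambda>\<epsilon>. mu (int q) (real l) (\<lambda>x. z \<epsilon> * f \<epsilon> x + w \<epsilon> * g \<epsilon> x)) (- real N)"
    using * by blast
next
  fix \<epsilon> :: real assume "\<epsilon> \<in> {0<..1}"
  then have "f \<epsilon> \<in> schwartz" "g \<epsilon> \<in> schwartz" using assms(1,2) unfolding E_S_def by blast+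
  then show "(\<lambda>x. z \<epsilon> * f \<epsilon> x + w \<epsilon> * g \<epsilon> x) \<in> schwartz" by (rule schwartz_lincomb)
qed

lemma N_S_lincomb:
  assumes "f \<in> E_S" "g \<in> E_S" "z \<in> E_C" "w \<in> E_C"
    "f \<in> N_S \<or> z \<in> N_C" "g \<in> N_S \<or> w \<in> N_C"
  shows "(\<lambda>\<epsilon> x. z \<epsilon> * f \<epsilon> x + w \<epsilon> * g \<epsilon> x) \<in> N_S"
  unfolding N_S_def
proof (intro CollectI conjI allI ballI)
  fix q l p :: nat
  have *: "\<exists>s t. real p \<le> s + t \<and> bigO_eps (\<lambda>\<epsilon>. ennreal (norm (z \<epsilon>))) s \<and> bigO_eps (\<lambda>\<epsilon>. mu (int q) (real l) (f \<epsilon>)) t"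
    if A: "f \<in> N_S \<or> z \<in> N_C" "f \<in> E_S" "z \<in> E_C" for f :: "'a fnet" and z
  proof -
    obtain N N' where 1: "bigO_eps (\<lambda>\<epsilon>. mu (int q) (real l) (f \<epsilon>)) (- real N)"
      "bigO_eps (\<lambda>\<epsilon>. ennreal (norm (z \<epsilon>))) (- real N')"
      using A unfolding E_S_def E_C_def by blast
    from A(1) show ?thesis
    proof
      assume "f \<in> N_S"
      then have "bigO_eps (\<lambda>\<epsilon>. mu (int q) (real l) (f \<epsilon>)) (real (p + N'))" unfolding N_S_def by blast
      then show ?thesis using 1(2) by (intro exI[of _ "- real N'"] exI[of _ "real (p + N')"]) auto
    next
      assume "z \<in> N_C"
      then have "bigO_eps (\<lambda>\<epsilon>. ennreal (norm (z \<epsilon>))) (real (p + N))" unfolding N_C_def by blast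
      then show ?thesis using 1(1) by (intro exI[of _ "- real N"] exI[of _ "real (p + N)"]) auto
    qed
  qed
  obtain s t s' t' where st: "real p \<le> s + t" "bigO_eps (\<lambda>\<epsilon>. ennreal (norm (z \<epsilon>))) s" "bigO_eps (\<lambda>\<epsilon>. mu (int q) (real l) (f \<epsilon>)) t"
    "real p \<le> s' + t'" "bigO_eps (\<lambda>\<epsilon>. ennreal (norm (w \<epsilon>))) s'" "bigO_eps (\<lambda>\<epsilon>. mu (int q) (real l) (g \<epsilon>)) t'"
    using *[OF assms(5,1,3)] *[OF assms(6,2,4)] by blast
  have sm: "\<forall>\<epsilon>\<in>{0<..1}. smooth (f \<epsilon>) \<and> smooth (g \<epsilon>)" using assms(1,2) by (auto simp: E_S_def schwartz_def)
  show "bigO_eps (\<lambda>\<epsilon>. mu (int q) (real l) (\<lambda>x. z \<epsilon> * f \<epsilon> x + w \<epsilon> * g \<epsilon> x)) (real p)"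
    by (rule bigO_lincomb[OF sm st(2,3,5,6,1,4)])
next
  fix \<epsilon> :: real assume "\<epsilon> \<in> {0<..1}"
  then have "f \<epsilon> \<in> schwartz" "g \<epsilon> \<in> schwartz" using assms(1,2) unfolding E_S_def by blast+
  then show "(\<lambda>x. z \<epsilon> * f \<epsilon> x + w \<epsilon> * g \<epsilon> x) \<in> schwartz" by (rule schwartz_lincomb)
qed

lemma E_tau_lincomb:
  assumes "f \<in> E_tau" "g \<in> E_tau" "z \<in> E_C" "w \<in> E_C"
  shows "(\<lambda>\<epsilon> x. z \<epsilon> * f \<epsilon> x + w \<epsilon> * g \<epsilon> x) \<in> E_tau"
  unfolding E_tau_def
proof (intro CollectI conjI allI ballI)
  fix l :: nat
  obtain Q R M N where 1: "bigO_eps (\<lambda>\<epsilon>. mu (- int Q) (real l) (f \<epsilon>)) (- real N)"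
     "bigO_eps (\<lambda>\<epsilon>. mu (- int R) (real l) (g \<epsilon>)) (- real M)"
    using assms(1,2) unfolding E_tau_def by blast
  have 3: "bigO_eps (\<lambda>\<epsilon>. mu (- int (Q + R)) (real l) (f \<epsilon>)) (- real N)"
     "bigO_eps (\<lambda>\<epsilon>. mu (- int (Q + R)) (real l) (g \<epsilon>)) (- real M)"
    by (rule bigO_eps_mono[OF 1(1)] bigO_eps_mono[OF 1(2)]; auto intro!: mu_mono always_eventually)+
  obtain M' N' where 2: "bigO_eps (\<lambda>\<epsilon>. ennreal (norm (z \<epsilon>))) (- real N')" "bigO_eps (\<lambda>\<epsilon>. ennreal (norm (w \<epsilon>))) (- real M')"
    using assms(3,4) unfolding E_C_def by blast
  have sm: "\<forall>\<epsilon>\<in>{0<..1}. smooth (f \<epsilon>) \<and> smooth (g \<epsilon>)" using assms(1,2) by (auto simp: E_tau_def mult_space_def)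
  have *: "bigO_eps (\<lambda>\<epsilon>. mu (- int (Q + R)) (real l) (\<lambda>x. z \<epsilon> * f \<epsilon> x + w \<epsilon> * g \<epsilon> x)) (- real (N + M + N' + M'))"
    by (rule bigO_lincomb[OF sm 2(1) 3(1) 2(2) 3(2)]) simp_all
  show "\<exists>q N. bigO_eps (\<lambda>\<epsilon>. mu (- int q) (real l) (\<lambda>x. z \<epsilon> * f \<epsilon> x + w \<epsilon> * g \<epsilon> x)) (- real N)"
    using * by blast
next
  fix \<epsilon> :: real assume "\<epsilon> \<in> {0<..1}"
  then have "f \<epsilon> \<in> mult_space" "g \<epsilon> \<in> mult_space" using assms(1,2) unfolding E_tau_def by blast+
  then show "(\<lambda>x. z \<epsilon> * f \<epsilon> x + w \<epsilon> * g \<epsilon> x) \<in> mult_space" by (rule mult_space_lincomb)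
qed

lemma N_tau_lincomb:
  assumes "f \<in> E_tau" "g \<in> E_tau" "z \<in> E_C" "w \<in> E_C"
    "f \<in> N_tau \<or> z \<in> N_C" "g \<in> N_tau \<or> w \<in> N_C"
  shows "(\<lambda>\<epsilon> x. z \<epsilon> * f \<epsilon> x + w \<epsilon> * g \<epsilon> x) \<in> N_tau"
  unfolding N_tau_def
proof (intro CollectI conjI allI ballI)
  fix l :: nat
  have *: "\<exists>Q::nat. \<forall>R\<ge>Q. \<forall>p::nat. \<exists>s t. real p \<le> s + t \<and> bigO_eps (\<lambda>\<epsilon>. ennreal (norm (z \<epsilon>))) s \<and> bigO_eps (\<lambda>\<epsilon>. mu (- int R) (real l) (f \<epsilon>)) t"
    if A: "f \<in> N_tau \<or> z \<in> N_C" "f \<in> E_tau" "z \<in> E_C" for f :: "'a fnet" and z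
  proof -
    obtain Q N N' where 1: "bigO_eps (\<lambda>\<epsilon>. mu (- int Q) (real l) (f \<epsilon>)) (- real N)"
      "bigO_eps (\<lambda>\<epsilon>. ennreal (norm (z \<epsilon>))) (- real N')"
      using A unfolding E_tau_def E_C_def by blast
    have up: "bigO_eps (\<lambda>\<epsilon>. mu (- int R) (real l) (f \<epsilon>)) s"
      if "bigO_eps (\<lambda>\<epsilon>. mu (- int R') (real l) (f \<epsilon>)) s" "R' \<le> R" for R R' s
      by (rule bigO_eps_mono[OF that(1)]) (use that(2) in \<open>auto intro!: mu_mono always_eventually\<close>)
    from A(1) show ?thesis
    proof
      assume "f \<in> N_tau"
      then obtain Q' where Q': "\<And>p. bigO_eps (\<lambda>\<epsilon>. mu (- int Q') (real l) (f \<epsilon>)) (real p)" unfolding N_tau_def by blast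
      have "real p \<le> - real N' + real (p + N') \<and> bigO_eps (\<lambda>\<epsilon>. ennreal (norm (z \<epsilon>))) (- real N') \<and>
          bigO_eps (\<lambda>\<epsilon>. mu (- int R) (real l) (f \<epsilon>)) (real (p + N'))" if "Q' \<le> R" for R p
        by (intro conjI 1(2) up[OF Q' that]) simp
      then show ?thesis by blast
    next
      assume "z \<in> N_C"
      then have zN: "bigO_eps (\<lambda>\<epsilon>. ennreal (norm (z \<epsilon>))) (real (p + N))" for p unfolding N_C_def by blast
      have "real p \<le> real (p + N) + - real N \<and> bigO_eps (\<lambda>\<epsilon>. ennreal (norm (z \<epsilon>))) (real (p + N)) \<and>
          bigO_eps (\<lambda>\<epsilon>. mu (- int R) (real l) (f \<epsilon>)) (- real N)" if "Q \<le> R" for R p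
        by (intro conjI zN up[OF 1(1) that]) simp
      then show ?thesis by blast
    qed
  qed
  obtain Q1 Q2 :: nat where Q:
    "\<forall>R\<ge>Q1. \<forall>p::nat. \<exists>s t. real p \<le> s + t \<and> bigO_eps (\<lambda>\<epsilon>. ennreal (norm (z \<epsilon>))) s \<and> bigO_eps (\<lambda>\<epsilon>. mu (- int R) (real l) (f \<epsilon>)) t"
    "\<forall>R\<ge>Q2. \<forall>p::nat. \<exists>s t. real p \<le> s + t \<and> bigO_eps (\<lambda>\<epsilon>. ennreal (norm (w \<epsilon>))) s \<and> bigO_eps (\<lambda>\<epsilon>. mu (- int R) (real l) (g \<epsilon>)) t"
    using *[OF assms(5,1,3)] *[OF assms(6,2,4)] by blast
  have sm: "\<forall>\<epsilon>\<in>{0<..1}. smooth (f \<epsilon>) \<and> smooth (g \<epsilon>)" using assms(1,2) by (auto simp: E_tau_def mult_space_def)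
  have "bigO_eps (\<lambda>\<epsilon>. mu (- int (Q1 + Q2)) (real l) (\<lambda>x. z \<epsilon> * f \<epsilon> x + w \<epsilon> * g \<epsilon> x)) (real p)" for p
  proof -
    obtain s t where st: "real p \<le> s + t" "bigO_eps (\<lambda>\<epsilon>. ennreal (norm (z \<epsilon>))) s" "bigO_eps (\<lambda>\<epsilon>. mu (- int (Q1 + Q2)) (real l) (f \<epsilon>)) t"
      using Q(1)[rule_format, of "Q1 + Q2" p] by auto
    obtain s' t' where st': "real p \<le> s' + t'" "bigO_eps (\<lambda>\<epsilon>. ennreal (norm (w \<epsilon>))) s'" "bigO_eps (\<lambda>\<epsilon>. mu (- int (Q1 + Q2)) (real l) (g \<epsilon>)) t'"
      using Q(2)[rule_format, of "Q1 + Q2" p] by auto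
    show ?thesis by (rule bigO_lincomb[OF sm st(2,3) st'(2,3) st(1) st'(1)])
  qed
  then show "\<exists>q. \<forall>p. bigO_eps (\<lambda>\<epsilon>. mu (- int q) (real l) (\<lambda>x. z \<epsilon> * f \<epsilon> x + w \<epsilon> * g \<epsilon> x)) (real p)"
    by blast
next
  fix \<epsilon> :: real assume "\<epsilon> \<in> {0<..1}"
  then have "f \<epsilon> \<in> mult_space" "g \<epsilon> \<in> mult_space" using assms(1,2) unfolding E_tau_def by blast+
  then show "(\<lambda>x. z \<epsilon> * f \<epsilon> x + w \<epsilon> * g \<epsilon> x) \<in> mult_space" by (rule mult_space_lincomb)
qed


lemma E_S_minus:
  assumes "u \<in> E_S" "v \<in> E_S" shows "(\<lambda>\<epsilon> x. u \<epsilon> x - v \<epsilon> x) \<in> E_S"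
  using E_S_lincomb[OF assms E_C_const E_C_const, of 1 "-1"] by simp

lemma E_tau_minus:
  assumes "u \<in> E_tau" "v \<in> E_tau" shows "(\<lambda>\<epsilon> x. u \<epsilon> x - v \<epsilon> x) \<in> E_tau"
  using E_tau_lincomb[OF assms E_C_const E_C_const, of 1 "-1"] by simp

lemma E_S_scale:
  assumes "u \<in> E_S" "z \<in> E_C" shows "(\<lambda>\<epsilon> x. z \<epsilon> * u \<epsilon> x) \<in> E_S"
  using E_S_lincomb[OF assms(1,1) assms(2) E_C_const[of 0]] by simp

lemma E_tau_scale:
  assumes "u \<in> E_tau" "z \<in> E_C" shows "(\<lambda>\<epsilon> x. z \<epsilon> * u \<epsilon> x) \<in> E_tau"
  using E_tau_lincomb[OF assms(1,1) assms(2) E_C_const[of 0]] by simp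

lemma E_S_add:
  assumes "u \<in> E_S" "v \<in> E_S" shows "(\<lambda>\<epsilon> x. u \<epsilon> x + v \<epsilon> x) \<in> E_S"
  using E_S_lincomb[OF assms E_C_const E_C_const, of 1 1] by simp

lemma E_tau_add:
  assumes "u \<in> E_tau" "v \<in> E_tau" shows "(\<lambda>\<epsilon> x. u \<epsilon> x + v \<epsilon> x) \<in> E_tau"
  using E_tau_lincomb[OF assms E_C_const E_C_const, of 1 1] by simp

lemma N_C_zero: "(\<lambda>\<epsilon>. 0) \<in> N_C"
  unfolding N_C_def bigO_eps_def by auto

lemma E_tau_cong:
  assumes "f \<in> E_tau" "\<forall>\<epsilon>\<in>{0<..1}. f \<epsilon> = g \<epsilon>" shows "(f, g) \<in> rel_tau"
proof -
  have ev: "\<forall>\<^sub>F \<epsilon> in at_right (0::real). f \<epsilon> = g \<epsilon>"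
    by (rule eventually_mono[OF eventually_at_right_real[of 0 1]]) (use assms(2) in auto)
  have g: "g \<in> E_tau"
    unfolding E_tau_def
  proof (intro CollectI conjI allI ballI)
    fix l :: nat
    obtain q N where "bigO_eps (\<lambda>\<epsilon>. mu (- int q) (real l) (f \<epsilon>)) (- real N)"
      using assms(1) unfolding E_tau_def by blast
    then have "bigO_eps (\<lambda>\<epsilon>. mu (- int q) (real l) (g \<epsilon>)) (- real N)"
      by (rule bigO_eps_mono) (use ev in \<open>auto elim: eventually_mono\<close>)
    then show "\<exists>q N. bigO_eps (\<lambda>\<epsilon>. mu (- int q) (real l) (g \<epsilon>)) (- real N)" by blast
  qed (use assms in \<open>auto simp: E_tau_def\<close>)
  have 0: "(\<lambda>\<epsilon> x. 0 * f \<epsilon> x + 0 * f \<epsilon> x) \<in> N_tau"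
    using N_tau_lincomb[OF assms(1,1) E_C_const E_C_const] N_C_zero by blast
  have "(\<lambda>\<epsilon> x. f \<epsilon> x - g \<epsilon> x) \<in> N_tau"
    unfolding N_tau_def
  proof (intro CollectI conjI allI ballI)
    fix l :: nat
    obtain q where "\<And>p. bigO_eps (\<lambda>\<epsilon>. mu (- int q) (real l) (\<lambda>x. 0 * f \<epsilon> x + 0 * f \<epsilon> x)) (real p)"
      using 0 unfolding N_tau_def by blast
    then have "bigO_eps (\<lambda>\<epsilon>. mu (- int q) (real l) (\<lambda>x. f \<epsilon> x - g \<epsilon> x)) (real p)" for p
      by (rule bigO_eps_mono) (use ev in \<open>auto elim: eventually_mono\<close>)
    then show "\<exists>q. \<forall>p. bigO_eps (\<lambda>\<epsilon>. mu (- int q) (real l) (\<lambda>x. f \<epsilon> x - g \<epsilon> x)) (real p)" by blast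
  qed (use 0 assms(2) in \<open>auto simp: N_tau_def\<close>)
  then show ?thesis using assms g unfolding rel_tau_def by simp
qed

lemma equiv_rel_S: "equiv (E_S :: 'a::euclidean_space fnet set) rel_S"
proof (rule equivI)
  show "(rel_S :: 'a fnet rel) \<subseteq> E_S \<times> E_S" by (auto simp: rel_S_def)
  show "refl_on (E_S :: 'a fnet set) rel_S"
    by (rule refl_onI)
      (use N_S_lincomb[OF _ _ E_C_const E_C_const, of _ _ 0 0] N_C_zero in \<open>auto simp: rel_S_def\<close>)
  have m: "(\<lambda>\<epsilon> x. 1 * u \<epsilon> x + 1 * v \<epsilon> x) \<in> N_S" if "u \<in> E_S" "v \<in> E_S" "u \<in> N_S" "v \<in> N_S" for u v :: "'a fnet"
    using N_S_lincomb[OF that(1,2) E_C_const E_C_const] that by blast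
  have e: "(\<lambda>\<epsilon> x. u \<epsilon> x - v \<epsilon> x) \<in> E_S" if "u \<in> E_S" "v \<in> E_S" for u v :: "'a fnet"
    using E_S_lincomb[OF that(1,2) E_C_const E_C_const, of 1 "-1"] that by simp
  show "sym (rel_S :: 'a fnet rel)"
  proof (rule symI)
    fix f g :: "'a fnet" assume "(f, g) \<in> rel_S"
    then show "(g, f) \<in> rel_S"
      using N_S_lincomb[OF e e E_C_const E_C_const, of f g f g "-1" 0] N_C_zero by (auto simp: rel_S_def)
  qed
  show "trans (rel_S :: 'a fnet rel)"
  proof (rule transI)
    fix f g h :: "'a fnet" assume "(f, g) \<in> rel_S" "(g, h) \<in> rel_S"
    then show "(f, h) \<in> rel_S"
      using m[OF e e, of f g g h] by (auto simp: rel_S_def)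
  qed
qed

lemma equiv_rel_tau: "equiv (E_tau :: 'a::euclidean_space fnet set) rel_tau"
proof (rule equivI)
  show "(rel_tau :: 'a fnet rel) \<subseteq> E_tau \<times> E_tau" by (auto simp: rel_tau_def)
  show "refl_on (E_tau :: 'a fnet set) rel_tau"
    by (rule refl_onI) (auto intro: E_tau_cong)
  have m: "(\<lambda>\<epsilon> x. 1 * u \<epsilon> x + 1 * v \<epsilon> x) \<in> N_tau" if "u \<in> E_tau" "v \<in> E_tau" "u \<in> N_tau" "v \<in> N_tau" for u v :: "'a fnet"
    using N_tau_lincomb[OF that(1,2) E_C_const E_C_const] that by blast
  have e: "(\<lambda>\<epsilon> x. u \<epsilon> x - v \<epsilon> x) \<in> E_tau" if "u \<in> E_tau" "v \<in> E_tau" for u v :: "'a fnet"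
    using E_tau_lincomb[OF that(1,2) E_C_const E_C_const, of 1 "-1"] that by simp
  show "sym (rel_tau :: 'a fnet rel)"
  proof (rule symI)
    fix f g :: "'a fnet" assume "(f, g) \<in> rel_tau"
    then show "(g, f) \<in> rel_tau"
      using N_tau_lincomb[OF e e E_C_const E_C_const, of f g f g "-1" 0] N_C_zero by (auto simp: rel_tau_def)
  qed
  show "trans (rel_tau :: 'a fnet rel)"
  proof (rule transI)
    fix f g h :: "'a fnet" assume "(f, g) \<in> rel_tau" "(g, h) \<in> rel_tau"
    then show "(f, h) \<in> rel_tau"
      using m[OF e e, of f g g h] by (auto simp: rel_tau_def)
  qed
qed

lemma class_add_S:
  assumes "F \<in> G_S" "G \<in> G_S" "f \<in> F" "g \<in> G"
  shows "class_add rel_S F G = rel_S `` {\<lambda>\<epsilon> x. f \<epsilon> x + g \<epsilon> x}"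
proof -
  have "rel_S `` {\<lambda>\<epsilon> x. f' \<epsilon> x + g' \<epsilon> x} = rel_S `` {\<lambda>\<epsilon> x. f \<epsilon> x + g \<epsilon> x}"
    if "f' \<in> F" "g' \<in> G" for f' g'
  proof (rule equiv_class_eq[OF equiv_rel_S])
    have r: "(f', f) \<in> rel_S" "(g', g) \<in> rel_S"
      using that assms quotient_eq_iff[OF equiv_rel_S] unfolding G_S_def by blast+
    then have E: "f \<in> E_S" "f' \<in> E_S" "g \<in> E_S" "g' \<in> E_S" by (auto simp: rel_S_def)
    have "(\<lambda>\<epsilon> x. 1 * (f' \<epsilon> x - f \<epsilon> x) + 1 * (g' \<epsilon> x - g \<epsilon> x)) \<in> N_S"
      by (rule N_S_lincomb[OF E_S_minus[OF E(2,1)] E_S_minus[OF E(4,3)] E_C_const E_C_const])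
        (use r in \<open>simp_all add: rel_S_def\<close>)
    moreover have "(\<lambda>\<epsilon> x. 1 * (f' \<epsilon> x - f \<epsilon> x) + 1 * (g' \<epsilon> x - g \<epsilon> x)) = (\<lambda>\<epsilon> x. (f' \<epsilon> x + g' \<epsilon> x) - (f \<epsilon> x + g \<epsilon> x))"
      by (simp add: algebra_simps)
    ultimately have N: "(\<lambda>\<epsilon> x. (f' \<epsilon> x + g' \<epsilon> x) - (f \<epsilon> x + g \<epsilon> x)) \<in> N_S" by (rule back_subst)
    show "(\<lambda>\<epsilon> x. f' \<epsilon> x + g' \<epsilon> x, \<lambda>\<epsilon> x. f \<epsilon> x + g \<epsilon> x) \<in> rel_S"
      unfolding rel_S_def using E_S_add[OF E(2,4)] E_S_add[OF E(1,3)] N by blast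
  qed
  then show ?thesis unfolding class_add_def using assms(3,4) by blast
qed

lemma class_add_tau:
  assumes "F \<in> G_tau" "G \<in> G_tau" "f \<in> F" "g \<in> G"
  shows "class_add rel_tau F G = rel_tau `` {\<lambda>\<epsilon> x. f \<epsilon> x + g \<epsilon> x}"
proof -
  have "rel_tau `` {\<lambda>\<epsilon> x. f' \<epsilon> x + g' \<epsilon> x} = rel_tau `` {\<lambda>\<epsilon> x. f \<epsilon> x + g \<epsilon> x}"
    if "f' \<in> F" "g' \<in> G" for f' g'
  proof (rule equiv_class_eq[OF equiv_rel_tau])
    have r: "(f', f) \<in> rel_tau" "(g', g) \<in> rel_tau"
      using that assms quotient_eq_iff[OF equiv_rel_tau] unfolding G_tau_def by blast+
    then have E: "f \<in> E_tau" "f' \<in> E_tau" "g \<in> E_tau" "g' \<in> E_tau" by (auto simp: rel_tau_def)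
    have "(\<lambda>\<epsilon> x. 1 * (f' \<epsilon> x - f \<epsilon> x) + 1 * (g' \<epsilon> x - g \<epsilon> x)) \<in> N_tau"
      by (rule N_tau_lincomb[OF E_tau_minus[OF E(2,1)] E_tau_minus[OF E(4,3)] E_C_const E_C_const])
        (use r in \<open>simp_all add: rel_tau_def\<close>)
    moreover have "(\<lambda>\<epsilon> x. 1 * (f' \<epsilon> x - f \<epsilon> x) + 1 * (g' \<epsilon> x - g \<epsilon> x)) = (\<lambda>\<epsilon> x. (f' \<epsilon> x + g' \<epsilon> x) - (f \<epsilon> x + g \<epsilon> x))"
      by (simp add: algebra_simps)
    ultimately have N: "(\<lambda>\<epsilon> x. (f' \<epsilon> x + g' \<epsilon> x) - (f \<epsilon> x + g \<epsilon> x)) \<in> N_tau" by (rule back_subst)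
    show "(\<lambda>\<epsilon> x. f' \<epsilon> x + g' \<epsilon> x, \<lambda>\<epsilon> x. f \<epsilon> x + g \<epsilon> x) \<in> rel_tau"
      unfolding rel_tau_def using E_tau_add[OF E(2,4)] E_tau_add[OF E(1,3)] N by blast
  qed
  then show ?thesis unfolding class_add_def using assms(3,4) by blast
qed

lemma C_bar_repr:
  assumes "Z \<in> C_bar" "z \<in> Z" "z' \<in> Z"
  shows "z \<in> E_C" "z' \<in> E_C" "(\<lambda>\<epsilon>. z' \<epsilon> - z \<epsilon>) \<in> N_C"
proof -
  obtain x where x: "Z = rel_C `` {x}" using assms unfolding C_bar_def by (auto elim: quotientE)
  have "(x, z) \<in> rel_C" "(x, z') \<in> rel_C" using assms x by auto
  then have E: "z \<in> E_C" "z' \<in> E_C" and N: "(\<lambda>\<epsilon>. x \<epsilon> - z \<epsilon>) \<in> N_C" "(\<lambda>\<epsilon>. x \<epsilon> - z' \<epsilon>) \<in> N_C"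
    by (auto simp: rel_C_def)
  show "z \<in> E_C" "z' \<in> E_C" by fact+
  show "(\<lambda>\<epsilon>. z' \<epsilon> - z \<epsilon>) \<in> N_C"
    unfolding N_C_def
  proof safe
    fix p :: nat
    have "norm (z' \<epsilon> - z \<epsilon>) \<le> norm (x \<epsilon> - z \<epsilon>) + norm (x \<epsilon> - z' \<epsilon>)" for \<epsilon>
      by (metis dist_norm dist_commute dist_triangle3 add.commute)
    then have ev: "\<forall>\<^sub>F \<epsilon> in at_right 0. ennreal (norm (z' \<epsilon> - z \<epsilon>)) \<le> ennreal (norm (x \<epsilon> - z \<epsilon>)) + ennreal (norm (x \<epsilon> - z' \<epsilon>))"
      by (simp flip: ennreal_plus add: ennreal_leI)
    show "bigO_eps (\<lambda>\<epsilon>. ennreal (norm (z' \<epsilon> - z \<epsilon>))) (real p)"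
      by (rule bigO_eps_mono[OF bigO_eps_add order_refl ev]) (use N in \<open>auto simp: N_C_def\<close>)
  qed
qed

lemma class_scale_S:
  assumes "Z \<in> C_bar" "F \<in> G_S" "z \<in> Z" "f \<in> F"
  shows "class_scale rel_S Z F = rel_S `` {\<lambda>\<epsilon> x. z \<epsilon> * f \<epsilon> x}"
proof -
  have "rel_S `` {\<lambda>\<epsilon> x. z' \<epsilon> * f' \<epsilon> x} = rel_S `` {\<lambda>\<epsilon> x. z \<epsilon> * f \<epsilon> x}"
    if "z' \<in> Z" "f' \<in> F" for z' f'
  proof (rule equiv_class_eq[OF equiv_rel_S])
    have r: "(f', f) \<in> rel_S"
      using that assms quotient_eq_iff[OF equiv_rel_S] unfolding G_S_def by blast+
    then have E: "f \<in> E_S" "f' \<in> E_S" by (auto simp: rel_S_def)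
    note z = C_bar_repr[OF assms(1,3) that(1)]
    have "(\<lambda>\<epsilon> x. z' \<epsilon> * (f' \<epsilon> x - f \<epsilon> x) + (z' \<epsilon> - z \<epsilon>) * f \<epsilon> x) \<in> N_S"
      by (rule N_S_lincomb[OF E_S_minus[OF E(2,1)] E(1) z(2) N_C_E_C[OF z(3)]])
        (use r z(3) in \<open>simp_all add: rel_S_def\<close>)
    moreover have "(\<lambda>\<epsilon> x. z' \<epsilon> * (f' \<epsilon> x - f \<epsilon> x) + (z' \<epsilon> - z \<epsilon>) * f \<epsilon> x) = (\<lambda>\<epsilon> x. z' \<epsilon> * f' \<epsilon> x - z \<epsilon> * f \<epsilon> x)"
      by (simp add: algebra_simps)
    ultimately have N: "(\<lambda>\<epsilon> x. z' \<epsilon> * f' \<epsilon> x - z \<epsilon> * f \<epsilon> x) \<in> N_S" by (rule back_subst)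
    show "(\<lambda>\<epsilon> x. z' \<epsilon> * f' \<epsilon> x, \<lambda>\<epsilon> x. z \<epsilon> * f \<epsilon> x) \<in> rel_S"
      unfolding rel_S_def using E_S_scale[OF E(2) z(2)] E_S_scale[OF E(1) z(1)] N by blast
  qed
  then show ?thesis unfolding class_scale_def using assms(3,4) by blast
qed

lemma class_scale_tau:
  assumes "Z \<in> C_bar" "F \<in> G_tau" "z \<in> Z" "f \<in> F"
  shows "class_scale rel_tau Z F = rel_tau `` {\<lambda>\<epsilon> x. z \<epsilon> * f \<epsilon> x}"
proof -
  have "rel_tau `` {\<lambda>\<epsilon> x. z' \<epsilon> * f' \<epsilon> x} = rel_tau `` {\<lambda>\<epsilon> x. z \<epsilon> * f \<epsilon> x}"
    if "z' \<in> Z" "f' \<in> F" for z' f'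
  proof (rule equiv_class_eq[OF equiv_rel_tau])
    have r: "(f', f) \<in> rel_tau"
      using that assms quotient_eq_iff[OF equiv_rel_tau] unfolding G_tau_def by blast+
    then have E: "f \<in> E_tau" "f' \<in> E_tau" by (auto simp: rel_tau_def)
    note z = C_bar_repr[OF assms(1,3) that(1)]
    have "(\<lambda>\<epsilon> x. z' \<epsilon> * (f' \<epsilon> x - f \<epsilon> x) + (z' \<epsilon> - z \<epsilon>) * f \<epsilon> x) \<in> N_tau"
      by (rule N_tau_lincomb[OF E_tau_minus[OF E(2,1)] E(1) z(2) N_C_E_C[OF z(3)]])
        (use r z(3) in \<open>simp_all add: rel_tau_def\<close>)
    moreover have "(\<lambda>\<epsilon> x. z' \<epsilon> * (f' \<epsilon> x - f \<epsilon> x) + (z' \<epsilon> - z \<epsilon>) * f \<epsilon> x) = (\<lambda>\<epsilon> x. z' \<epsilon> * f' \<epsilon> x - z \<epsilon> * f \<epsilon> x)"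
      by (simp add: algebra_simps)
    ultimately have N: "(\<lambda>\<epsilon> x. z' \<epsilon> * f' \<epsilon> x - z \<epsilon> * f \<epsilon> x) \<in> N_tau" by (rule back_subst)
    show "(\<lambda>\<epsilon> x. z' \<epsilon> * f' \<epsilon> x, \<lambda>\<epsilon> x. z \<epsilon> * f \<epsilon> x) \<in> rel_tau"
      unfolding rel_tau_def using E_tau_scale[OF E(2) z(2)] E_tau_scale[OF E(1) z(1)] N by blast
  qed
  then show ?thesis unfolding class_scale_def using assms(3,4) by blast
qed

lemma strongly_moderate_bound:
  fixes T :: "real \<Rightarrow> ('a::euclidean_space \<Rightarrow> complex) \<Rightarrow> ('b::euclidean_space \<Rightarrow> complex)"
  assumes "strongly_moderate b c T"
  shows "\<exists>(K::real) (p::nat) (q::nat) (k::nat). \<forall>s f. (\<forall>\<epsilon>\<in>{0<..1}. f \<epsilon> \<in> schwartz) \<longrightarrow>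
    bigO_eps (\<lambda>\<epsilon>. mu (int q) (real k) (f \<epsilon>)) s \<longrightarrow>
    bigO_eps (\<lambda>\<epsilon>. mu (- int p) (real l) (T \<epsilon> (f \<epsilon>))) (s - K)"
proof -
  obtain lam r where *: "\<forall>l::nat. \<exists>C\<ge>0. \<exists>p q::nat.
     \<forall>\<^sub>F \<epsilon> in at_right 0. \<forall>f\<in>schwartz.
       mu (- int p) (real l) (T \<epsilon> f) \<le> ennreal (C * \<epsilon> powr (- r l)) * mu (int q) (lam l) f"
    using assms unfolding strongly_moderate_def by (elim bexE)
  obtain C p q where C: "C \<ge> 0" and ev: "\<forall>\<^sub>F \<epsilon> in at_right 0. \<forall>f\<in>schwartz.
     mu (- int p) (real l) (T \<epsilon> f) \<le> ennreal (C * \<epsilon> powr (- r l)) * mu (int q) (lam l) f"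
    using spec[OF *, of l] by (elim exE conjE)
  define k where "k = nat \<lceil>lam l\<rceil>"
  have k: "lam l \<le> real k" unfolding k_def by linarith
  have O1: "bigO_eps (\<lambda>\<epsilon>. ennreal (C * \<epsilon> powr (- r l))) (- r l)"
    unfolding bigO_eps_def by (rule exI[of _ C]) (simp add: C)
  have ev1: "\<forall>\<^sub>F \<epsilon> in at_right (0::real). \<epsilon> \<in> {0<..<1}" by (rule eventually_at_right_real) simp
  have "bigO_eps (\<lambda>\<epsilon>. mu (- int p) (real l) (T \<epsilon> (f \<epsilon>))) (s - r l)"
    if f: "\<forall>\<epsilon>\<in>{0<..1}. f \<epsilon> \<in> schwartz" and O: "bigO_eps (\<lambda>\<epsilon>. mu (int q) (real k) (f \<epsilon>)) s"
    for s :: real and f :: "'a fnet"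
  proof -
    have ev2: "\<forall>\<^sub>F \<epsilon> in at_right 0. mu (- int p) (real l) (T \<epsilon> (f \<epsilon>)) \<le> ennreal (C * \<epsilon> powr (- r l)) * mu (int q) (real k) (f \<epsilon>)"
      using ev ev1
    proof eventually_elim
      case (elim \<epsilon>)
      have "\<epsilon> \<in> {0<..1}" using elim(2) by simp
      then have "f \<epsilon> \<in> schwartz" by (rule bspec[OF f])
      with elim(1) have "mu (- int p) (real l) (T \<epsilon> (f \<epsilon>)) \<le> ennreal (C * \<epsilon> powr (- r l)) * mu (int q) (lam l) (f \<epsilon>)"
        by (rule bspec)
      also have "\<dots> \<le> ennreal (C * \<epsilon> powr (- r l)) * mu (int q) (real k) (f \<epsilon>)"
        by (intro mult_left_mono mu_mono k) simp_all
      finally show ?case .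
    qed
    show ?thesis
      by (rule bigO_eps_mono[OF bigO_eps_mult[OF O1 O] _ ev2]) simp
  qed
  then show ?thesis by blast
qed

lemma cont_linear_maps_mem:
  assumes "T \<in> cont_linear_maps" "f \<in> schwartz"
  shows "T f \<in> mult_space"
proof -
  have "T \<in> schwartz \<rightarrow> mult_space" using assms(1) unfolding cont_linear_maps_def mem_Collect_eq by (elim conjE)
  then show ?thesis using assms(2) by (rule funcset_mem)
qed

lemma image_E_tau:
  fixes T :: "real \<Rightarrow> ('a::euclidean_space \<Rightarrow> complex) \<Rightarrow> ('b::euclidean_space \<Rightarrow> complex)"
  assumes "\<forall>\<epsilon>\<in>{0<..1}. T \<epsilon> \<in> cont_linear_maps" "strongly_moderate b c T" "f \<in> E_S"
  shows "(\<lambda>\<epsilon>. T \<epsilon> (f \<epsilon>)) \<in> E_tau"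
  unfolding E_tau_def
proof (intro CollectI conjI allI ballI)
  fix \<epsilon> :: real assume "\<epsilon> \<in> {0<..1}"
  then have "T \<epsilon> \<in> cont_linear_maps" "f \<epsilon> \<in> schwartz" using assms(1,3) unfolding E_S_def by blast+
  then show "T \<epsilon> (f \<epsilon>) \<in> mult_space" by (rule cont_linear_maps_mem)
next
  fix l :: nat
  obtain K p q k where *: "\<forall>s f. (\<forall>\<epsilon>\<in>{0<..1}. f \<epsilon> \<in> schwartz) \<longrightarrow>
    bigO_eps (\<lambda>\<epsilon>. mu (int q) (real k) (f \<epsilon>)) s \<longrightarrow>
    bigO_eps (\<lambda>\<epsilon>. mu (- int p) (real l) (T \<epsilon> (f \<epsilon>))) (s - K)"
    using strongly_moderate_bound[OF assms(2), of l] by (elim exE)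
  have fs: "\<forall>\<epsilon>\<in>{0<..1}. f \<epsilon> \<in> schwartz" using assms(3) unfolding E_S_def by blast
  obtain N where N: "bigO_eps (\<lambda>\<epsilon>. mu (int q) (real k) (f \<epsilon>)) (- real N)"
    using assms(3) unfolding E_S_def by blast
  have 1: "bigO_eps (\<lambda>\<epsilon>. mu (- int p) (real l) (T \<epsilon> (f \<epsilon>))) (- real N - K)"
    by (rule mp[OF mp[OF spec[OF spec[OF *, of "- real N"], of f] fs] N])
  have "bigO_eps (\<lambda>\<epsilon>. mu (- int p) (real l) (T \<epsilon> (f \<epsilon>))) (- real (N + nat \<lceil>K\<rceil>))"
    by (rule bigO_eps_mono[OF 1]) (use real_nat_ceiling_ge[of K] in simp_all)
  then show "\<exists>q N. bigO_eps (\<lambda>\<epsilon>. mu (- int q) (real l) (T \<epsilon> (f \<epsilon>))) (- real N)" by blast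
qed

lemma image_N_tau:
  fixes T :: "real \<Rightarrow> ('a::euclidean_space \<Rightarrow> complex) \<Rightarrow> ('b::euclidean_space \<Rightarrow> complex)"
  assumes "\<forall>\<epsilon>\<in>{0<..1}. T \<epsilon> \<in> cont_linear_maps" "strongly_moderate b c T" "f \<in> N_S"
  shows "(\<lambda>\<epsilon>. T \<epsilon> (f \<epsilon>)) \<in> N_tau"
  unfolding N_tau_def
proof (intro CollectI conjI allI ballI)
  fix \<epsilon> :: real assume "\<epsilon> \<in> {0<..1}"
  then have "T \<epsilon> \<in> cont_linear_maps" "f \<epsilon> \<in> schwartz" using assms(1,3) unfolding N_S_def by blast+
  then show "T \<epsilon> (f \<epsilon>) \<in> mult_space" by (rule cont_linear_maps_mem)
next
  fix l :: nat
  obtain K p q k where *: "\<forall>s f. (\<forall>\<epsilon>\<in>{0<..1}. f \<epsilon> \<in> schwartz) \<longrightarrow>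
    bigO_eps (\<lambda>\<epsilon>. mu (int q) (real k) (f \<epsilon>)) s \<longrightarrow>
    bigO_eps (\<lambda>\<epsilon>. mu (- int p) (real l) (T \<epsilon> (f \<epsilon>))) (s - K)"
    using strongly_moderate_bound[OF assms(2), of l] by (elim exE)
  have fs: "\<forall>\<epsilon>\<in>{0<..1}. f \<epsilon> \<in> schwartz" using assms(3) unfolding N_S_def by blast
  have "bigO_eps (\<lambda>\<epsilon>. mu (- int p) (real l) (T \<epsilon> (f \<epsilon>))) (real n)" for n
  proof -
    have N: "bigO_eps (\<lambda>\<epsilon>. mu (int q) (real k) (f \<epsilon>)) (real (n + nat \<lceil>K\<rceil>))"
      using assms(3) unfolding N_S_def by blast
    have 1: "bigO_eps (\<lambda>\<epsilon>. mu (- int p) (real l) (T \<epsilon> (f \<epsilon>))) (real (n + nat \<lceil>K\<rceil>) - K)"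
      by (rule mp[OF mp[OF spec[OF spec[OF *, of "real (n + nat \<lceil>K\<rceil>)"], of f] fs] N])
    show ?thesis
      by (rule bigO_eps_mono[OF 1]) (use real_nat_ceiling_ge[of K] in simp_all)
  qed
  then show "\<exists>q. \<forall>n. bigO_eps (\<lambda>\<epsilon>. mu (- int q) (real l) (T \<epsilon> (f \<epsilon>))) (real n)" by blast
qed

lemma cont_linear_lincomb:
  fixes T :: "('a::euclidean_space \<Rightarrow> complex) \<Rightarrow> ('b::euclidean_space \<Rightarrow> complex)"
  assumes "T \<in> cont_linear_maps" "f \<in> schwartz" "g \<in> schwartz"
  shows "T (\<lambda>x. z * f x + w * g x) = (\<lambda>y. z * T f y + w * T g y)"
proof -
  have sc: "(\<lambda>x. c * h x) \<in> schwartz" if "h \<in> schwartz" for c and h :: "'a \<Rightarrow> complex"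
    using schwartz_lincomb[OF that that, of c 0] by simp
  have add: "T (\<lambda>x. h x + k x) = (\<lambda>y. T h y + T k y)" if "h \<in> schwartz" "k \<in> schwartz" for h k
    using assms(1) that unfolding cont_linear_maps_def by blast
  have mult: "T (\<lambda>x. c * h x) = (\<lambda>y. c * T h y)" if "h \<in> schwartz" for c h
    using assms(1) that unfolding cont_linear_maps_def by blast
  show ?thesis unfolding add[OF sc[OF assms(2)] sc[OF assms(3)]] mult[OF assms(2)] mult[OF assms(3)] ..
qed

lemma image_rel_tau:
  assumes T: "\<forall>\<epsilon>\<in>{0<..1}. T \<epsilon> \<in> cont_linear_maps" "strongly_moderate b c T"
    and "(f, g) \<in> rel_S"
  shows "(\<lambda>\<epsilon>. T \<epsilon> (f \<epsilon>), \<lambda>\<epsilon>. T \<epsilon> (g \<epsilon>)) \<in> rel_tau"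
proof -
  have E: "f \<in> E_S" "g \<in> E_S" and N: "(\<lambda>\<epsilon> x. f \<epsilon> x - g \<epsilon> x) \<in> N_S" using assms(3) by (auto simp: rel_S_def)
  have TE: "(\<lambda>\<epsilon>. T \<epsilon> (f \<epsilon>)) \<in> E_tau" "(\<lambda>\<epsilon>. T \<epsilon> (g \<epsilon>)) \<in> E_tau" using image_E_tau[OF T] E by blast+
  let ?d = "\<lambda>\<epsilon> x. T \<epsilon> (f \<epsilon>) x - T \<epsilon> (g \<epsilon>) x"
  let ?e = "\<lambda>\<epsilon>. T \<epsilon> (\<lambda>x. f \<epsilon> x - g \<epsilon> x)"
  have eN: "?e \<in> N_tau" using image_N_tau[OF T N] .
  have eE: "?e \<in> E_tau" using image_E_tau[OF T E_S_minus[OF E]] .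
  have "\<forall>\<epsilon>\<in>{0<..1}. ?d \<epsilon> = ?e \<epsilon>"
  proof
    fix \<epsilon> :: real assume "\<epsilon> \<in> {0<..1}"
    then have "T \<epsilon> \<in> cont_linear_maps" "f \<epsilon> \<in> schwartz" "g \<epsilon> \<in> schwartz"
      using T(1) E unfolding E_S_def by blast+
    from cont_linear_lincomb[OF this, of 1 "-1"] show "?d \<epsilon> = ?e \<epsilon>" by simp
  qed
  from E_tau_cong[OF E_tau_minus[OF TE] this]
  have de: "(\<lambda>\<epsilon> x. ?d \<epsilon> x - ?e \<epsilon> x) \<in> N_tau" unfolding rel_tau_def by blast
  have "(\<lambda>\<epsilon> x. 1 * (?d \<epsilon> x - ?e \<epsilon> x) + 1 * ?e \<epsilon> x) \<in> N_tau"
    by (rule N_tau_lincomb[OF E_tau_minus[OF E_tau_minus[OF TE] eE] eE E_C_const E_C_const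
      disjI1[OF de] disjI1[OF eN]])
  then have "?d \<in> N_tau" by simp
  then show ?thesis using TE unfolding rel_tau_def by blast
qed

lemma canonical_extension_exists:
  fixes T :: "real \<Rightarrow> ('a::euclidean_space \<Rightarrow> complex) \<Rightarrow> ('b::euclidean_space \<Rightarrow> complex)"
  assumes T: "\<forall>\<epsilon>\<in>{0<..1}. T \<epsilon> \<in> cont_linear_maps" "strongly_moderate b c T"
  shows "\<exists>L. canonical_extension T L"
proof
  show "canonical_extension T (\<lambda>F. \<Union>f\<in>F. class_tau (\<lambda>\<epsilon>. T \<epsilon> (f \<epsilon>)))"
    unfolding canonical_extension_def
  proof (intro ballI)
    fix F :: "'a fnet set" and f :: "'a fnet" assume F: "F \<in> G_S" "f \<in> F"
    have "class_tau (\<lambda>\<epsilon>. T \<epsilon> (f' \<epsilon>)) = class_tau (\<lambda>\<epsilon>. T \<epsilon> (f \<epsilon>))" if "f' \<in> F" for f'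
    proof -
      have "(f', f) \<in> rel_S" using that F quotient_eq_iff[OF equiv_rel_S] unfolding G_S_def by blast
      from image_rel_tau[OF T this] show ?thesis
        unfolding class_tau_def by (rule equiv_class_eq[OF equiv_rel_tau])
    qed
    then show "(\<Union>f\<in>F. class_tau (\<lambda>\<epsilon>. T \<epsilon> (f \<epsilon>))) = class_tau (\<lambda>\<epsilon>. T \<epsilon> (f \<epsilon>))" using F by blast
  qed
qed

lemma canonical_extension_linear:
  fixes T :: "real \<Rightarrow> ('a::euclidean_space \<Rightarrow> complex) \<Rightarrow> ('b::euclidean_space \<Rightarrow> complex)"
  assumes T: "\<forall>\<epsilon>\<in>{0<..1}. T \<epsilon> \<in> cont_linear_maps" "strongly_moderate b c T"
    and L: "canonical_extension T L"
  shows "L \<in> C_bar_linear_maps"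
proof -
  have Lc: "L (rel_S `` {f}) = class_tau (\<lambda>\<epsilon>. T \<epsilon> (f \<epsilon>))" if "f \<in> E_S" for f
    using L that equiv_class_self[OF equiv_rel_S that] quotientI[OF that] unfolding canonical_extension_def G_S_def by blast
  have ex: "\<exists>f. f \<in> F \<and> f \<in> E_S \<and> F = rel_S `` {f}" if "F \<in> G_S" for F :: "'a fnet set"
    using that equiv_class_self[OF equiv_rel_S] unfolding G_S_def by (auto elim!: quotientE)
  have G: "class_tau h \<in> G_tau" "h \<in> class_tau h" if "h \<in> E_tau" for h :: "'b fnet"
    using that equiv_class_self[OF equiv_rel_tau] unfolding class_tau_def G_tau_def by (auto intro: quotientI)
  note I = image_E_tau[OF T]
  have TL: "\<forall>\<epsilon>\<in>{0<..1}. T \<epsilon> (\<lambda>x. f \<epsilon> x + g \<epsilon> x) = (\<lambda>y. T \<epsilon> (f \<epsilon>) y + T \<epsilon> (g \<epsilon>) y)"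
    if "f \<in> E_S" "g \<in> E_S" for f g
  proof
    fix \<epsilon> :: real assume "\<epsilon> \<in> {0<..1}"
    then have "T \<epsilon> \<in> cont_linear_maps" "f \<epsilon> \<in> schwartz" "g \<epsilon> \<in> schwartz"
      using T(1) that unfolding E_S_def by blast+
    from cont_linear_lincomb[OF this, of 1 1]
    show "T \<epsilon> (\<lambda>x. f \<epsilon> x + g \<epsilon> x) = (\<lambda>y. T \<epsilon> (f \<epsilon>) y + T \<epsilon> (g \<epsilon>) y)" by simp
  qed
  have TS: "\<forall>\<epsilon>\<in>{0<..1}. T \<epsilon> (\<lambda>x. z \<epsilon> * f \<epsilon> x) = (\<lambda>y. z \<epsilon> * T \<epsilon> (f \<epsilon>) y)"
    if "f \<in> E_S" for f and z :: "real \<Rightarrow> complex"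
  proof
    fix \<epsilon> :: real assume "\<epsilon> \<in> {0<..1}"
    then have "T \<epsilon> \<in> cont_linear_maps" "f \<epsilon> \<in> schwartz"
      using T(1) that unfolding E_S_def by blast+
    from cont_linear_lincomb[OF this this(2), of "z \<epsilon>" 0]
    show "T \<epsilon> (\<lambda>x. z \<epsilon> * f \<epsilon> x) = (\<lambda>y. z \<epsilon> * T \<epsilon> (f \<epsilon>) y)" by simp
  qed
  have "L \<in> G_S \<rightarrow> G_tau"
  proof
    fix F :: "'a fnet set" assume "F \<in> G_S"
    then obtain f where "f \<in> E_S" "F = rel_S `` {f}" using ex by blast
    then show "L F \<in> G_tau" using Lc G(1)[OF I] by simp
  qed
  moreover have "L (class_add rel_S F G) = class_add rel_tau (L F) (L G)" if FG: "F \<in> G_S" "G \<in> G_S" for F G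
  proof -
    obtain f g where f: "f \<in> F" "f \<in> E_S" "F = rel_S `` {f}" and g: "g \<in> G" "g \<in> E_S" "G = rel_S `` {g}"
      using ex FG by blast
    have s: "(\<lambda>\<epsilon> x. f \<epsilon> x + g \<epsilon> x) \<in> E_S"
      using E_S_lincomb[OF f(2) g(2) E_C_const E_C_const, of 1 1] by simp
    have "L (class_add rel_S F G) = class_tau (\<lambda>\<epsilon>. T \<epsilon> (\<lambda>x. f \<epsilon> x + g \<epsilon> x))"
      using class_add_S[OF that f(1) g(1)] Lc[OF s] by simp
    also have "\<dots> = class_tau (\<lambda>\<epsilon> x. T \<epsilon> (f \<epsilon>) x + T \<epsilon> (g \<epsilon>) x)"
      unfolding class_tau_def
      by (rule equiv_class_eq[OF equiv_rel_tau E_tau_cong[OF I[OF s]]])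
         (use TL f(2) g(2) in blast)
    also have "\<dots> = class_add rel_tau (L F) (L G)"
      using class_add_tau[OF G(1)[OF I[OF f(2)]] G(1)[OF I[OF g(2)]] G(2)[OF I[OF f(2)]] G(2)[OF I[OF g(2)]]]
        Lc f g by (simp add: class_tau_def)
    finally show ?thesis .
  qed
  moreover have "L (class_scale rel_S Z F) = class_scale rel_tau Z (L F)" if ZF: "Z \<in> C_bar" "F \<in> G_S" for Z F
  proof -
    obtain f where f: "f \<in> F" "f \<in> E_S" "F = rel_S `` {f}" using ex ZF by blast
    obtain x where "x \<in> E_C" "Z = rel_C `` {x}" using ZF(1) unfolding C_bar_def by (auto elim: quotientE)
    then have "x \<in> Z" using N_C_zero by (simp add: rel_C_def)
    then obtain z where z: "z \<in> Z" "z \<in> E_C" using C_bar_repr[OF ZF(1)] by blast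
    have s: "(\<lambda>\<epsilon> x. z \<epsilon> * f \<epsilon> x) \<in> E_S"
      using E_S_scale[OF f(2) z(2)] .
    have "L (class_scale rel_S Z F) = class_tau (\<lambda>\<epsilon>. T \<epsilon> (\<lambda>x. z \<epsilon> * f \<epsilon> x))"
      using class_scale_S[OF that z(1) f(1)] Lc[OF s] by simp
    also have "\<dots> = class_tau (\<lambda>\<epsilon> x. z \<epsilon> * T \<epsilon> (f \<epsilon>) x)"
      unfolding class_tau_def
      by (rule equiv_class_eq[OF equiv_rel_tau E_tau_cong[OF I[OF s]]])
         (use TS f(2) in blast)
    also have "\<dots> = class_scale rel_tau Z (L F)"
      using class_scale_tau[OF that(1) G(1)[OF I[OF f(2)]] z(1) G(2)[OF I[OF f(2)]]]
        Lc f by (simp add: class_tau_def)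
    finally show ?thesis .
  qed
  ultimately show ?thesis unfolding C_bar_linear_maps_def by blast
qed

end

theory Submission
  imports Defs
begin

text \<open>
  The kernel is of finite rank for every \<open>\<epsilon>\<close>. Averaging \<open>f\<close> against dilated Gaussians with binomial
  weights produces a finite difference of order \<open>m\<close>, so that the error of the average is of size
  \<open>2\<^sup>m \<sigma>\<^sup>r\<close> times the derivatives of \<open>f\<close> of order \<open>r \<le> m\<close>. With \<open>\<sigma> = \<epsilon>\<^sup>2\<close> and \<open>2\<^sup>m \<le> 1/\<epsilon>\<close> this is negligible
  as soon as these derivatives are \<open>O(\<epsilon>\<^sup>-\<^sup>r)\<close> for large \<open>r\<close>, which is what \<open>a \<le> 1\<close> provides. The Gaussian kernel
  expands as \<open>exp (-|x - y|\<^sup>2) = \<Sum>\<^sub>\<alpha> E\<^sub>\<alpha>(x) E\<^sub>\<alpha>(y)\<close> with \<open>E\<^sub>\<alpha>\<close> a normalized monomial times a Gaussian, and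
  truncating at a degree polynomial in \<open>1/\<epsilon>\<close> costs a negligible error, too. This gives
  \<open>f \<approx> A\<^sub>\<epsilon> f = \<Sum>\<^sub>i c\<^sub>i \<langle>f, E\<^sub>i\<rangle> E\<^sub>i\<close>, a finite sum, whose image under \<open>T\<^sub>\<epsilon>\<close> is the integral operator with kernel
  \<open>\<Sum>\<^sub>i c\<^sub>i (T\<^sub>\<epsilon> E\<^sub>i)(x) E\<^sub>i(y)\<close>; no exchange of \<open>T\<^sub>\<epsilon>\<close> with an integral occurs. The kernel is moderate because
  the estimate of \<open>T\<^sub>\<epsilon>\<close> is uniform in the function. Only sup estimates of \<open>A\<^sub>\<epsilon> f - f\<close> are needed: by
  interpolation, a moderate net that is negligible in order zero is negligible in all orders.
\<close>

section \<open>Iterated partial derivatives\<close>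

text \<open>One kernel has to serve every \<open>f\<close> and every order \<open>p\<close> of
  negligibility, so neither the order \<open>m\<close> of the finite difference nor the degree
  \<open>K\<close> of the truncation may depend on them; both grow as \<epsilon> tends to 0. Every
  fixed order \<open>r\<close> is then eventually available, and the differences beyond the
  \<open>r\<close>-th are estimated trivially at the price 2^m, which is why \<open>m\<close> is
  only logarithmic in 1/\<epsilon>. With \<sigma> = \<epsilon>^2 the regularization error is
  \<epsilon>^(2r - 1) times the size \<epsilon>^(-N(r)) of the derivatives of order
  \<open>r\<close>, hence at most \<epsilon>^(r - 1) once N(r) \<le> r: the square leaves a full
  \<open>r\<close> to spare. The truncation loses \<sigma>^(-2r) = \<epsilon>^(-4r) and gains
  K^(-r), so \<open>K\<close> of size \<epsilon>^(-6) leaves \<epsilon>^(2r). Its estimate of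
  \<open>f\<close> has a weight that grows with \<open>r\<close> but contains no derivatives, and
  regularity provides one exponent N(0) for all weights. Hence \<open>r\<close> can still be taken
  as large as \<open>p\<close> demands.\<close>

text \<open>Coinduction for smoothness: a family of differentiable functions closed under partial
  derivatives consists of smooth functions. It serves the zero function, integrals with kernels and
  tensor products.\<close>

lemma smoothI:
  assumes "P f" "\<And>g. P g \<Longrightarrow> g differentiable_on UNIV"
    and "\<And>g b. P g \<Longrightarrow> b \<in> Basis \<Longrightarrow> P (partial_deriv b g)"
  shows "smooth f"
proof -
  have "\<forall>g. P g \<longrightarrow> Ck k g" for k
    by (induction k) (use assms(2,3) in \<open>auto simp: differentiable_imp_continuous_on\<close>)
  then show ?thesis using assms(1) by (simp add: smooth_def)
qed

lemma has_vector_derivative_line: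
  assumes "(f has_derivative f') (at (x + t *\<^sub>R v))"
  shows "((\<lambda>t::real. f (x + t *\<^sub>R v)) has_vector_derivative f' v) (at t)"
proof -
  have "((\<lambda>t::real. x + t *\<^sub>R v) has_derivative (\<lambda>s. s *\<^sub>R v)) (at t)"
    by (auto intro!: derivative_eq_intros)
  from has_derivative_compose[OF this assms]
  show ?thesis
    unfolding has_vector_derivative_def
    using linear_scale[OF has_derivative_linear[OF assms]] by simp
qed

lemma partial_deriv_eqI:
  assumes "(f has_derivative f') (at x)"
  shows "partial_deriv b f x = f' b"
  unfolding partial_deriv_def
  using has_vector_derivative_line[of f f' x 0 b] assms by (simp add: vector_derivative_at)

lemma smooth_has_derivative:
  fixes f :: "'a::euclidean_space \<Rightarrow> complex"
  assumes "smooth f"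
  shows "(f has_derivative (\<lambda>v. \<Sum>b\<in>Basis. (v \<bullet> b) *\<^sub>R partial_deriv b f x)) (at x)"
proof -
  obtain f' where f': "(f has_derivative f') (at x)"
    using smooth_differentiable[OF assms] by (auto simp: differentiable_on_def differentiable_def)
  have "f' v = (\<Sum>b\<in>Basis. (v \<bullet> b) *\<^sub>R f' b)" for v
  proof -
    have "f' v = f' (\<Sum>b\<in>Basis. (v \<bullet> b) *\<^sub>R b)" by (simp add: euclidean_representation)
    then show ?thesis
      using has_derivative_linear[OF f'] by (simp add: linear_sum linear_scale)
  qed
  then have "f' = (\<lambda>v. \<Sum>b\<in>Basis. (v \<bullet> b) *\<^sub>R partial_deriv b f x)"
    unfolding partial_deriv_eqI[OF f'] by (rule ext)
  with f' show ?thesis by metis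
qed

lemma smooth_line_derivative:
  fixes f :: "'a::euclidean_space \<Rightarrow> complex"
  assumes "smooth f"
  shows "((\<lambda>t. f (x + t *\<^sub>R v)) has_vector_derivative
    (\<Sum>b\<in>Basis. (v \<bullet> b) *\<^sub>R partial_deriv b f (x + t *\<^sub>R v))) (at t)"
  by (rule has_vector_derivative_line) (rule smooth_has_derivative[OF assms])

lemma smooth_partial_line_derivative:
  fixes f :: "'a::euclidean_space \<Rightarrow> complex"
  assumes "smooth f"
  shows "((\<lambda>t. f (x + t *\<^sub>R b)) has_vector_derivative partial_deriv b f (x + t *\<^sub>R b)) (at t)"
proof -
  obtain f' where f': "(f has_derivative f') (at (x + t *\<^sub>R b))"
    using smooth_has_derivative[OF assms] by blast
  show ?thesis
    unfolding partial_deriv_eqI[OF f'] by (rule has_vector_derivative_line[OF f'])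
qed

lemma smooth_continuous_on: "smooth f \<Longrightarrow> continuous_on S f"
  by (rule continuous_on_subset[OF differentiable_imp_continuous_on[OF smooth_differentiable] subset_UNIV])

lemma smooth_continuous_compose:
  assumes "smooth f" "continuous_on S g"
  shows "continuous_on S (\<lambda>x. f (g x))"
  by (rule continuous_on_compose2[OF smooth_continuous_on[OF assms(1)] assms(2) subset_UNIV])

text \<open>Clairaut's theorem. Differentiating
  \<open>f (x + t c + u b) - f (x + t c) = \<integral>\<^sub>0\<^sup>u \<partial>\<^sub>b f (x + t c + s b) ds\<close> first in \<open>t\<close> under the integral and then in \<open>u\<close>
  exchanges the two derivatives.\<close>

lemma partial_deriv_commute:
  fixes f :: "'a::euclidean_space \<Rightarrow> complex"
  assumes f: "smooth f" and b: "b \<in> Basis" and c: "c \<in> Basis"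
  shows "partial_deriv b (partial_deriv c f) x = partial_deriv c (partial_deriv b f) x"
proof -
  let ?bf = "partial_deriv b f" and ?cf = "partial_deriv c f"
  have bf: "smooth ?bf" and cf: "smooth ?cf" and cbf: "smooth (partial_deriv c ?bf)"
    using f b c by (simp_all add: smooth_partial_deriv)
  have ftc: "((\<lambda>s. ?bf (y + s *\<^sub>R b)) has_integral f (y + u *\<^sub>R b) - f y) {0..u}" if "0 \<le> u" for u y
    using fundamental_theorem_of_calculus[OF that, of "\<lambda>s. f (y + s *\<^sub>R b)" "\<lambda>s. ?bf (y + s *\<^sub>R b)"]
      has_vector_derivative_at_within[OF smooth_partial_line_derivative[OF f]] by auto
  have key: "?cf (x + u *\<^sub>R b) - ?cf x = integral {0..u} (\<lambda>s. partial_deriv c ?bf (x + s *\<^sub>R b))"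
    if u: "0 \<le> u" for u
  proof -
    have "((\<lambda>t. integral (cbox 0 u) (\<lambda>s. ?bf (x + t *\<^sub>R c + s *\<^sub>R b))) has_vector_derivative
        integral (cbox 0 u) (\<lambda>s. partial_deriv c ?bf (x + 0 *\<^sub>R c + s *\<^sub>R b))) (at 0 within UNIV)"
    proof (rule leibniz_rule_vector_derivative)
      fix t s :: real
      show "((\<lambda>t. ?bf (x + t *\<^sub>R c + s *\<^sub>R b)) has_vector_derivative
          partial_deriv c ?bf (x + t *\<^sub>R c + s *\<^sub>R b)) (at t within UNIV)"
        using smooth_partial_line_derivative[OF bf, of "x + s *\<^sub>R b" c t] by (simp add: algebra_simps)
    next
      fix t :: real
      show "(\<lambda>s. ?bf (x + t *\<^sub>R c + s *\<^sub>R b)) integrable_on cbox 0 u"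
        using has_integral_integrable[OF ftc[OF u, of "x + t *\<^sub>R c"]] by simp
    next
      show "continuous_on (UNIV \<times> cbox 0 u) (\<lambda>(t, s). partial_deriv c ?bf (x + t *\<^sub>R c + s *\<^sub>R b))"
        unfolding split_beta by (rule smooth_continuous_compose[OF cbf]) (intro continuous_intros)
    qed auto
    moreover have "integral (cbox 0 u) (\<lambda>s. ?bf (x + t *\<^sub>R c + s *\<^sub>R b)) =
        f ((x + u *\<^sub>R b) + t *\<^sub>R c) - f (x + t *\<^sub>R c)" for t
      using integral_unique[OF ftc[OF u, of "x + t *\<^sub>R c"]] by (simp add: algebra_simps)
    moreover have "((\<lambda>t. f ((x + u *\<^sub>R b) + t *\<^sub>R c) - f (x + t *\<^sub>R c)) has_vector_derivative
        ?cf (x + u *\<^sub>R b) - ?cf x) (at 0)"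
      using has_vector_derivative_diff[OF smooth_partial_line_derivative[OF f, of "x + u *\<^sub>R b" c 0]
          smooth_partial_line_derivative[OF f, of x c 0]] by simp
    ultimately show ?thesis
      by (simp add: vector_derivative_unique_at)
  qed
  \<comment> \<open>\<open>key\<close> is available for \<open>0 \<le> u\<close> only, so both
    derivatives at 0 are taken within \<open>{0..1}\<close>, where vector derivatives are still
    unique.\<close>
  have "((\<lambda>u. integral {0..u} (\<lambda>s. partial_deriv c ?bf (x + s *\<^sub>R b))) has_vector_derivative
      partial_deriv c ?bf (x + 0 *\<^sub>R b)) (at 0 within {0..1})"
    by (rule integral_has_vector_derivative) (rule smooth_continuous_compose[OF cbf], intro continuous_intros, simp)
  then have "((\<lambda>u. integral {0..u} (\<lambda>s. partial_deriv c ?bf (x + s *\<^sub>R b))) has_vector_derivative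
      partial_deriv c ?bf x) (at 0 within {0..1})" by simp
  then have "((\<lambda>u. ?cf (x + u *\<^sub>R b) - ?cf x) has_vector_derivative
      partial_deriv c ?bf x) (at 0 within {0..1})"
    by (rule has_vector_derivative_transform[rotated 2]) (simp_all add: key)
  moreover have "((\<lambda>u. ?cf (x + u *\<^sub>R b) - ?cf x) has_vector_derivative
      partial_deriv b ?cf x) (at 0 within {0..1})"
    using has_vector_derivative_diff[OF smooth_partial_line_derivative[OF cf, of x b 0]
        has_vector_derivative_const[of "?cf x"]] has_vector_derivative_at_within by fastforce
  ultimately show ?thesis
    using vector_derivative_unique_within_closed_interval[of 0 1 0] by auto
qed

text \<open>Lists of directions replace multi-indices: one more derivative is one more list entry,
  so estimates go by induction on lists, and the order of differentiation fixed by
  \<open>basis_enum\<close> becomes irrelevant through \<open>iter_deriv_perm\<close>.\<close>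

definition iter_deriv :: "'a::euclidean_space list \<Rightarrow> ('a \<Rightarrow> complex) \<Rightarrow> 'a \<Rightarrow> complex" where
  "iter_deriv bs f = foldr partial_deriv bs f"

lemma iter_deriv_Nil [simp]: "iter_deriv [] f = f"
  and iter_deriv_Cons: "iter_deriv (b # bs) f = partial_deriv b (iter_deriv bs f)"
  and iter_deriv_append: "iter_deriv (bs @ cs) f = iter_deriv bs (iter_deriv cs f)"
  by (simp_all add: iter_deriv_def)

lemma smooth_iter_deriv: "smooth f \<Longrightarrow> set bs \<subseteq> Basis \<Longrightarrow> smooth (iter_deriv bs f)"
  by (induction bs) (auto simp: iter_deriv_Cons smooth_partial_deriv)

lemma iter_deriv_lincomb:
  assumes "smooth f" "smooth g" "set bs \<subseteq> Basis"
  shows "iter_deriv bs (\<lambda>x. z * f x + w * g x) = (\<lambda>x. z * iter_deriv bs f x + w * iter_deriv bs g x)"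
  using assms(3)
  by (induction bs)
    (auto simp: iter_deriv_Cons partial_deriv_lincomb smooth_differentiable smooth_iter_deriv assms(1,2))

text \<open>Clairaut's theorem for neighbouring entries: \<open>move\<close> carries the head of the
  first list to the front of the second one, and the remaining lists have equal multisets
  again.\<close>

lemma iter_deriv_perm:
  assumes f: "smooth f" and "mset bs = mset cs" and "set bs \<subseteq> Basis"
  shows "iter_deriv bs f = iter_deriv cs f"
  using assms(2,3)
proof (induction bs arbitrary: cs)
  case Nil
  then show ?case by simp
next
  case (Cons b bs)
  then have "b \<in> set cs" by (metis list.set_intros(1) mset_eq_setD)
  then obtain ds es where cs: "cs = ds @ b # es" by (meson split_list)
  have cB: "set cs \<subseteq> Basis" using Cons.prems mset_eq_setD by blast
  have move: "iter_deriv (ds @ b # es) f = iter_deriv (b # ds @ es) f"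
    if "set (ds @ b # es) \<subseteq> Basis" for ds
    using that
  proof (induction ds)
    case (Cons d ds)
    have "partial_deriv d (partial_deriv b (iter_deriv (ds @ es) f))
        = partial_deriv b (partial_deriv d (iter_deriv (ds @ es) f))"
      using Cons.prems by (intro ext partial_deriv_commute smooth_iter_deriv f) auto
    then show ?case using Cons by (simp add: iter_deriv_Cons)
  qed simp
  have "mset bs = mset (ds @ es)" using Cons.prems(1) cs by simp
  then have "iter_deriv bs f = iter_deriv (ds @ es) f" using Cons by (metis list.set_intros(2) subset_code(1))
  then show ?case using move cs cB by (simp add: iter_deriv_Cons)
qed

lemma distinct_basis_enum: "distinct (basis_enum :: 'a::euclidean_space list)"
  unfolding basis_enum_def
  by (metis (mono_tags, lifting) someI_ex finite_Basis finite_distinct_list)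

abbreviation multi_index_list :: "('a::euclidean_space \<Rightarrow> nat) \<Rightarrow> 'a list" where
  "multi_index_list \<alpha> \<equiv> concat (map (\<lambda>b. replicate (\<alpha> b) b) basis_enum)"

lemma multi_deriv_iter_deriv: "multi_deriv \<alpha> f = iter_deriv (multi_index_list \<alpha>) f"
proof -
  have *: "(partial_deriv b ^^ k) g = iter_deriv (replicate k b) g" for b k and g :: "'a \<Rightarrow> complex"
    by (induction k) (auto simp: iter_deriv_Cons)
  have "foldr (\<lambda>b g. (partial_deriv b ^^ \<alpha> b) g) bs f = iter_deriv (concat (map (\<lambda>b. replicate (\<alpha> b) b) bs)) f" for bs
    by (induction bs) (auto simp: iter_deriv_append *)
  then show ?thesis by (simp add: multi_deriv_def)
qed

lemma set_multi_index_list: "set (multi_index_list \<alpha>) \<subseteq> Basis"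
  by (auto simp: basis_enum)

lemma length_multi_index_list: "length (multi_index_list \<alpha>) = multi_order \<alpha>"
  unfolding multi_order_def basis_enum[symmetric] sum.distinct_set_conv_list[OF distinct_basis_enum]
  by (simp add: length_concat o_def)

lemma mset_multi_index_list_count:
  assumes "set bs \<subseteq> (Basis :: 'a::euclidean_space set)"
  shows "mset (multi_index_list (count_list bs)) = mset bs"
proof (rule multiset_eqI)
  fix x :: 'a
  have "count (mset (concat (map (\<lambda>b. replicate (n b) b) ds))) x = (if x \<in> set ds then n x else 0)"
    if "distinct ds" for ds and n :: "'a \<Rightarrow> nat"
    using that by (induction ds) (auto)
  from this[OF distinct_basis_enum] show "count (mset (multi_index_list (count_list bs))) x = count (mset bs) x"
    using assms by (auto simp: basis_enum count_mset count_list_0_iff)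
qed

text \<open>The form in which all seminorms are estimated below. A list of basis vectors is sorted
  into the multi-index of its multiplicities without changing the derivative; conversely a
  multi-index is itself a list, of length its order.\<close>

lemma mu_le_ennreal_iff:
  fixes f :: "'a::euclidean_space \<Rightarrow> complex"
  assumes "smooth f" "0 \<le> B"
  shows "mu r (real l) f \<le> ennreal B \<longleftrightarrow>
    (\<forall>bs x. set bs \<subseteq> Basis \<longrightarrow> length bs \<le> l \<longrightarrow> (1 + norm x) powi r * norm (iter_deriv bs f x) \<le> B)"
    (is "_ \<longleftrightarrow> ?R")
proof -
  have "mu r (real l) f \<le> ennreal B \<longleftrightarrow>
     (\<forall>x \<alpha>. multi_order \<alpha> \<le> l \<longrightarrow> (1 + norm x) powi r * norm (multi_deriv \<alpha> f x) \<le> B)"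
    using assms(2) by (simp add: mu_le_iff)
  also have "\<dots> \<longleftrightarrow> ?R"
  proof safe
    fix bs x assume *: "\<forall>x \<alpha>. multi_order \<alpha> \<le> l \<longrightarrow> (1 + norm x) powi r * norm (multi_deriv \<alpha> f x) \<le> B"
      and bs: "set bs \<subseteq> (Basis :: 'a set)" "length bs \<le> l"
    note m = mset_multi_index_list_count[OF bs(1)]
    have "multi_order (count_list bs) \<le> l"
      using bs(2) m length_multi_index_list by (metis mset_eq_length)
    moreover have "multi_deriv (count_list bs) f = iter_deriv bs f"
      unfolding multi_deriv_iter_deriv
      by (rule iter_deriv_perm[OF assms(1) m set_multi_index_list])
    ultimately show "(1 + norm x) powi r * norm (iter_deriv bs f x) \<le> B" using * by metis
  next
    fix x and \<alpha> :: "'a \<Rightarrow> nat"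
    assume "?R" "multi_order \<alpha> \<le> l"
    then show "(1 + norm x) powi r * norm (multi_deriv \<alpha> f x) \<le> B"
      using set_multi_index_list[of \<alpha>] length_multi_index_list[of \<alpha>]
      by (simp only: multi_deriv_iter_deriv)
  qed
  finally show ?thesis .
qed

lemma smooth_zero: "smooth (\<lambda>x. 0)"
proof (rule smoothI[where P = "\<lambda>f. f = (\<lambda>x. 0)"])
  fix g :: "'a \<Rightarrow> complex" and b :: 'a assume "g = (\<lambda>x. 0)"
  then show "partial_deriv b g = (\<lambda>x. 0)" by (simp add: partial_deriv_def fun_eq_iff)
qed auto

lemma iter_deriv_zero: "iter_deriv bs (\<lambda>x. 0) = (\<lambda>x. 0)"
  by (induction bs) (auto simp: iter_deriv_Cons partial_deriv_def fun_eq_iff)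

lemma
  assumes "finite I" "\<And>i. i \<in> I \<Longrightarrow> smooth (f i)"
  shows smooth_sum: "smooth (\<lambda>x. \<Sum>i\<in>I. z i * f i x)"
    and iter_deriv_sum: "set bs \<subseteq> Basis \<Longrightarrow>
      iter_deriv bs (\<lambda>x. \<Sum>i\<in>I. z i * f i x) = (\<lambda>x. \<Sum>i\<in>I. z i * iter_deriv bs (f i) x)"
proof -
  have "smooth (\<lambda>x. \<Sum>i\<in>I. z i * f i x) \<and> (set bs \<subseteq> Basis \<longrightarrow>
      iter_deriv bs (\<lambda>x. \<Sum>i\<in>I. z i * f i x) = (\<lambda>x. \<Sum>i\<in>I. z i * iter_deriv bs (f i) x))" for bs
    using assms
  proof (induction I)
    case empty
    then show ?case by (simp add: smooth_zero iter_deriv_zero)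
  next
    case (insert i I)
    then have s: "smooth (f i)" "smooth (\<lambda>x. \<Sum>i\<in>I. z i * f i x)" by auto
    show ?case
      using smooth_lincomb[OF s, of "z i" 1] iter_deriv_lincomb[OF s, of bs "z i" 1] insert by simp
  qed
  then show "smooth (\<lambda>x. \<Sum>i\<in>I. z i * f i x)" "set bs \<subseteq> Basis \<Longrightarrow>
      iter_deriv bs (\<lambda>x. \<Sum>i\<in>I. z i * f i x) = (\<lambda>x. \<Sum>i\<in>I. z i * iter_deriv bs (f i) x)" by auto
qed

section \<open>Seminorm bounds\<close>

lemma mu_neg_le_ennreal_iff:
  fixes f :: "'a::euclidean_space \<Rightarrow> complex"
  assumes "smooth f" "0 \<le> B"
  shows "mu (- int q) (real l) f \<le> ennreal B \<longleftrightarrow>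
    (\<forall>bs x. set bs \<subseteq> Basis \<longrightarrow> length bs \<le> l \<longrightarrow> norm (iter_deriv bs f x) \<le> B * (1 + norm x) ^ q)"
proof -
  have "(1 + norm x) powi (- int q) * N \<le> B \<longleftrightarrow> N \<le> B * (1 + norm x) ^ q" for x :: 'a and N :: real
    using zero_less_power[of "1 + norm x" q]
    by (simp add: power_int_minus field_simps add_pos_nonneg)
  then show ?thesis using mu_le_ennreal_iff[OF assms] by simp
qed

lemma mu_pos_le_ennreal_iff:
  fixes f :: "'a::euclidean_space \<Rightarrow> complex"
  assumes "smooth f" "0 \<le> B"
  shows "mu (int q) (real l) f \<le> ennreal B \<longleftrightarrow>
    (\<forall>bs x. set bs \<subseteq> Basis \<longrightarrow> length bs \<le> l \<longrightarrow> (1 + norm x) ^ q * norm (iter_deriv bs f x) \<le> B)"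
  using mu_le_ennreal_iff[OF assms] by simp

lemma finite_ennreal_bound:
  assumes "(a::ennreal) < \<infinity>"
  obtains B where "0 \<le> B" "a \<le> ennreal B"
  using assms by (cases a) auto

lemma schwartz_iff:
  "f \<in> schwartz \<longleftrightarrow> smooth f \<and> (\<forall>q l. \<exists>B\<ge>0. \<forall>bs x. set bs \<subseteq> Basis \<longrightarrow> length bs \<le> l \<longrightarrow>
     (1 + norm x) ^ q * norm (iter_deriv bs f x) \<le> B)"
proof (cases "smooth f")
  case True
  have "mu (int q) (real l) f < \<infinity> \<longleftrightarrow> (\<exists>B\<ge>0. mu (int q) (real l) f \<le> ennreal B)" for q l
    by (metis finite_ennreal_bound ennreal_less_top infinity_ennreal_def order_le_less_trans)
  then show ?thesis
    using True by (simp add: schwartz_def mu_pos_le_ennreal_iff[OF True] cong: conj_cong)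
qed (simp add: schwartz_def)

lemma mult_space_iff:
  "f \<in> mult_space \<longleftrightarrow> smooth f \<and> (\<forall>l. \<exists>q. \<exists>B\<ge>0. \<forall>bs x. set bs \<subseteq> Basis \<longrightarrow> length bs \<le> l \<longrightarrow>
     norm (iter_deriv bs f x) \<le> B * (1 + norm x) ^ q)"
proof (cases "smooth f")
  case True
  have "mu (- int q) (real l) f < \<infinity> \<longleftrightarrow> (\<exists>B\<ge>0. mu (- int q) (real l) f \<le> ennreal B)" for q l
    by (metis finite_ennreal_bound ennreal_less_top infinity_ennreal_def order_le_less_trans)
  then show ?thesis
    using True by (simp add: mult_space_def mu_neg_le_ennreal_iff[OF True] cong: conj_cong)
qed (simp add: mult_space_def)

lemma schwartz_smooth: "f \<in> schwartz \<Longrightarrow> smooth f"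
  and mult_space_smooth: "f \<in> mult_space \<Longrightarrow> smooth f"
  by (simp_all add: schwartz_def mult_space_def)

lemma schwartz_decay:
  assumes "f \<in> schwartz"
  obtains B where "0 \<le> B" "\<And>x. (1 + norm x) ^ q * norm (f x) \<le> B"
proof -
  from assms obtain B where "0 \<le> B" "\<forall>bs x. set bs \<subseteq> Basis \<longrightarrow> length bs \<le> 0 \<longrightarrow>
     (1 + norm x) ^ q * norm (iter_deriv bs f x) \<le> B"
    unfolding schwartz_iff by blast
  with that[of B] show ?thesis by (metis iter_deriv_Nil empty_iff empty_set list.size(3) order_refl subsetI)
qed

lemma partial_deriv_mult_space:
  assumes "f \<in> mult_space" "b \<in> Basis"
  shows "partial_deriv b f \<in> mult_space"
  unfolding mult_space_iff
proof safe
  show "smooth (partial_deriv b f)" using assms by (simp add: mult_space_smooth smooth_partial_deriv)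
  fix l
  obtain q B where B: "0 \<le> B" "\<And>bs x. set bs \<subseteq> Basis \<Longrightarrow> length bs \<le> Suc l \<Longrightarrow>
     norm (iter_deriv bs f x) \<le> B * (1 + norm x) ^ q"
    using assms(1) unfolding mult_space_iff by blast
  have "norm (iter_deriv bs (partial_deriv b f) x) \<le> B * (1 + norm x) ^ q"
    if "set bs \<subseteq> Basis" "length bs \<le> l" for bs x
    using B(2)[of "bs @ [b]" x] that assms(2) by (simp add: iter_deriv_append iter_deriv_Cons)
  then show "\<exists>q. \<exists>B\<ge>0. \<forall>bs x. set bs \<subseteq> Basis \<longrightarrow> length bs \<le> l \<longrightarrow>
     norm (iter_deriv bs (partial_deriv b f) x) \<le> B * (1 + norm x) ^ q"
    using B(1) by blast
qed

lemma schwartz_imp_mult_space: "f \<in> schwartz \<Longrightarrow> f \<in> mult_space"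
proof -
  assume f: "f \<in> schwartz"
  have "mu (- int 0) (real l) f < \<infinity>" for l
    using f by (simp add: schwartz_def) (metis of_nat_0)
  then show ?thesis using f unfolding mult_space_def schwartz_def by blast
qed

lemma mult_space_sum:
  fixes f :: "'i \<Rightarrow> 'a::euclidean_space \<Rightarrow> complex"
  assumes "finite I" "\<And>i. i \<in> I \<Longrightarrow> f i \<in> mult_space"
  shows "(\<lambda>x. \<Sum>i\<in>I. z i * f i x) \<in> mult_space"
  using assms
proof (induction I)
  case empty
  have "norm (iter_deriv bs (\<lambda>x::'a. 0) x) \<le> 0 * (1 + norm x) ^ 0" for bs and x :: 'a
    by (simp add: iter_deriv_zero)
  then have "\<exists>q. \<exists>B\<ge>0. \<forall>bs x. set bs \<subseteq> Basis \<longrightarrow> length bs \<le> l \<longrightarrow>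
     norm (iter_deriv bs (\<lambda>x::'a. 0) x) \<le> B * (1 + norm x) ^ q" for l
    by blast
  then show ?case unfolding mult_space_iff by (simp add: smooth_zero)
next
  case (insert i I)
  then show ?case
    using mult_space_lincomb[of "f i" "\<lambda>x. \<Sum>i\<in>I. z i * f i x" "z i" 1] by simp
qed

lemma schwartz_sum:
  fixes f :: "'i \<Rightarrow> 'a::euclidean_space \<Rightarrow> complex"
  assumes "finite I" "\<And>i. i \<in> I \<Longrightarrow> f i \<in> schwartz"
  shows "(\<lambda>x. \<Sum>i\<in>I. z i * f i x) \<in> schwartz"
  using assms
proof (induction I)
  case empty
  have "(1 + norm x) ^ q * norm (iter_deriv bs (\<lambda>x::'a. 0) x) \<le> 0" for bs q and x :: 'a
    by (simp add: iter_deriv_zero)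
  then show ?case unfolding schwartz_iff by (simp add: smooth_zero) blast
next
  case (insert i I)
  then show ?case
    using schwartz_lincomb[of "f i" "\<lambda>x. \<Sum>i\<in>I. z i * f i x" "z i" 1] by simp
qed

section \<open>Integral operators with slowly growing kernels\<close>

text \<open>Domination by a series of indicators of concentric balls: the point \<open>y\<close> is
  charged to the ball of radius \<open>1 + real k\<close> with \<open>k\<close> the floor of its
  norm. The ball volume uses up \<open>DIM('a)\<close> powers, and the two extra powers leave the
  convergent series of 1 / (k + 1)^2.\<close>

lemma integrable_weight:
  "integrable lborel (\<lambda>y::'a::euclidean_space. 1 / (1 + norm y) ^ (DIM('a) + 2))"
proof (rule integrableI_bounded)
  let ?d = "DIM('a) + 2"
  let ?v = "unit_ball_vol (real DIM('a))"
  define c :: "nat \<Rightarrow> real" where "c k = 1 / (1 + real k) ^ ?d" for k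
  have "ennreal (norm (1 / (1 + norm y) ^ ?d)) \<le> (\<Sum>k. ennreal (c k) * indicator (ball 0 (1 + real k)) y)"
    for y :: 'a
  proof -
    define k where "k = nat \<lfloor>norm y\<rfloor>"
    have k: "real k \<le> norm y" "norm y < 1 + real k"
      unfolding k_def using norm_ge_zero[of y] by linarith+
    have "1 / (1 + norm y) ^ ?d \<le> c k"
      unfolding c_def using k by (intro divide_left_mono power_mono mult_pos_pos zero_less_power) auto
    then have "ennreal (norm (1 / (1 + norm y) ^ ?d)) \<le> ennreal (c k) * indicator (ball 0 (1 + real k)) y"
      using k by (simp add: ennreal_leI)
    also have "\<dots> \<le> (\<Sum>k. ennreal (c k) * indicator (ball 0 (1 + real k)) y)"
      using sum_le_suminf[of "\<lambda>k. ennreal (c k) * indicator (ball 0 (1 + real k)) y" "{k}", OF _ finite.intros(2)[OF finite.emptyI]]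
      by (simp only: sum.insert finite.emptyI empty_iff not_False_eq_True sum.empty add_0_right summableI ball_simps zero_le simp_thms)
    finally show ?thesis .
  qed
  then have "(\<integral>\<^sup>+ y. ennreal (norm (1 / (1 + norm y) ^ ?d)) \<partial>(lborel :: 'a measure))
      \<le> (\<integral>\<^sup>+ y. (\<Sum>k. ennreal (c k) * indicator (ball 0 (1 + real k)) y) \<partial>(lborel :: 'a measure))"
    by (intro nn_integral_mono) simp
  also have "\<dots> = (\<Sum>k. \<integral>\<^sup>+ y. ennreal (c k) * indicator (ball 0 (1 + real k)) y \<partial>(lborel :: 'a measure))"
    by (intro nn_integral_suminf borel_measurable_times_ennreal borel_measurable_const borel_measurable_indicator) auto
  also have "\<dots> = (\<Sum>k. ennreal (?v * (1 / real (Suc k) ^ 2)))"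
  proof (intro suminf_cong)
    fix k
    have "(\<integral>\<^sup>+ y. ennreal (c k) * indicator (ball 0 (1 + real k)) y \<partial>(lborel :: 'a measure))
        = ennreal (c k) * ennreal (?v * (1 + real k) ^ DIM('a))"
      by (subst nn_integral_cmult_indicator) (auto simp: emeasure_ball)
    also have "\<dots> = ennreal (c k * (?v * (1 + real k) ^ DIM('a)))"
      by (subst ennreal_mult) (auto simp: c_def)
    also have "c k * (?v * (1 + real k) ^ DIM('a)) = ?v * (1 / real (Suc k) ^ 2)"
      by (simp add: c_def power_add power2_eq_square add.commute)
    finally show "(\<integral>\<^sup>+ y. ennreal (c k) * indicator (ball 0 (1 + real k)) y \<partial>(lborel :: 'a measure))
        = ennreal (?v * (1 / real (Suc k) ^ 2))" .
  qed
  also have "\<dots> < \<infinity>"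
  proof -
    have "summable (\<lambda>k. 1 / real (Suc k) ^ 2)"
      using inverse_power_summable[of 2, where 'a = real] by (subst summable_Suc_iff) (simp add: inverse_eq_divide)
    then have "summable (\<lambda>k. ?v * (1 / real (Suc k) ^ 2))" by (rule summable_mult)
    then show ?thesis
      by (subst suminf_ennreal2) (auto simp: less_top)
  qed
  finally show "(\<integral>\<^sup>+ y. ennreal (norm (1 / (1 + norm y) ^ ?d)) \<partial>(lborel :: 'a measure)) < \<infinity>" .
qed measurable

definition weight_integral :: "'a::euclidean_space itself \<Rightarrow> real" where
  "weight_integral _ = (\<integral>y. 1 / (1 + norm (y::'a)) ^ (DIM('a) + 2) \<partial>lborel)"

lemma weight_integral_nonneg: "0 \<le> weight_integral TYPE('a::euclidean_space)"
  unfolding weight_integral_def by (rule integral_nonneg_AE) auto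

lemma weight_bound_integral:
  fixes g :: "'a::euclidean_space \<Rightarrow> 'b::{banach, second_countable_topology}"
  assumes "g \<in> borel_measurable borel" "\<And>y. (1 + norm y) ^ (DIM('a) + 2) * norm (g y) \<le> B"
  shows "integrable lborel g" "norm (\<integral>y. g y \<partial>lborel) \<le> B * weight_integral TYPE('a)"
proof -
  let ?w = "\<lambda>y::'a. B * (1 / (1 + norm y) ^ (DIM('a) + 2))"
  have le: "norm (g y) \<le> ?w y" for y
    using assms(2)[of y] by (simp add: field_simps add_pos_nonneg)
  have w: "integrable lborel ?w" using integrable_weight by (rule integrable_mult_right)
  have "0 \<le> B"
    by (rule order_trans[OF _ assms(2)[of 0]]) simp
  show g: "integrable lborel g"
    by (rule Bochner_Integration.integrable_bound[OF w]) (use assms(1) le \<open>0 \<le> B\<close> in auto)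
  have "norm (\<integral>y. g y \<partial>lborel) \<le> (\<integral>y. ?w y \<partial>lborel)"
    by (rule Bochner_Integration.integral_norm_bound_integral[OF g w le])
  then show "norm (\<integral>y. g y \<partial>lborel) \<le> B * weight_integral TYPE('a)"
    unfolding weight_integral_def by (subst (asm) integral_mult_right_zero)
qed

section \<open>Mean value and second-order Taylor estimates along segments\<close>

lemma vector_mvt_bound:
  fixes g :: "real \<Rightarrow> 'a::real_inner"
  assumes "a \<le> b" "\<And>t. t \<in> {a..b} \<Longrightarrow> (g has_vector_derivative g' t) (at t)"
    and "\<And>t. t \<in> {a..b} \<Longrightarrow> norm (g' t) \<le> B"
  shows "norm (g b - g a) \<le> B * (b - a)"
proof (cases "a = b")
  case False
  then have "a < b" using assms(1) by simp
  moreover have "continuous_on {a..b} g"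
    using assms(2) by (intro continuous_at_imp_continuous_on ballI has_vector_derivative_continuous) blast
  ultimately obtain x where x: "x \<in> {a<..<b}" "norm (g b - g a) \<le> norm ((b - a) *\<^sub>R g' x)"
    using mvt_general[of a b g "\<lambda>x h. h *\<^sub>R g' x"] assms(2)
    unfolding has_vector_derivative_def by auto
  have "norm ((b - a) *\<^sub>R g' x) \<le> B * (b - a)"
    using assms(3)[of x] x(1) \<open>a < b\<close> by (simp add: mult.commute mult_left_mono)
  then show ?thesis using x(2) by linarith
qed simp

text \<open>Allows differentiation under an integral sign by integrating a quadratic Taylor
  remainder, in place of a limit theorem for integrals.\<close>

lemma quadratic_has_derivative:
  assumes "bounded_linear D" and "\<And>v. norm v \<le> 1 \<Longrightarrow> norm (F (x + v) - F x - D v) \<le> C * norm v ^ 2"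
  shows "(F has_derivative D) (at x)"
  unfolding has_derivative_at_alt
proof (intro conjI allI impI assms(1))
  fix e :: real assume e: "e > 0"
  \<comment> \<open>The \<open>1\<close> in the minimum keeps increments in the range of the
    assumption; adding 1 to \<bar>C\<bar> covers \<open>C = 0\<close>.\<close>
  define d where "d = min 1 (e / (\<bar>C\<bar> + 1))"
  have "norm (F y - F x - D (y - x)) \<le> e * norm (y - x)" if y: "norm (y - x) < d" for y
  proof -
    let ?n = "norm (y - x)"
    have "\<bar>C\<bar> * ?n \<le> (\<bar>C\<bar> + 1) * (e / (\<bar>C\<bar> + 1))"
      using y by (intro mult_mono) (auto simp: d_def)
    then have "\<bar>C\<bar> * ?n \<le> e" by simp
    then have "C * ?n \<le> e" by (rule order_trans[rotated]) (simp add: mult_right_mono)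
    then have "C * ?n * ?n \<le> e * ?n" by (simp add: mult_right_mono)
    moreover have "norm (F (x + (y - x)) - F x - D (y - x)) \<le> C * ?n ^ 2"
      using y by (intro assms(2)) (simp add: d_def)
    ultimately show ?thesis by (simp add: power2_eq_square mult.assoc)
  qed
  moreover have "d > 0" using e by (simp add: d_def)
  ultimately show "\<exists>d>0. \<forall>y. norm (y - x) < d \<longrightarrow> norm (F y - F x - D (y - x)) \<le> e * norm (y - x)" by blast
qed

text \<open>The l1 norm of \<open>v\<close> appears because the partial derivatives are bounded one
  by one rather than through the gradient.\<close>

lemma smooth_increment_bound:
  fixes f :: "'a::euclidean_space \<Rightarrow> complex"
  assumes "smooth f" "0 \<le> t" "\<And>b s. b \<in> Basis \<Longrightarrow> s \<in> {0..t} \<Longrightarrow> norm (partial_deriv b f (x + s *\<^sub>R v)) \<le> B"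
  shows "norm (f (x + t *\<^sub>R v) - f x) \<le> (\<Sum>b\<in>Basis. \<bar>v \<bullet> b\<bar>) * B * t"
proof -
  have "norm (f (x + t *\<^sub>R v) - f (x + 0 *\<^sub>R v)) \<le> (\<Sum>b\<in>Basis. \<bar>v \<bullet> b\<bar>) * B * (t - 0)"
  proof (rule vector_mvt_bound[OF assms(2) smooth_line_derivative[OF assms(1)]])
    fix s assume s: "s \<in> {0..t}"
    have "norm (\<Sum>b\<in>Basis. (v \<bullet> b) *\<^sub>R partial_deriv b f (x + s *\<^sub>R v)) \<le>
        (\<Sum>b\<in>Basis. \<bar>v \<bullet> b\<bar> * B)"
      by (rule sum_norm_le) (use assms(3) s in \<open>simp add: mult_left_mono\<close>)
    then show "norm (\<Sum>b\<in>Basis. (v \<bullet> b) *\<^sub>R partial_deriv b f (x + s *\<^sub>R v)) \<le>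
        (\<Sum>b\<in>Basis. \<bar>v \<bullet> b\<bar>) * B"
      by (simp add: sum_distrib_right)
  qed
  then show ?thesis by simp
qed

text \<open>The mean value inequality twice: for the partial derivatives along the segment, and for
  the path minus its tangent at 0, whose derivative is the increment \<open>?g' t - ?g' 0\<close>.
  This gives the constant 1 where Taylor's formula has 1/2.\<close>

lemma smooth_second_order_bound:
  fixes f :: "'a::euclidean_space \<Rightarrow> complex"
  assumes f: "smooth f"
    and B: "\<And>b c s. b \<in> Basis \<Longrightarrow> c \<in> Basis \<Longrightarrow> s \<in> {0..1} \<Longrightarrow>
      norm (partial_deriv c (partial_deriv b f) (x + s *\<^sub>R v)) \<le> B"
  shows "norm (f (x + v) - f x - (\<Sum>b\<in>Basis. (v \<bullet> b) *\<^sub>R partial_deriv b f x))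
    \<le> (\<Sum>b\<in>Basis. \<bar>v \<bullet> b\<bar>)\<^sup>2 * B"
proof -
  define V where "V = (\<Sum>b\<in>Basis. \<bar>v \<bullet> b\<bar>)"
  have V: "0 \<le> V" unfolding V_def by (simp add: sum_nonneg)
  have B0: "0 \<le> B" using B[of "SOME b. b \<in> Basis" "SOME b. b \<in> Basis" 0]
    by (simp add: SOME_Basis) (meson norm_ge_zero order_trans)
  let ?g' = "\<lambda>t. \<Sum>b\<in>Basis. (v \<bullet> b) *\<^sub>R partial_deriv b f (x + t *\<^sub>R v)"
  let ?G = "\<lambda>t. f (x + t *\<^sub>R v) - t *\<^sub>R ?g' 0"
  have "norm (?G 1 - ?G 0) \<le> V\<^sup>2 * B * (1 - 0)"
  proof (rule vector_mvt_bound)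
    fix t :: real assume t: "t \<in> {0..1}"
    have "((\<lambda>t. t *\<^sub>R ?g' 0) has_vector_derivative ?g' 0) (at t)"
      by (auto intro!: derivative_eq_intros)
    from has_vector_derivative_diff[OF smooth_line_derivative[OF f] this]
    show "(?G has_vector_derivative ?g' t - ?g' 0) (at t)" .
    have "norm (?g' t - ?g' 0) = norm (\<Sum>b\<in>Basis. (v \<bullet> b) *\<^sub>R (partial_deriv b f (x + t *\<^sub>R v) - partial_deriv b f x))"
      by (simp add: sum_subtractf scaleR_diff_right)
    also have "\<dots> \<le> (\<Sum>b\<in>Basis. \<bar>v \<bullet> b\<bar> * (V * B * 1))"
    proof (rule sum_norm_le)
      fix b :: 'a assume b: "b \<in> Basis"
      have "norm (partial_deriv b f (x + t *\<^sub>R v) - partial_deriv b f x) \<le> V * B * t"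
        unfolding V_def
        by (rule smooth_increment_bound) (use f b B t in \<open>auto simp: smooth_partial_deriv\<close>)
      also have "\<dots> \<le> V * B * 1" using t V B0 by (intro mult_left_mono) auto
      finally show "norm ((v \<bullet> b) *\<^sub>R (partial_deriv b f (x + t *\<^sub>R v) - partial_deriv b f x)) \<le> \<bar>v \<bullet> b\<bar> * (V * B * 1)"
        by (simp add: mult_left_mono)
    qed
    also have "\<dots> = V\<^sup>2 * B" by (simp add: V_def power2_eq_square sum_distrib_right mult.assoc)
    finally show "norm (?g' t - ?g' 0) \<le> V\<^sup>2 * B" .
  qed simp
  then show ?thesis by (simp add: V_def algebra_simps)
qed

section \<open>Differentiation under the integral sign\<close>

definition kernel_int :: "('b::euclidean_space \<times> 'a::euclidean_space \<Rightarrow> complex) \<Rightarrow> ('a \<Rightarrow> complex) \<Rightarrow> 'b \<Rightarrow> complex" where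
  "kernel_int h f x = (\<integral>y. h (x, y) * f y \<partial>lborel)"

text \<open>Splits the weight of the product space into one in \<open>x\<close>, which leaves the
  integral, and one in \<open>y\<close>, which the decay of the integrand absorbs.\<close>

lemma one_plus_norm_Pair_le: "1 + norm (x, y) \<le> (1 + norm x) * (1 + norm y)"
proof -
  have "norm (x, y) + 0 \<le> norm x + norm y + norm x * norm y"
    by (intro add_mono norm_Pair_le) simp
  then show ?thesis by (simp add: algebra_simps)
qed

text \<open>The decay of \<open>f\<close> is spent twice: \<open>q\<close> powers compensate the
  growth of \<open>k\<close>, the remaining \<open>DIM('a) + 2\<close> make the product integrable
  by \<open>integrable_weight\<close>.\<close>

lemma kernel_int_weight_bound:
  fixes f :: "'a::euclidean_space \<Rightarrow> complex"
  assumes "continuous_on UNIV k" "continuous_on UNIV f" "0 \<le> A"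
    and "\<And>y. norm (k y) \<le> A * (1 + norm y) ^ q"
    and "\<And>y. (1 + norm y) ^ (q + (DIM('a) + 2)) * norm (f y) \<le> B"
  shows "integrable lborel (\<lambda>y. k y * f y)"
    and "norm (\<integral>y. k y * f y \<partial>lborel) \<le> A * B * weight_integral TYPE('a)"
proof -
  have m: "(\<lambda>y. k y * f y) \<in> borel_measurable borel"
    using assms(1,2) by (intro borel_measurable_continuous_onI continuous_intros)
  have "(1 + norm y) ^ (DIM('a) + 2) * norm (k y * f y) \<le> A * B" for y
  proof -
    have "norm (k y * f y) \<le> A * (1 + norm y) ^ q * norm (f y)"
      using assms(4)[of y] by (simp add: norm_mult mult_right_mono)
    then have "(1 + norm y) ^ (DIM('a) + 2) * norm (k y * f y) \<le>
        (1 + norm y) ^ (DIM('a) + 2) * (A * (1 + norm y) ^ q * norm (f y))"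
      by (intro mult_left_mono) auto
    also have "\<dots> = A * ((1 + norm y) ^ (q + (DIM('a) + 2)) * norm (f y))"
      by (simp add: power_add mult_ac)
    also have "\<dots> \<le> A * B" by (intro mult_left_mono assms)
    finally show ?thesis .
  qed
  from weight_bound_integral[OF m this]
  show "integrable lborel (\<lambda>y. k y * f y)"
    "norm (\<integral>y. k y * f y \<partial>lborel) \<le> A * B * weight_integral TYPE('a)" by auto
qed

lemma continuous_Pair_section:
  "smooth h \<Longrightarrow> continuous_on UNIV (\<lambda>y. h (x, y))"
  by (rule smooth_continuous_compose) (auto intro!: continuous_intros)

lemma kernel_int_integrable:
  fixes f :: "'a::euclidean_space \<Rightarrow> complex" and h :: "'b::euclidean_space \<times> 'a \<Rightarrow> complex"
  assumes h: "h \<in> mult_space" and f: "f \<in> schwartz"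
  shows "integrable lborel (\<lambda>y. h (x, y) * f y)"
proof -
  obtain q A where A: "0 \<le> A" "\<And>bs z. set bs \<subseteq> Basis \<Longrightarrow> length bs \<le> 0 \<Longrightarrow>
     norm (iter_deriv bs h z) \<le> A * (1 + norm z) ^ q"
    using h unfolding mult_space_iff by blast
  obtain B where B: "\<And>y. (1 + norm y) ^ (q + (DIM('a) + 2)) * norm (f y) \<le> B"
    using schwartz_decay[OF f] by blast
  have "norm (h (x, y)) \<le> (A * (1 + norm x) ^ q) * (1 + norm y) ^ q" for y
  proof -
    have "norm (h (x, y)) \<le> A * (1 + norm (x, y)) ^ q" using A(2)[of "[]" "(x, y)"] by simp
    also have "\<dots> \<le> A * ((1 + norm x) * (1 + norm y)) ^ q"
      by (intro mult_left_mono power_mono one_plus_norm_Pair_le A) auto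
    finally show ?thesis by (simp add: power_mult_distrib mult.assoc)
  qed
  then show ?thesis
    by (rule kernel_int_weight_bound(1)[rotated 3, OF _ B])
      (simp_all add: continuous_Pair_section smooth_continuous_on schwartz_smooth[OF f] mult_space_smooth[OF h] A(1))
qed

lemma sum_Basis_Pair:
  fixes f :: "'a::euclidean_space \<times> 'b::euclidean_space \<Rightarrow> 'c::comm_monoid_add"
  shows "sum f Basis = (\<Sum>b\<in>Basis. f (b, 0)) + (\<Sum>b\<in>Basis. f (0, b))"
  unfolding Basis_prod_def
  by (subst sum.union_disjoint) (auto simp: sum.reindex inj_on_def)

text \<open>The second-order remainder of \<open>h\<close> in its first variable is quadratic in
  \<open>v\<close> and grows in \<open>y\<close> only polynomially, with the exponent
  \<open>q\<close> of the second derivatives of \<open>h\<close>. Integrated against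
  \<open>f\<close> it stays quadratic in \<open>v\<close>.\<close>

lemma kernel_int_has_derivative:
  fixes f :: "'a::euclidean_space \<Rightarrow> complex" and h :: "'b::euclidean_space \<times> 'a \<Rightarrow> complex"
  assumes h: "h \<in> mult_space" and f: "f \<in> schwartz"
  shows "(kernel_int h f has_derivative
    (\<lambda>v. \<Sum>b\<in>Basis. (v \<bullet> b) *\<^sub>R kernel_int (partial_deriv (b, 0) h) f x)) (at x)"
proof -
  note hs = mult_space_smooth[OF h]
  obtain q A where A: "0 \<le> A" "\<And>bs z. set bs \<subseteq> Basis \<Longrightarrow> length bs \<le> 2 \<Longrightarrow>
     norm (iter_deriv bs h z) \<le> A * (1 + norm z) ^ q"
    using h unfolding mult_space_iff by blast
  obtain B where B: "\<And>y. (1 + norm y) ^ (q + (DIM('a) + 2)) * norm (f y) \<le> B"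
    using schwartz_decay[OF f] by blast
  \<comment> \<open>\<open>real DIM('b) ^ 2\<close> comes from replacing the l1 norm of
    \<open>v\<close> by the Euclidean one, and \<open>2 + norm x\<close> bounds
    \<open>1 + norm\<close> on the segment from \<open>x\<close> to \<open>x + v\<close>, which has
    length at most 1.\<close>
  define C where "C = real DIM('b) ^ 2 * (A * (2 + norm x) ^ q)"
  have C: "0 \<le> C" using A by (simp add: C_def)
  let ?D = "\<lambda>v y. \<Sum>b\<in>Basis. (v \<bullet> b) *\<^sub>R partial_deriv (b, 0) h (x, y)"
  have int: "integrable lborel (\<lambda>y. h (x', y) * f y)" for x' by (rule kernel_int_integrable[OF h f])
  have pint: "integrable lborel (\<lambda>y. partial_deriv (b, 0) h (x, y) * f y)" if "b \<in> Basis" for b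
    by (rule kernel_int_integrable[OF partial_deriv_mult_space[OF h] f]) (use that in \<open>simp add: Basis_prod_def\<close>)
  have rem: "norm (h (x + v, y) - h (x, y) - ?D v y) \<le> C * norm v ^ 2 * (1 + norm y) ^ q"
    if v: "norm v \<le> 1" for v y
  proof -
    have "norm (h ((x, y) + (v, 0)) - h (x, y) - (\<Sum>b\<in>Basis. ((v, 0) \<bullet> b) *\<^sub>R partial_deriv b h (x, y)))
        \<le> (\<Sum>b\<in>Basis. \<bar>(v, 0::'a) \<bullet> b\<bar>)\<^sup>2 * (A * ((2 + norm x) * (1 + norm y)) ^ q)"
    proof (rule smooth_second_order_bound[OF hs])
      fix b c :: "'b \<times> 'a" and s :: real assume bc: "b \<in> Basis" "c \<in> Basis" and s: "s \<in> {0..1}"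
      have "norm (partial_deriv c (partial_deriv b h) ((x, y) + s *\<^sub>R (v, 0))) \<le> A * (1 + norm ((x, y) + s *\<^sub>R (v, 0))) ^ q"
        using A(2)[of "[c, b]" "(x, y) + s *\<^sub>R (v, 0)"] bc by (simp add: iter_deriv_Cons)
      also have "\<dots> \<le> A * ((2 + norm x) * (1 + norm y)) ^ q"
      proof (intro mult_left_mono power_mono A)
        have "1 + norm ((x, y) + s *\<^sub>R (v, 0)) \<le> (1 + norm (x + s *\<^sub>R v)) * (1 + norm y)"
          using one_plus_norm_Pair_le[of "x + s *\<^sub>R v" y] by simp
        also have "\<dots> \<le> (2 + norm x) * (1 + norm y)"
          using norm_triangle_ineq[of x "s *\<^sub>R v"] mult_le_one[of s "norm v"] s v
          by (intro mult_right_mono) auto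
        finally show "1 + norm ((x, y) + s *\<^sub>R (v, 0)) \<le> (2 + norm x) * (1 + norm y)" .
      qed auto
      finally show "norm (partial_deriv c (partial_deriv b h) ((x, y) + s *\<^sub>R (v, 0)))
        \<le> A * ((2 + norm x) * (1 + norm y)) ^ q" .
    qed
    moreover have "(\<Sum>b\<in>Basis. ((v, 0) \<bullet> b) *\<^sub>R partial_deriv b h (x, y)) = ?D v y"
      by (simp add: sum_Basis_Pair)
    moreover have "(\<Sum>b\<in>Basis. \<bar>(v, 0::'a) \<bullet> b\<bar>) \<le> real DIM('b) * norm v"
      by (simp add: sum_Basis_Pair sum_bounded_above Basis_le_norm)
    then have "(\<Sum>b\<in>Basis. \<bar>(v, 0::'a) \<bullet> b\<bar>)\<^sup>2 * (A * ((2 + norm x) * (1 + norm y)) ^ q)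
        \<le> (real DIM('b) * norm v)\<^sup>2 * (A * ((2 + norm x) * (1 + norm y)) ^ q)"
      using A by (intro mult_right_mono power_mono) (auto intro: sum_nonneg)
    ultimately show ?thesis by (simp add: C_def power_mult_distrib mult_ac)
  qed
  have D: "(\<integral>y. ?D v y * f y \<partial>lborel) = (\<Sum>b\<in>Basis. (v \<bullet> b) *\<^sub>R kernel_int (partial_deriv (b, 0) h) f x)"
    "integrable lborel (\<lambda>y. ?D v y * f y)" for v
    using pint unfolding kernel_int_def
    by (simp_all add: sum_distrib_right)
  show ?thesis
  proof (rule quadratic_has_derivative)
    show "bounded_linear (\<lambda>v. \<Sum>b\<in>Basis. (v \<bullet> b) *\<^sub>R kernel_int (partial_deriv (b, 0) h) f x)"
      by (intro bounded_linear_sum bounded_linear_scaleR_const bounded_linear_inner_left bounded_linear_ident)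
    fix v :: 'b assume v: "norm v \<le> 1"
    have "kernel_int h f (x + v) - kernel_int h f x - (\<Sum>b\<in>Basis. (v \<bullet> b) *\<^sub>R kernel_int (partial_deriv (b, 0) h) f x)
      = (\<integral>y. (h (x + v, y) - h (x, y) - ?D v y) * f y \<partial>lborel)"
      unfolding D(1)[symmetric] kernel_int_def[of h]
      using int D(2)[of v] by (simp add: left_diff_distrib)
    also have "norm \<dots> \<le> (C * norm v ^ 2) * B * weight_integral TYPE('a)"
    proof (rule kernel_int_weight_bound(2)[OF _ _ _ rem[OF v] B])
      show "continuous_on UNIV (\<lambda>y. h (x + v, y) - h (x, y) - ?D v y)"
        using hs by (intro continuous_intros continuous_Pair_section smooth_partial_deriv) (auto simp: Basis_prod_def)
    qed (use C f in \<open>auto intro: smooth_continuous_on schwartz_smooth\<close>)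
    finally show "norm (kernel_int h f (x + v) - kernel_int h f x -
        (\<Sum>b\<in>Basis. (v \<bullet> b) *\<^sub>R kernel_int (partial_deriv (b, 0) h) f x)) \<le> (C * B * weight_integral TYPE('a)) * norm v ^ 2"
      by (simp add: mult_ac)
  qed
qed

lemma partial_deriv_kernel_int:
  fixes h :: "'b::euclidean_space \<times> 'a::euclidean_space \<Rightarrow> complex"
  assumes "h \<in> mult_space" "f \<in> schwartz" "b \<in> Basis"
  shows "partial_deriv b (kernel_int h f) = kernel_int (partial_deriv (b, 0) h) f"
proof
  fix x
  have "(\<Sum>c\<in>Basis. (b \<bullet> c) *\<^sub>R kernel_int (partial_deriv (c, 0) h) f x) =
      (\<Sum>c\<in>Basis. if c = b then kernel_int (partial_deriv (c, 0) h) f x else 0)"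
    by (rule sum.cong) (use assms(3) in \<open>auto simp: inner_Basis\<close>)
  then show "partial_deriv b (kernel_int h f) x = kernel_int (partial_deriv (b, 0) h) f x"
    using partial_deriv_eqI[OF kernel_int_has_derivative[OF assms(1,2)], of b x] assms(3)
    by simp
qed

lemma smooth_kernel_int:
  fixes h :: "'b::euclidean_space \<times> 'a::euclidean_space \<Rightarrow> complex"
  assumes "h \<in> mult_space" and f: "f \<in> schwartz"
  shows "smooth (kernel_int h f)"
proof (rule smoothI[where P = "\<lambda>K. \<exists>h\<in>mult_space. K = kernel_int h f"])
  show "\<exists>h'\<in>mult_space. kernel_int h f = kernel_int h' f" using assms by blast
next
  fix K assume "\<exists>h\<in>mult_space. K = kernel_int h f"
  then show "K differentiable_on UNIV"
    using kernel_int_has_derivative[OF _ f] by (force simp: differentiable_on_def differentiable_def)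
next
  fix K :: "'b \<Rightarrow> complex" and b :: 'b assume "\<exists>h\<in>mult_space. K = kernel_int h f" and b: "b \<in> Basis"
  then obtain h :: "'b \<times> 'a \<Rightarrow> complex" where h: "h \<in> mult_space" "K = kernel_int h f" by blast
  have "partial_deriv (b, 0) h \<in> mult_space" using h b by (intro partial_deriv_mult_space) (auto simp: Basis_prod_def)
  then show "\<exists>h\<in>mult_space. partial_deriv b K = kernel_int h f"
    using partial_deriv_kernel_int[OF h(1) f b] h(2) by blast
qed

lemma iter_deriv_kernel_int:
  fixes h :: "'b::euclidean_space \<times> 'a::euclidean_space \<Rightarrow> complex"
  assumes h: "h \<in> mult_space" and f: "f \<in> schwartz" and "set bs \<subseteq> Basis"
  shows "iter_deriv bs (kernel_int h f) = kernel_int (iter_deriv (map (\<lambda>b. (b, 0)) bs) h) f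
    \<and> iter_deriv (map (\<lambda>b. (b, 0)) bs) h \<in> mult_space"
  using assms(3)
proof (induction bs)
  case (Cons b bs)
  moreover have "(b, 0) \<in> (Basis :: ('b \<times> 'a) set)" using Cons.prems by (simp add: Basis_prod_def)
  ultimately show ?case
    by (simp add: iter_deriv_Cons partial_deriv_kernel_int f partial_deriv_mult_space)
qed (simp add: h)

text \<open>All derivatives fall on \<open>h\<close>, so \<open>f\<close> enters through a seminorm
  of order zero and the growth exponent \<open>q\<close> of \<open>h\<close> carries over
  unchanged.\<close>

lemma mu_kernel_int_le:
  fixes h :: "'b::euclidean_space \<times> 'a::euclidean_space \<Rightarrow> complex"
  assumes h: "h \<in> mult_space" and f: "f \<in> schwartz" and "0 \<le> A" "0 \<le> B"
    and hA: "mu (- int q) (real l) h \<le> ennreal A"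
    and fB: "mu (int (q + (DIM('a) + 2))) 0 f \<le> ennreal B"
  shows "mu (- int q) (real l) (kernel_int h f) \<le> ennreal (A * B * weight_integral TYPE('a))"
proof (subst mu_neg_le_ennreal_iff[OF smooth_kernel_int[OF h f]])
  show "0 \<le> A * B * weight_integral TYPE('a)" using assms weight_integral_nonneg[where 'a = 'a] by simp
  show "\<forall>bs x. set bs \<subseteq> Basis \<longrightarrow> length bs \<le> l \<longrightarrow>
      norm (iter_deriv bs (kernel_int h f) x) \<le> A * B * weight_integral TYPE('a) * (1 + norm x) ^ q"
  proof (intro allI impI)
    fix bs :: "'b list" and x :: 'b assume bs: "set bs \<subseteq> Basis" "length bs \<le> l"
    let ?k = "iter_deriv (map (\<lambda>b. (b, 0)) bs) h"
    note k = iter_deriv_kernel_int[OF h f bs(1)]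
    have B: "(1 + norm y) ^ (q + (DIM('a) + 2)) * norm (f y) \<le> B" for y
      using fB mu_pos_le_ennreal_iff[OF schwartz_smooth[OF f] \<open>0 \<le> B\<close>, of "q + (DIM('a) + 2)" 0]
      by (auto dest: spec[of _ "[]"])
    have "norm (?k (x, y)) \<le> (A * (1 + norm x) ^ q) * (1 + norm y) ^ q" for y
    proof -
      have "set (map (\<lambda>b. (b, 0::'a)) bs) \<subseteq> Basis" using bs(1) by (auto simp: Basis_prod_def)
      then have "norm (?k (x, y)) \<le> A * (1 + norm (x, y)) ^ q"
        using hA bs(2) unfolding mu_neg_le_ennreal_iff[OF mult_space_smooth[OF h] \<open>0 \<le> A\<close>]
        by (metis length_map)
      also have "\<dots> \<le> A * ((1 + norm x) * (1 + norm y)) ^ q"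
        by (intro mult_left_mono power_mono one_plus_norm_Pair_le assms) auto
      finally show ?thesis by (simp add: power_mult_distrib mult.assoc)
    qed
    then have "norm (\<integral>y. ?k (x, y) * f y \<partial>lborel) \<le> (A * (1 + norm x) ^ q) * B * weight_integral TYPE('a)"
      by (rule kernel_int_weight_bound(2)[rotated 3, OF _ B])
        (simp_all add: continuous_Pair_section smooth_continuous_on schwartz_smooth[OF f] mult_space_smooth[OF conjunct2[OF k]] assms(3))
    then show "norm (iter_deriv bs (kernel_int h f) x) \<le> A * B * weight_integral TYPE('a) * (1 + norm x) ^ q"
      using k by (simp add: kernel_int_def mult_ac)
  qed
qed

lemma kernel_int_mult_space:
  fixes h :: "'b::euclidean_space \<times> 'a::euclidean_space \<Rightarrow> complex"
  assumes h: "h \<in> mult_space" and f: "f \<in> schwartz"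
  shows "kernel_int h f \<in> mult_space"
  unfolding mult_space_def
proof (intro CollectI conjI allI smooth_kernel_int assms)
  fix l :: nat
  obtain q where "mu (- int q) (real l) h < \<infinity>" using h unfolding mult_space_def by blast
  then obtain A where A: "0 \<le> A" "mu (- int q) (real l) h \<le> ennreal A" by (rule finite_ennreal_bound)
  have "mu (int (q + (DIM('a) + 2))) (real 0) f < \<infinity>" using f unfolding schwartz_def by blast
  then obtain B where B: "0 \<le> B" "mu (int (q + (DIM('a) + 2))) 0 f \<le> ennreal B"
    using finite_ennreal_bound by (metis of_nat_0)
  from mu_kernel_int_le[OF h f A(1) B(1) A(2) B(2)]
  show "\<exists>q. mu (- int q) (real l) (kernel_int h f) < \<infinity>"
    by (metis ennreal_less_top infinity_ennreal_def order_le_less_trans)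
qed

section \<open>Tensor products\<close>

definition tensor :: "('a \<Rightarrow> complex) \<Rightarrow> ('b \<Rightarrow> complex) \<Rightarrow> 'a \<times> 'b \<Rightarrow> complex" where
  "tensor u v z = u (fst z) * v (snd z)"

lemma tensor_has_derivative:
  fixes u :: "'a::euclidean_space \<Rightarrow> complex" and v :: "'b::euclidean_space \<Rightarrow> complex"
  assumes "(u has_derivative u') (at (fst z))" "(v has_derivative v') (at (snd z))"
  shows "(tensor u v has_derivative (\<lambda>w. u (fst z) * v' (snd w) + u' (fst w) * v (snd z))) (at z)"
proof -
  have "((\<lambda>w. u (fst w)) has_derivative (\<lambda>w. u' (fst w))) (at z)"
    by (rule has_derivative_compose[of fst fst z UNIV u u', OF _ assms(1)]) (intro has_derivative_fst has_derivative_ident)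
  moreover have "((\<lambda>w. v (snd w)) has_derivative (\<lambda>w. v' (snd w))) (at z)"
    by (rule has_derivative_compose[of snd snd z UNIV v v', OF _ assms(2)]) (intro has_derivative_snd has_derivative_ident)
  ultimately show ?thesis
    unfolding tensor_def[abs_def] by (rule has_derivative_mult)
qed

lemma partial_deriv_tensor:
  fixes u :: "'a::euclidean_space \<Rightarrow> complex" and v :: "'b::euclidean_space \<Rightarrow> complex"
  assumes "smooth u" "smooth v"
  shows "partial_deriv (b, 0) (tensor u v) = tensor (partial_deriv b u) v"
    and "partial_deriv (0, c) (tensor u v) = tensor u (partial_deriv c v)"
proof -
  {
    fix z :: "'a \<times> 'b"
    obtain u' v' where d: "(u has_derivative u') (at (fst z))" "(v has_derivative v') (at (snd z))"
      using smooth_has_derivative[OF assms(1)] smooth_has_derivative[OF assms(2)] by blast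
    note zero = linear_0[OF has_derivative_linear[OF d(1)]] linear_0[OF has_derivative_linear[OF d(2)]]
    have "partial_deriv (b, 0) (tensor u v) z = tensor (partial_deriv b u) v z
      \<and> partial_deriv (0, c) (tensor u v) z = tensor u (partial_deriv c v) z"
      using partial_deriv_eqI[OF tensor_has_derivative[OF d]] partial_deriv_eqI[OF d(1)] partial_deriv_eqI[OF d(2)]
      by (simp add: tensor_def zero)
  }
  then show "partial_deriv (b, 0) (tensor u v) = tensor (partial_deriv b u) v"
    "partial_deriv (0, c) (tensor u v) = tensor u (partial_deriv c v)" by blast+
qed

lemma smooth_tensor:
  fixes u :: "'a::euclidean_space \<Rightarrow> complex" and v :: "'b::euclidean_space \<Rightarrow> complex"
  assumes "smooth u" "smooth v"
  shows "smooth (tensor u v)"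
proof (rule smoothI[where P = "\<lambda>g. \<exists>u v. smooth u \<and> smooth v \<and> g = tensor u v"])
  fix g :: "'a \<times> 'b \<Rightarrow> complex" assume "\<exists>u v. smooth u \<and> smooth v \<and> g = tensor u v"
  then obtain u v where *: "smooth u" "smooth v" "g = tensor u v" by blast
  show "g differentiable_on UNIV"
    using tensor_has_derivative[OF smooth_has_derivative[OF *(1)] smooth_has_derivative[OF *(2)]]
    unfolding *(3) differentiable_on_def differentiable_def by blast
  fix b :: "'a \<times> 'b" assume "b \<in> Basis"
  then consider b' where "b = (b', 0)" "b' \<in> Basis" | b' where "b = (0, b')" "b' \<in> Basis"
    by (auto simp: Basis_prod_def)
  then show "\<exists>u v. smooth u \<and> smooth v \<and> partial_deriv b g = tensor u v"
    by cases (use * partial_deriv_tensor[OF *(1,2)] smooth_partial_deriv in blast)+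
qed (use assms in blast)

text \<open>A basis vector of the product space differentiates one factor only, so no Leibniz sum
  arises.\<close>

lemma iter_deriv_tensor:
  fixes u :: "'a::euclidean_space \<Rightarrow> complex" and v :: "'b::euclidean_space \<Rightarrow> complex"
  assumes "smooth u" "smooth v" "set bs \<subseteq> Basis"
  shows "\<exists>cs ds. set cs \<subseteq> Basis \<and> set ds \<subseteq> Basis \<and> length cs \<le> length bs \<and> length ds \<le> length bs \<and>
    iter_deriv bs (tensor u v) = tensor (iter_deriv cs u) (iter_deriv ds v)"
  using assms(3)
proof (induction bs)
  case Nil
  then show ?case by (intro exI[of _ "[]"]) simp
next
  case (Cons b bs)
  then obtain cs ds where *: "set cs \<subseteq> Basis" "set ds \<subseteq> Basis" "length cs \<le> length bs" "length ds \<le> length bs"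
    "iter_deriv bs (tensor u v) = tensor (iter_deriv cs u) (iter_deriv ds v)" by auto
  note pd = partial_deriv_tensor[OF smooth_iter_deriv[OF assms(1) *(1)] smooth_iter_deriv[OF assms(2) *(2)]]
  from Cons.prems consider b' where "b = (b', 0)" "b' \<in> Basis" | b' where "b = (0, b')" "b' \<in> Basis"
    by (auto simp: Basis_prod_def)
  then show ?case
  proof cases
    case 1
    then show ?thesis using * pd(1)[of b']
      by (intro exI[of _ "b' # cs"] exI[of _ ds]) (simp add: iter_deriv_Cons)
  next
    case 2
    then show ?thesis using * pd(2)[of b']
      by (intro exI[of _ cs] exI[of _ "b' # ds"]) (simp add: iter_deriv_Cons)
  qed
qed

lemma mu_tensor_le:
  fixes u :: "'a::euclidean_space \<Rightarrow> complex" and v :: "'b::euclidean_space \<Rightarrow> complex"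
  assumes "smooth u" "smooth v" "0 \<le> A" "0 \<le> B"
    and "mu (- int p) (real l) u \<le> ennreal A" "mu (- int q) (real l) v \<le> ennreal B"
  shows "mu (- int (p + q)) (real l) (tensor u v) \<le> ennreal (A * B)"
proof (subst mu_neg_le_ennreal_iff[OF smooth_tensor[OF assms(1,2)]])
  show "0 \<le> A * B" using assms by simp
  have uA: "norm (iter_deriv bs u x) \<le> A * (1 + norm x) ^ p" if "set bs \<subseteq> Basis" "length bs \<le> l" for bs x
    using assms(5) that unfolding mu_neg_le_ennreal_iff[OF assms(1,3)] by blast
  have vB: "norm (iter_deriv bs v x) \<le> B * (1 + norm x) ^ q" if "set bs \<subseteq> Basis" "length bs \<le> l" for bs x
    using assms(6) that unfolding mu_neg_le_ennreal_iff[OF assms(2,4)] by blast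
  show "\<forall>bs x. set bs \<subseteq> Basis \<longrightarrow> length bs \<le> l \<longrightarrow>
      norm (iter_deriv bs (tensor u v) x) \<le> A * B * (1 + norm x) ^ (p + q)"
  proof (intro allI impI)
    fix bs and z :: "'a \<times> 'b" assume bs: "set bs \<subseteq> (Basis :: ('a \<times> 'b) set)" "length bs \<le> l"
    obtain cs ds where *: "set cs \<subseteq> Basis" "set ds \<subseteq> Basis" "length cs \<le> length bs" "length ds \<le> length bs"
      "iter_deriv bs (tensor u v) = tensor (iter_deriv cs u) (iter_deriv ds v)"
      using iter_deriv_tensor[OF assms(1,2) bs(1)] by blast
    have z: "norm (fst z) \<le> norm z" "norm (snd z) \<le> norm z"
      using norm_fst_le[of "fst z" "snd z"] norm_snd_le[of "snd z" "fst z"] by simp_all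
    have "norm (iter_deriv bs (tensor u v) z) = norm (iter_deriv cs u (fst z)) * norm (iter_deriv ds v (snd z))"
      by (simp add: * tensor_def norm_mult)
    also have "\<dots> \<le> (A * (1 + norm (fst z)) ^ p) * (B * (1 + norm (snd z)) ^ q)"
      using * bs assms(3,4) by (intro mult_mono uA vB) auto
    also have "\<dots> \<le> (A * (1 + norm z) ^ p) * (B * (1 + norm z) ^ q)"
      using z assms(3,4) by (intro mult_mono mult_left_mono power_mono) auto
    also have "\<dots> = A * B * (1 + norm z) ^ (p + q)" by (simp add: power_add)
    finally show "norm (iter_deriv bs (tensor u v) z) \<le> A * B * (1 + norm z) ^ (p + q)" .
  qed
qed

lemma tensor_mult_space:
  fixes u :: "'a::euclidean_space \<Rightarrow> complex" and v :: "'b::euclidean_space \<Rightarrow> complex"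
  assumes "u \<in> mult_space" "v \<in> mult_space"
  shows "tensor u v \<in> mult_space"
  unfolding mult_space_def
proof (intro CollectI conjI allI smooth_tensor mult_space_smooth assms)
  fix l :: nat
  obtain p q where "mu (- int p) (real l) u < \<infinity>" "mu (- int q) (real l) v < \<infinity>"
    using assms unfolding mult_space_def by blast
  then obtain A B where "0 \<le> A" "mu (- int p) (real l) u \<le> ennreal A" "0 \<le> B" "mu (- int q) (real l) v \<le> ennreal B"
    by (meson finite_ennreal_bound)
  then have "mu (- int (p + q)) (real l) (tensor u v) \<le> ennreal (A * B)"
    using assms by (intro mu_tensor_le mult_space_smooth) auto
  then show "\<exists>q. mu (- int q) (real l) (tensor u v) < \<infinity>"
    by (metis ennreal_less_top infinity_ennreal_def order_le_less_trans)
qed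

section \<open>Gaussian monomials\<close>

text \<open>\<open>2 ^ k / fact k\<close> is the coefficient of (x y)^k in exp (2 x y). Its square
  root is given to each of the two factors, so that the products
  \<open>gauss_monomial k x * gauss_monomial k y\<close> sum to exp (-(x - y)^2).\<close>

definition gauss_monomial :: "nat \<Rightarrow> real \<Rightarrow> real" where
  "gauss_monomial k x = sqrt (2 ^ k / fact k) * x ^ k * exp (- x\<^sup>2)"

lemma power_div_fact_le_exp:
  assumes "0 \<le> (x::real)"
  shows "x ^ k / fact k \<le> exp x"
proof -
  have "(\<Sum>n\<in>{k}. x ^ n /\<^sub>R fact n) \<le> (\<Sum>n. x ^ n /\<^sub>R fact n)"
    using assms summable_exp_generic[of x] by (intro sum_le_suminf) auto
  then show ?thesis by (simp add: exp_def divide_inverse_commute)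
qed

text \<open>The square is a Poisson probability with mean 2 x^2, that is, one term of the series of
  exp (2 x^2) divided by its sum. The bound is uniform in \<open>k\<close>.\<close>

lemma abs_gauss_monomial_le: "\<bar>gauss_monomial k x\<bar> \<le> 1"
proof -
  have "(gauss_monomial k x)\<^sup>2 = (2 * x\<^sup>2) ^ k / fact k * exp (- (2 * x\<^sup>2))"
    by (simp add: gauss_monomial_def power_mult_distrib power_mult[symmetric] mult.commute[of 2 k]
        exp_add[symmetric] power2_eq_square[of "exp _"])
  also have "\<dots> \<le> exp (2 * x\<^sup>2) * exp (- (2 * x\<^sup>2))"
    by (intro mult_right_mono power_div_fact_le_exp) auto
  also have "\<dots> = 1" by (simp add: exp_add[symmetric])
  finally show ?thesis by (simp add: abs_square_le_1)
qed

text \<open>Multiplication by \<open>x\<close>, and differentiation in the next lemma, act as ladder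
  operators: they shift \<open>k\<close> by one and cost a factor of order sqrt k. This keeps
  seminorms of high degree polynomial in the degree.\<close>

lemma mult_gauss_monomial: "x * gauss_monomial k x = sqrt (real (Suc k) / 2) * gauss_monomial (Suc k) x"
proof -
  have "sqrt (2 ^ k / fact k) = sqrt (real (Suc k) / 2) * sqrt (2 ^ Suc k / fact (Suc k))"
    unfolding real_sqrt_mult[symmetric] by (simp add: field_simps del: of_nat_Suc)
  then show ?thesis by (simp add: gauss_monomial_def)
qed

lemma gauss_monomial_has_real_derivative:
  "(gauss_monomial k has_real_derivative
     sqrt (2 * real k) * gauss_monomial (k - 1) x - sqrt (2 * real (Suc k)) * gauss_monomial (Suc k) x) (at x)"
proof -
  have "(gauss_monomial k has_real_derivative
      sqrt (2 ^ k / fact k) * (real k * x ^ (k - 1)) * exp (- x\<^sup>2) - 2 * (x * gauss_monomial k x)) (at x)"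
    unfolding gauss_monomial_def[abs_def] by (auto intro!: derivative_eq_intros simp: algebra_simps)
  moreover have "2 * (x * gauss_monomial k x) = sqrt (2 * real (Suc k)) * gauss_monomial (Suc k) x"
  proof -
    have "2 * sqrt (real (Suc k) / 2) = sqrt (2\<^sup>2 * (real (Suc k) / 2))"
      unfolding real_sqrt_mult by simp
    then show ?thesis unfolding mult_gauss_monomial by simp
  qed
  \<comment> \<open>For \<open>k = 0\<close> the truncated difference \<open>k - 1\<close> does no
    harm, since both sides have the factor 0.\<close>
  moreover have "sqrt (2 ^ k / fact k) * (real k * x ^ (k - 1)) * exp (- x\<^sup>2) = sqrt (2 * real k) * gauss_monomial (k - 1) x"
  proof (cases k)
    case (Suc j)
    have "sqrt (2 ^ k / fact k) * real k = sqrt (2 ^ k / fact k * (real k)\<^sup>2)"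
      unfolding real_sqrt_mult by simp
    also have "2 ^ k / fact k * (real k)\<^sup>2 = 2 * real k * (2 ^ j / fact j)"
      by (simp add: Suc field_simps power2_eq_square del: of_nat_Suc)
    also have "sqrt \<dots> = sqrt (2 * real k) * sqrt (2 ^ j / fact j)" by (rule real_sqrt_mult)
    finally show ?thesis by (simp add: gauss_monomial_def Suc mult_ac)
  qed simp
  ultimately show ?thesis by simp
qed

definition gauss_tensor :: "real \<Rightarrow> ('a::euclidean_space \<Rightarrow> nat) \<Rightarrow> 'a \<Rightarrow> complex" where
  "gauss_tensor s \<alpha> u = complex_of_real (\<Prod>b\<in>Basis. gauss_monomial (\<alpha> b) (u \<bullet> b / s))"

lemma norm_gauss_tensor_le: "norm (gauss_tensor s \<alpha> u) \<le> 1"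
  unfolding gauss_tensor_def norm_of_real abs_prod
  by (rule prod_le_1) (auto intro: abs_gauss_monomial_le)

lemma prod_gauss_monomial_upd:
  assumes "(b :: 'a::euclidean_space) \<in> Basis"
  shows "(\<Prod>c\<in>Basis. gauss_monomial ((\<alpha>(b := k)) c) (u \<bullet> c / s)) =
    gauss_monomial k (u \<bullet> b / s) * (\<Prod>c\<in>Basis - {b}. gauss_monomial (\<alpha> c) (u \<bullet> c / s))"
  using prod.remove[OF finite_Basis assms, of "\<lambda>c. gauss_monomial ((\<alpha>(b := k)) c) (u \<bullet> c / s)"]
  by simp

lemma mult_gauss_tensor:
  fixes u :: "'a::euclidean_space"
  assumes "b \<in> Basis" "s \<noteq> 0"
  shows "of_real (u \<bullet> b) * gauss_tensor s \<alpha> u =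
    of_real (s * sqrt (real (Suc (\<alpha> b)) / 2)) * gauss_tensor s (\<alpha>(b := Suc (\<alpha> b))) u"
proof -
  have "(u \<bullet> b / s) * gauss_monomial (\<alpha> b) (u \<bullet> b / s) =
      sqrt (real (Suc (\<alpha> b)) / 2) * gauss_monomial (Suc (\<alpha> b)) (u \<bullet> b / s)"
    by (rule mult_gauss_monomial)
  then have "(u \<bullet> b) * gauss_monomial (\<alpha> b) (u \<bullet> b / s) =
      s * sqrt (real (Suc (\<alpha> b)) / 2) * gauss_monomial (Suc (\<alpha> b)) (u \<bullet> b / s)"
    using assms(2) by (simp add: field_simps)
  then have "(u \<bullet> b) * (\<Prod>c\<in>Basis. gauss_monomial (\<alpha> c) (u \<bullet> c / s)) =
      s * sqrt (real (Suc (\<alpha> b)) / 2) * (\<Prod>c\<in>Basis. gauss_monomial ((\<alpha>(b := Suc (\<alpha> b))) c) (u \<bullet> c / s))"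
    unfolding prod_gauss_monomial_upd[OF assms(1)]
    using prod_gauss_monomial_upd[OF assms(1), of \<alpha> "\<alpha> b" u s] by (simp add: mult.assoc[symmetric])
  then show ?thesis unfolding gauss_tensor_def of_real_mult[symmetric] of_real_eq_iff .
qed

lemma gauss_tensor_has_derivative:
  fixes u :: "'a::euclidean_space"
  shows "(gauss_tensor s \<alpha> has_derivative (\<lambda>v. \<Sum>b\<in>Basis. of_real ((v \<bullet> b) / s *
     (sqrt (2 * real (\<alpha> b)) * gauss_monomial (\<alpha> b - 1) (u \<bullet> b / s) -
      sqrt (2 * real (Suc (\<alpha> b))) * gauss_monomial (Suc (\<alpha> b)) (u \<bullet> b / s)) *
     (\<Prod>c\<in>Basis - {b}. gauss_monomial (\<alpha> c) (u \<bullet> c / s))))) (at u)"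
proof -
  let ?d = "\<lambda>b. sqrt (2 * real (\<alpha> b)) * gauss_monomial (\<alpha> b - 1) (u \<bullet> b / s) -
      sqrt (2 * real (Suc (\<alpha> b))) * gauss_monomial (Suc (\<alpha> b)) (u \<bullet> b / s)"
  have *: "((\<lambda>u. gauss_monomial (\<alpha> b) (u \<bullet> b / s)) has_derivative (\<lambda>v. (v \<bullet> b) / s * ?d b)) (at u)" for b
  proof -
    have "((\<lambda>u. u \<bullet> b / s) has_derivative (\<lambda>v. v \<bullet> b / s)) (at u)"
      unfolding divide_inverse by (auto intro!: derivative_eq_intros)
    from has_derivative_compose[OF this gauss_monomial_has_real_derivative[unfolded has_field_derivative_def]]
    show ?thesis by (simp add: mult.commute)
  qed
  have "((\<lambda>u. \<Prod>b\<in>Basis. gauss_monomial (\<alpha> b) (u \<bullet> b / s)) has_derivative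
     (\<lambda>v. \<Sum>b\<in>Basis. (v \<bullet> b) / s * ?d b * (\<Prod>c\<in>Basis - {b}. gauss_monomial (\<alpha> c) (u \<bullet> c / s)))) (at u)"
    by (rule has_derivative_prod[OF *])
  from has_derivative_of_real[OF this, where ?'a = complex] show ?thesis
    unfolding gauss_tensor_def[abs_def] of_real_sum .
qed

lemma partial_deriv_gauss_tensor:
  fixes b :: "'a::euclidean_space"
  assumes b: "b \<in> Basis"
  shows "partial_deriv b (gauss_tensor s \<alpha>) = (\<lambda>u.
    of_real (sqrt (2 * real (\<alpha> b)) / s) * gauss_tensor s (\<alpha>(b := \<alpha> b - 1)) u +
    of_real (- sqrt (2 * real (Suc (\<alpha> b))) / s) * gauss_tensor s (\<alpha>(b := Suc (\<alpha> b))) u)"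
proof
  fix u :: 'a
  let ?F = "\<lambda>v c. (v \<bullet> c) / s *
     (sqrt (2 * real (\<alpha> c)) * gauss_monomial (\<alpha> c - 1) (u \<bullet> c / s) -
      sqrt (2 * real (Suc (\<alpha> c))) * gauss_monomial (Suc (\<alpha> c)) (u \<bullet> c / s)) *
     (\<Prod>d\<in>Basis - {c}. gauss_monomial (\<alpha> d) (u \<bullet> d / s))"
  have "partial_deriv b (gauss_tensor s \<alpha>) u = (\<Sum>c\<in>Basis. of_real (?F b c))"
    by (rule partial_deriv_eqI[OF gauss_tensor_has_derivative])
  also have "\<dots> = (\<Sum>c\<in>Basis. if c = b then of_real (?F b c) else 0)"
    by (rule sum.cong) (use b in \<open>auto simp: inner_Basis\<close>)
  also have "\<dots> = of_real (?F b b)" using b by simp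
  also have "?F b b = sqrt (2 * real (\<alpha> b)) / s * (\<Prod>c\<in>Basis. gauss_monomial ((\<alpha>(b := \<alpha> b - 1)) c) (u \<bullet> c / s)) +
      (- sqrt (2 * real (Suc (\<alpha> b))) / s) * (\<Prod>c\<in>Basis. gauss_monomial ((\<alpha>(b := Suc (\<alpha> b))) c) (u \<bullet> c / s))"
    unfolding prod_gauss_monomial_upd[OF b] using b by (simp add: inner_Basis algebra_simps diff_divide_distrib)
  finally show "partial_deriv b (gauss_tensor s \<alpha>) u = of_real (sqrt (2 * real (\<alpha> b)) / s) * gauss_tensor s (\<alpha>(b := \<alpha> b - 1)) u +
      of_real (- sqrt (2 * real (Suc (\<alpha> b))) / s) * gauss_tensor s (\<alpha>(b := Suc (\<alpha> b))) u"
    unfolding gauss_tensor_def of_real_mult[symmetric] of_real_add[symmetric] .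
qed

lemma smooth_gauss_tensor: "smooth (gauss_tensor s \<alpha>)"
proof -
  \<comment> \<open>A partial derivative is a combination of two shifted tensors and so leaves the
    family; hence induction on \<open>k\<close> with \<open>Ck_lincomb\<close> instead of
    \<open>smoothI\<close>.\<close>
  have "Ck k (gauss_tensor s \<alpha>)" for k and \<alpha> :: "'a \<Rightarrow> nat"
  proof (induction k arbitrary: \<alpha>)
    case 0
    show ?case
      unfolding Ck.simps
      by (intro continuous_at_imp_continuous_on ballI) (rule has_derivative_continuous[OF gauss_tensor_has_derivative])
  next
    case (Suc k)
    have "gauss_tensor s \<alpha> differentiable_on UNIV"
      using gauss_tensor_has_derivative[of s \<alpha>] unfolding differentiable_on_def differentiable_def by blast
    then show ?case using Suc by (simp add: partial_deriv_gauss_tensor Ck_lincomb del: of_real_minus of_real_divide)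
  qed
  then show ?thesis by (simp add: smooth_def)
qed

text \<open>Each derivative and each weight factor costs one factor \<open>X\<close>. A derivative
  yields two shifted tensors with coefficients at most 2 (N + 1) / s; a weight factor is at most 1
  plus the l1 norm, and every coordinate raises one index at the cost of at most N + 1.
  \<open>N\<close> bounds the indices reachable in \<open>length bs + q\<close> such steps.\<close>

lemma iter_deriv_gauss_tensor_bound:
  fixes \<alpha> :: "'a::euclidean_space \<Rightarrow> nat"
  assumes s: "0 < s" "s \<le> 1" and "set bs \<subseteq> Basis"
    and "\<And>b. b \<in> Basis \<Longrightarrow> \<alpha> b + length bs + q \<le> N"
  shows "(1 + norm u) ^ q * norm (iter_deriv bs (gauss_tensor s \<alpha>) u) \<le>
    (4 * (real DIM('a) + 1) * (real N + 1) / s) ^ (length bs + q)"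
proof -
  define X where "X = 4 * (real DIM('a) + 1) * (real N + 1) / s"
  have sq: "sqrt (real k) \<le> real k" for k
    by (cases "k = 0") (auto simp: real_le_lsqrt self_le_power intro!: real_le_lsqrt)
  have X1: "1 + real DIM('a) * (real N + 1) \<le> X"
  proof -
    have "1 + real DIM('a) * (real N + 1) \<le> 4 * (real DIM('a) + 1) * (real N + 1)"
      by (simp add: algebra_simps)
    also have "\<dots> \<le> X" unfolding X_def using s by (simp add: le_divide_eq mult_left_le)
    finally show ?thesis .
  qed
  then have X0: "0 \<le> X" by (rule order_trans[rotated]) simp
  have base: "(1 + norm u) ^ q * norm (gauss_tensor s \<alpha> u) \<le> X ^ q"
    if "\<And>b. b \<in> Basis \<Longrightarrow> \<alpha> b + q \<le> N" for \<alpha> :: "'a \<Rightarrow> nat" and q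
    using that
  proof (induction q arbitrary: \<alpha>)
    case 0
    then show ?case by (simp add: norm_gauss_tensor_le)
  next
    case (Suc q)
    have up: "(1 + norm u) ^ q * (\<bar>u \<bullet> b\<bar> * norm (gauss_tensor s \<alpha> u)) \<le> (real N + 1) * X ^ q" if b: "b \<in> Basis" for b
    proof -
      have "\<bar>u \<bullet> b\<bar> * norm (gauss_tensor s \<alpha> u) =
          s * sqrt (real (Suc (\<alpha> b)) / 2) * norm (gauss_tensor s (\<alpha>(b := Suc (\<alpha> b))) u)"
        using arg_cong[OF mult_gauss_tensor[OF b, of s u \<alpha>], of norm] s by (simp add: norm_mult)
      moreover have "s * sqrt (real (Suc (\<alpha> b)) / 2) \<le> 1 * sqrt (real (Suc N))"
        using s Suc.prems[OF b] by (intro mult_mono real_sqrt_le_mono) auto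
      then have "s * sqrt (real (Suc (\<alpha> b)) / 2) \<le> real N + 1"
        using sq[of "Suc N"] by simp
      ultimately have "(1 + norm u) ^ q * (\<bar>u \<bullet> b\<bar> * norm (gauss_tensor s \<alpha> u)) \<le>
          (real N + 1) * ((1 + norm u) ^ q * norm (gauss_tensor s (\<alpha>(b := Suc (\<alpha> b))) u))"
        by (simp add: mult.left_commute[of "(1 + norm u) ^ q"] mult_right_mono)
      also have "\<dots> \<le> (real N + 1) * X ^ q"
      proof (intro mult_left_mono Suc.IH)
        fix c :: 'a assume "c \<in> Basis"
        with Suc.prems[OF this] show "(\<alpha>(b := Suc (\<alpha> b))) c + q \<le> N" by auto
      qed simp
      finally show ?thesis .
    qed
    have "(1 + norm u) ^ Suc q * norm (gauss_tensor s \<alpha> u) \<le>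
        (1 + norm u) ^ q * ((1 + (\<Sum>b\<in>Basis. \<bar>u \<bullet> b\<bar>)) * norm (gauss_tensor s \<alpha> u))"
      unfolding power_Suc2 mult.assoc
      by (intro mult_left_mono mult_right_mono add_left_mono norm_le_l1) auto
    also have "\<dots> = (1 + norm u) ^ q * norm (gauss_tensor s \<alpha> u) +
        (\<Sum>b\<in>Basis. (1 + norm u) ^ q * (\<bar>u \<bullet> b\<bar> * norm (gauss_tensor s \<alpha> u)))"
      by (simp add: distrib_right distrib_left sum_distrib_left sum_distrib_right mult_ac)
    also have "\<dots> \<le> X ^ q + (\<Sum>b\<in>(Basis::'a set). (real N + 1) * X ^ q)"
      using Suc.prems by (intro add_mono sum_mono up Suc.IH) force+
    also have "\<dots> = (1 + real DIM('a) * (real N + 1)) * X ^ q" by (simp add: algebra_simps)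
    also have "\<dots> \<le> X * X ^ q" using X1 X0 by (intro mult_right_mono) auto
    finally show ?case by simp
  qed
  have "(1 + norm u) ^ q * norm (iter_deriv bs (gauss_tensor s \<alpha>) u) \<le> X ^ (length bs + q)"
    if "set bs \<subseteq> Basis" "\<And>b. b \<in> Basis \<Longrightarrow> \<alpha> b + length bs + q \<le> N"
    for bs and \<alpha> :: "'a \<Rightarrow> nat"
    using that
  \<comment> \<open>Induction from the right, because the ladder formula applies to the innermost
    derivative; the induction hypothesis then treats the two shifted tensors.\<close>
  proof (induction bs arbitrary: \<alpha> rule: rev_induct)
    case Nil
    then show ?case using base by simp
  next
    case (snoc b bs)
    then have b: "b \<in> Basis" and bs: "set bs \<subseteq> Basis" by auto
    let ?a = "\<alpha>(b := \<alpha> b - 1)" and ?b = "\<alpha>(b := Suc (\<alpha> b))"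
    let ?x = "sqrt (2 * real (\<alpha> b)) / s" and ?y = "- sqrt (2 * real (Suc (\<alpha> b))) / s"
    have le: "sqrt (2 * real k) / s \<le> 2 * (real N + 1) / s" if "k \<le> Suc N" for k
      using sq[of "2 * k"] that s by (intro divide_right_mono) auto
    have ab: "\<bar>?x\<bar> \<le> 2 * (real N + 1) / s" "\<bar>?y\<bar> \<le> 2 * (real N + 1) / s"
      using le[of "\<alpha> b"] le[of "Suc (\<alpha> b)"] snoc.prems(2)[OF b] s by (simp_all add: abs_divide del: of_nat_Suc)
    have IHa: "(1 + norm u) ^ q * norm (iter_deriv bs (gauss_tensor s ?a) u) \<le> X ^ (length bs + q)"
      and IHb: "(1 + norm u) ^ q * norm (iter_deriv bs (gauss_tensor s ?b) u) \<le> X ^ (length bs + q)"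
    proof -
      have "?a c + length bs + q \<le> N" "?b c + length bs + q \<le> N" if "c \<in> Basis" for c
        using snoc.prems(2)[OF that] by auto
      then show "(1 + norm u) ^ q * norm (iter_deriv bs (gauss_tensor s ?a) u) \<le> X ^ (length bs + q)"
        "(1 + norm u) ^ q * norm (iter_deriv bs (gauss_tensor s ?b) u) \<le> X ^ (length bs + q)"
        using snoc.IH[OF bs] by blast+
    qed
    have "iter_deriv (bs @ [b]) (gauss_tensor s \<alpha>) u =
        of_real ?x * iter_deriv bs (gauss_tensor s ?a) u + of_real ?y * iter_deriv bs (gauss_tensor s ?b) u"
      by (simp only: iter_deriv_append iter_deriv_Cons iter_deriv_Nil partial_deriv_gauss_tensor[OF b]
          iter_deriv_lincomb[OF smooth_gauss_tensor smooth_gauss_tensor bs])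
    then have "norm (iter_deriv (bs @ [b]) (gauss_tensor s \<alpha>) u) \<le>
        \<bar>?x\<bar> * norm (iter_deriv bs (gauss_tensor s ?a) u) + \<bar>?y\<bar> * norm (iter_deriv bs (gauss_tensor s ?b) u)"
      using norm_triangle_ineq[of "of_real ?x * iter_deriv bs (gauss_tensor s ?a) u" "of_real ?y * iter_deriv bs (gauss_tensor s ?b) u"]
      by (simp only: norm_mult norm_of_real)
    then have "(1 + norm u) ^ q * norm (iter_deriv (bs @ [b]) (gauss_tensor s \<alpha>) u) \<le> (1 + norm u) ^ q *
        (\<bar>?x\<bar> * norm (iter_deriv bs (gauss_tensor s ?a) u) + \<bar>?y\<bar> * norm (iter_deriv bs (gauss_tensor s ?b) u))"
      by (intro mult_left_mono) auto
    also have "\<dots> = \<bar>?x\<bar> * ((1 + norm u) ^ q * norm (iter_deriv bs (gauss_tensor s ?a) u)) +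
        \<bar>?y\<bar> * ((1 + norm u) ^ q * norm (iter_deriv bs (gauss_tensor s ?b) u))"
      by (simp only: distrib_left mult.left_commute)
    also have "\<dots> \<le> 2 * (real N + 1) / s * X ^ (length bs + q) + 2 * (real N + 1) / s * X ^ (length bs + q)"
      by (intro add_mono mult_mono ab IHa IHb) (use s in auto)
    also have "\<dots> = 4 * (real N + 1) / s * X ^ (length bs + q)" by (simp add: algebra_simps)
    also have "\<dots> \<le> X * X ^ (length bs + q)"
      using s X0 unfolding X_def by (intro mult_right_mono divide_right_mono) auto
    finally show ?case by simp
  qed
  then show ?thesis using assms(3,4) unfolding X_def by blast
qed

lemma mu_gauss_tensor_le:
  fixes \<alpha> :: "'a::euclidean_space \<Rightarrow> nat"
  assumes s: "0 < s" "s \<le> 1" and "\<And>b. b \<in> Basis \<Longrightarrow> \<alpha> b \<le> K"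
  shows "mu (int q) (real l) (gauss_tensor s \<alpha>) \<le>
    ennreal ((4 * (real DIM('a) + 1) * (real (K + l + q) + 1) / s) ^ (l + q))"
proof (subst mu_pos_le_ennreal_iff[OF smooth_gauss_tensor])
  let ?X = "4 * (real DIM('a) + 1) * (real (K + l + q) + 1) / s"
  show "0 \<le> ?X ^ (l + q)" using s by simp
  have "1 * 1 \<le> 4 * (real DIM('a) + 1) * (real (K + l + q) + 1)" by (intro mult_mono) auto
  then have X: "1 \<le> ?X" using s by (simp add: le_divide_eq)
  show "\<forall>bs x. set bs \<subseteq> Basis \<longrightarrow> length bs \<le> l \<longrightarrow>
     (1 + norm x) ^ q * norm (iter_deriv bs (gauss_tensor s \<alpha>) x) \<le> ?X ^ (l + q)"
  proof (intro allI impI)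
    fix bs and x :: 'a assume bs: "set bs \<subseteq> (Basis :: 'a set)" "length bs \<le> l"
    have "(1 + norm x) ^ q * norm (iter_deriv bs (gauss_tensor s \<alpha>) x) \<le> ?X ^ (length bs + q)"
      using assms(3) bs by (intro iter_deriv_gauss_tensor_bound s) (force intro: add_mono)+
    also have "\<dots> \<le> ?X ^ (l + q)" using bs X by (intro power_increasing) auto
    finally show "(1 + norm x) ^ q * norm (iter_deriv bs (gauss_tensor s \<alpha>) x) \<le> ?X ^ (l + q)" .
  qed
qed

lemma gauss_tensor_schwartz:
  fixes \<alpha> :: "'a::euclidean_space \<Rightarrow> nat"
  assumes "0 < s" "s \<le> 1"
  shows "gauss_tensor s \<alpha> \<in> schwartz"
proof -
  have "\<alpha> b \<le> (\<Sum>b\<in>Basis. \<alpha> b)" if "b \<in> Basis" for b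
    using that by (simp add: member_le_sum)
  then have "mu (int q) (real l) (gauss_tensor s \<alpha>) < top" for q l
    by (intro order_le_less_trans[OF mu_gauss_tensor_le[OF assms] ennreal_less_top])
  then show ?thesis unfolding schwartz_def infinity_ennreal_def by (simp add: smooth_gauss_tensor)
qed

section \<open>Interpolation of seminorms\<close>

text \<open>A Landau-Kolmogorov inequality with free step \<open>t\<close>: a derivative is a
  difference quotient up to a second-order remainder. The two values of the quotient give 2 A / t,
  the remainder gives t B, and 2^q compares the weights at points of distance at most 1.\<close>

lemma mu_interpolation:
  fixes g :: "'a::euclidean_space \<Rightarrow> complex"
  assumes g: "smooth g" and A: "0 \<le> A" "mu (int q) (real l) g \<le> ennreal A"
    and B: "0 \<le> B" "mu (int q) (real (l + 2)) g \<le> ennreal B" and t: "0 < t" "t \<le> 1"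
  shows "mu (int q) (real (l + 1)) g \<le> ennreal (2 ^ q * (2 * A / t + t * B))"
proof (subst mu_pos_le_ennreal_iff[OF g])
  show "0 \<le> 2 ^ q * (2 * A / t + t * B)" using assms by simp
  have gA: "(1 + norm x) ^ q * norm (iter_deriv bs g x) \<le> A" if "set bs \<subseteq> Basis" "length bs \<le> l" for bs x
    using A(2) that unfolding mu_pos_le_ennreal_iff[OF g A(1)] by blast
  have gB: "(1 + norm x) ^ q * norm (iter_deriv bs g x) \<le> B" if "set bs \<subseteq> Basis" "length bs \<le> l + 2" for bs x
    using B(2) that unfolding mu_pos_le_ennreal_iff[OF g B(1)] by blast
  have w: "(1 + norm x) ^ q \<le> 2 ^ q * (1 + norm y) ^ q" if "dist x y \<le> 1" for x y :: 'a
  proof -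
    have "norm x \<le> norm y + 1" using that norm_triangle_sub[of x y] by (simp add: dist_norm)
    then have "1 + norm x \<le> 2 * (1 + norm y)" using norm_ge_zero[of y] unfolding distrib_left by linarith
    then have "(1 + norm x) ^ q \<le> (2 * (1 + norm y)) ^ q" by (intro power_mono) auto
    then show ?thesis by (simp only: power_mult_distrib)
  qed
  show "\<forall>bs x. set bs \<subseteq> Basis \<longrightarrow> length bs \<le> l + 1 \<longrightarrow>
     (1 + norm x) ^ q * norm (iter_deriv bs g x) \<le> 2 ^ q * (2 * A / t + t * B)"
  proof (intro allI impI)
    fix bs and x :: 'a assume bs: "set bs \<subseteq> (Basis :: 'a set)" "length bs \<le> l + 1"
    show "(1 + norm x) ^ q * norm (iter_deriv bs g x) \<le> 2 ^ q * (2 * A / t + t * B)"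
    proof (cases "length bs \<le> l")
      case True
      have "(1 + norm x) ^ q * norm (iter_deriv bs g x) \<le> 1 * A" using gA[OF bs(1) True] by simp
      also have "\<dots> \<le> 2 ^ q * (2 * A / t + t * B)"
      proof (rule mult_mono)
        have "A * t \<le> 2 * A" using A t mult_left_le[of t A] by linarith
        then have "A \<le> 2 * A / t" using t by (simp add: le_divide_eq)
        moreover have "0 \<le> t * B" using t B by simp
        ultimately show "A \<le> 2 * A / t + t * B" by linarith
      qed (use A in auto)
      finally show ?thesis .
    next
      case False
      then obtain b cs where bcs: "bs = b # cs" using bs by (cases bs) auto
      then have b: "b \<in> Basis" and cs: "set cs \<subseteq> Basis" "length cs = l" using bs False by auto
      define f where "f = iter_deriv cs g"
      have f: "smooth f" unfolding f_def using g cs by (simp add: smooth_iter_deriv)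
      define W where "W = (1 + norm x) ^ q"
      have W: "1 \<le> W" unfolding W_def by (rule one_le_power) simp
      have fB: "norm (partial_deriv d (partial_deriv c f) (x + r *\<^sub>R (t *\<^sub>R b))) \<le> 2 ^ q * B / W"
        if "c \<in> Basis" "d \<in> Basis" "r \<in> {0..1}" for c d r
      proof -
        let ?y = "x + r *\<^sub>R (t *\<^sub>R b)"
        have "dist x ?y \<le> 1" using that(3) t b by (simp add: dist_norm mult_le_one)
        then have "W * norm (partial_deriv d (partial_deriv c f) ?y) \<le>
           2 ^ q * ((1 + norm ?y) ^ q * norm (partial_deriv d (partial_deriv c f) ?y))"
          unfolding W_def mult.assoc[symmetric] by (intro mult_right_mono w) auto
        also have "\<dots> \<le> 2 ^ q * B"
          using gB[of "[d, c] @ cs" ?y] that cs by (intro mult_left_mono) (auto simp: f_def iter_deriv_Cons)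
        finally show ?thesis using W by (simp add: le_divide_eq mult.commute)
      qed
      have "norm (f (x + t *\<^sub>R b) - f x - (\<Sum>c\<in>Basis. ((t *\<^sub>R b) \<bullet> c) *\<^sub>R partial_deriv c f x))
          \<le> (\<Sum>c\<in>Basis. \<bar>(t *\<^sub>R b) \<bullet> c\<bar>)\<^sup>2 * (2 ^ q * B / W)"
        by (rule smooth_second_order_bound[OF f fB])
      moreover have "(\<Sum>c\<in>Basis. ((t *\<^sub>R b) \<bullet> c) *\<^sub>R partial_deriv c f x) = t *\<^sub>R partial_deriv b f x"
      proof -
        have "(\<Sum>c\<in>Basis. ((t *\<^sub>R b) \<bullet> c) *\<^sub>R partial_deriv c f x) = (\<Sum>c\<in>Basis. if c = b then t *\<^sub>R partial_deriv c f x else 0)"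
          using b by (intro sum.cong) (auto simp: inner_Basis)
        then show ?thesis using b by simp
      qed
      moreover have "(\<Sum>c\<in>Basis. \<bar>(t *\<^sub>R b) \<bullet> c\<bar>) = t"
      proof -
        have "(\<Sum>c\<in>Basis. \<bar>(t *\<^sub>R b) \<bullet> c\<bar>) = (\<Sum>c\<in>Basis. if c = b then t else 0)"
          using b t by (intro sum.cong) (auto simp: inner_Basis)
        then show ?thesis using b by simp
      qed
      ultimately have R: "norm (f (x + t *\<^sub>R b) - f x - t *\<^sub>R partial_deriv b f x) \<le> t\<^sup>2 * (2 ^ q * B / W)" by simp
      have "t * norm (partial_deriv b f x) = norm (t *\<^sub>R partial_deriv b f x)" using t by simp
      also have "\<dots> = norm (f (x + t *\<^sub>R b) - f x - (f (x + t *\<^sub>R b) - f x - t *\<^sub>R partial_deriv b f x))" by simp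
      also have "\<dots> \<le> norm (f (x + t *\<^sub>R b)) + norm (f x) + t\<^sup>2 * (2 ^ q * B / W)"
        using R norm_triangle_ineq4[of "f (x + t *\<^sub>R b) - f x" "f (x + t *\<^sub>R b) - f x - t *\<^sub>R partial_deriv b f x"]
          norm_triangle_ineq4[of "f (x + t *\<^sub>R b)" "f x"] by linarith
      finally have "W * (t * norm (partial_deriv b f x)) \<le> W * (norm (f (x + t *\<^sub>R b)) + norm (f x) + t\<^sup>2 * (2 ^ q * B / W))"
        using W by (intro mult_left_mono) auto
      also have "\<dots> = W * norm (f (x + t *\<^sub>R b)) + W * norm (f x) + t\<^sup>2 * 2 ^ q * B"
        using W by (simp add: field_simps)
      also have "\<dots> \<le> 2 ^ q * A + 2 ^ q * A + t\<^sup>2 * 2 ^ q * B"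
      proof (intro add_mono order_refl)
        have "W * norm (f (x + t *\<^sub>R b)) \<le> 2 ^ q * ((1 + norm (x + t *\<^sub>R b)) ^ q * norm (f (x + t *\<^sub>R b)))"
          unfolding W_def mult.assoc[symmetric] using t b by (intro mult_right_mono w) (auto simp: dist_norm)
        also have "\<dots> \<le> 2 ^ q * A" unfolding f_def using cs by (intro mult_left_mono gA) auto
        finally show "W * norm (f (x + t *\<^sub>R b)) \<le> 2 ^ q * A" .
        have "W * norm (f x) \<le> 1 * A" unfolding f_def W_def using gA[of cs x] cs by simp
        also have "\<dots> \<le> 2 ^ q * A" using A by (intro mult_right_mono) auto
        finally show "W * norm (f x) \<le> 2 ^ q * A" .
      qed
      also have "\<dots> = t * (2 ^ q * (2 * A / t + t * B))"
        using t by (simp add: field_simps power2_eq_square)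
      finally have "t * (W * norm (partial_deriv b f x)) \<le> t * (2 ^ q * (2 * A / t + t * B))" by (simp add: mult_ac)
      then show ?thesis using t unfolding bcs iter_deriv_Cons f_def W_def by simp
    qed
  qed
qed

section \<open>Finite differences\<close>

text \<open>(I - E)^m for the unit shift E. This sign convention gives the undisplaced value
  \<open>g t\<close> the coefficient 1.\<close>

definition fin_diff :: "nat \<Rightarrow> (real \<Rightarrow> complex) \<Rightarrow> real \<Rightarrow> complex" where
  "fin_diff m g t = (\<Sum>j\<le>m. (-1) ^ j * of_nat (m choose j) * g (t + real j))"

lemma fin_diff_0: "fin_diff 0 g t = g t"
  by (simp add: fin_diff_def)

lemma fin_diff_Suc: "fin_diff (Suc m) g t = fin_diff m g t - fin_diff m g (t + 1)"
proof -
  have "fin_diff (Suc m) g t = g t +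
      (\<Sum>j\<le>m. (-1) ^ Suc j * of_nat (Suc m choose Suc j) * g (t + real (Suc j)))"
    unfolding fin_diff_def by (subst sum.atMost_Suc_shift) simp
  also have "(\<Sum>j\<le>m. (-1) ^ Suc j * of_nat (Suc m choose Suc j) * g (t + real (Suc j))) =
      (\<Sum>j\<le>m. (-1) ^ Suc j * of_nat (m choose Suc j) * g (t + real (Suc j))) - fin_diff m g (t + 1)"
    unfolding fin_diff_def sum_subtractf[symmetric]
    by (rule sum.cong) (simp_all add: algebra_simps)
  also have "g t + ((\<Sum>j\<le>m. (-1) ^ Suc j * of_nat (m choose Suc j) * g (t + real (Suc j))) - fin_diff m g (t + 1)) =
      (\<Sum>j\<le>Suc m. (-1) ^ j * of_nat (m choose j) * g (t + real j)) - fin_diff m g (t + 1)"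
    by (subst sum.atMost_Suc_shift) simp
  also have "(\<Sum>j\<le>Suc m. (-1) ^ j * of_nat (m choose j) * g (t + real j)) = fin_diff m g t"
    unfolding fin_diff_def by simp
  finally show ?thesis .
qed

text \<open>Differences commute with derivatives, so the mean value inequality turns the outermost
  difference into a directional derivative, and the induction hypothesis applies to each
  \<open>partial_deriv b f\<close>. The interval up to \<open>T\<close> contains all points at which
  derivatives are evaluated.\<close>

lemma fin_diff_bound:
  fixes f :: "'a::euclidean_space \<Rightarrow> complex"
  assumes "smooth f" and "\<And>bs t. set bs \<subseteq> Basis \<Longrightarrow> length bs = r \<Longrightarrow> t \<in> {0..T} \<Longrightarrow>
      norm (iter_deriv bs f (u + t *\<^sub>R w)) \<le> B"
    and "0 \<le> t" "t + real r \<le> T"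
  shows "norm (fin_diff r (\<lambda>t. f (u + t *\<^sub>R w)) t) \<le> (\<Sum>b\<in>Basis. \<bar>w \<bullet> b\<bar>) ^ r * B"
  using assms
proof (induction r arbitrary: f t)
  case 0
  then show ?case using "0.prems"(2)[of "[]" t] by (simp add: fin_diff_0)
next
  case (Suc r)
  define V where "V = (\<Sum>b\<in>Basis. \<bar>w \<bullet> b\<bar>)"
  let ?G = "fin_diff r (\<lambda>t. f (u + t *\<^sub>R w))"
  let ?g = "\<lambda>t. \<Sum>b\<in>Basis. (w \<bullet> b) *\<^sub>R partial_deriv b f (u + t *\<^sub>R w)"
  have "norm (?G (t + 1) - ?G t) \<le> V * (V ^ r * B) * (t + 1 - t)"
  proof (rule vector_mvt_bound)
    fix x assume x: "x \<in> {t..t + 1}"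
    have shift: "((\<lambda>x. f (u + (x + real j) *\<^sub>R w)) has_vector_derivative ?g (x + real j)) (at x)" for j
      using smooth_line_derivative[OF Suc.prems(1), of "u + real j *\<^sub>R w" w x] by (simp add: algebra_simps)
    have "(?G has_vector_derivative (\<Sum>j\<le>r. (-1) ^ j * of_nat (r choose j) * ?g (x + real j))) (at x)"
      unfolding fin_diff_def[abs_def]
      by (intro has_vector_derivative_sum has_vector_derivative_mult_right shift)
    moreover have "(\<Sum>j\<le>r. (-1) ^ j * of_nat (r choose j) * ?g (x + real j)) =
        (\<Sum>b\<in>Basis. (w \<bullet> b) *\<^sub>R fin_diff r (\<lambda>t. partial_deriv b f (u + t *\<^sub>R w)) x)"
      unfolding fin_diff_def scaleR_sum_right sum_distrib_left
      by (subst sum.swap) (simp add: mult_scaleR_right)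
    ultimately show "(?G has_vector_derivative
        (\<Sum>b\<in>Basis. (w \<bullet> b) *\<^sub>R fin_diff r (\<lambda>t. partial_deriv b f (u + t *\<^sub>R w)) x)) (at x)" by simp
    have "norm (\<Sum>b\<in>Basis. (w \<bullet> b) *\<^sub>R fin_diff r (\<lambda>t. partial_deriv b f (u + t *\<^sub>R w)) x) \<le>
        (\<Sum>b\<in>Basis. \<bar>w \<bullet> b\<bar> * (V ^ r * B))"
    proof (rule sum_norm_le)
      fix b :: 'a assume b: "b \<in> Basis"
      have "norm (fin_diff r (\<lambda>t. partial_deriv b f (u + t *\<^sub>R w)) x) \<le> V ^ r * B"
        unfolding V_def
      proof (rule Suc.IH)
        show "smooth (partial_deriv b f)" using Suc.prems(1) b by (rule smooth_partial_deriv)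
        fix bs :: "'a list" and t assume "set bs \<subseteq> Basis" "length bs = r" "t \<in> {0..T}"
        then show "norm (iter_deriv bs (partial_deriv b f) (u + t *\<^sub>R w)) \<le> B"
          using Suc.prems(2)[of "bs @ [b]" t] b by (simp add: iter_deriv_append iter_deriv_Cons)
      qed (use x Suc.prems in auto)
      then show "norm ((w \<bullet> b) *\<^sub>R fin_diff r (\<lambda>t. partial_deriv b f (u + t *\<^sub>R w)) x) \<le> \<bar>w \<bullet> b\<bar> * (V ^ r * B)"
        by (simp add: mult_left_mono)
    qed
    then show "norm (\<Sum>b\<in>Basis. (w \<bullet> b) *\<^sub>R fin_diff r (\<lambda>t. partial_deriv b f (u + t *\<^sub>R w)) x) \<le> V * (V ^ r * B)"
      by (simp add: V_def sum_distrib_right)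
  qed simp
  then show ?case by (simp add: fin_diff_Suc V_def norm_minus_commute mult.assoc)
qed

text \<open>The \<open>m - r\<close> further differences are estimated by the triangle inequality,
  each doubling the bound. Thus \<open>m\<close> may tend to infinity while only derivatives of the
  fixed order \<open>r\<close> are used.\<close>

lemma fin_diff_bound_ge:
  fixes f :: "'a::euclidean_space \<Rightarrow> complex"
  assumes "smooth f" and "r \<le> m" and "\<And>bs t. set bs \<subseteq> Basis \<Longrightarrow> length bs = r \<Longrightarrow> t \<in> {0..T} \<Longrightarrow>
      norm (iter_deriv bs f (u + t *\<^sub>R w)) \<le> B"
    and "0 \<le> t" "t + real m \<le> T"
  shows "norm (fin_diff m (\<lambda>t. f (u + t *\<^sub>R w)) t) \<le> 2 ^ m * ((\<Sum>b\<in>Basis. \<bar>w \<bullet> b\<bar>) ^ r * B)"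
proof -
  define R where "R = (\<Sum>b\<in>Basis. \<bar>w \<bullet> b\<bar>) ^ r * B"
  have "norm (fin_diff (r + k) (\<lambda>t. f (u + t *\<^sub>R w)) t) \<le> 2 ^ k * R"
    if "0 \<le> t" "t + real (r + k) \<le> T" for k t
    using that
  proof (induction k arbitrary: t)
    case 0
    then show ?case using fin_diff_bound[of f r T u w B t] assms(1,3) by (simp add: R_def)
  next
    case (Suc k)
    have "norm (fin_diff (r + Suc k) (\<lambda>t. f (u + t *\<^sub>R w)) t) \<le>
        norm (fin_diff (r + k) (\<lambda>t. f (u + t *\<^sub>R w)) t) + norm (fin_diff (r + k) (\<lambda>t. f (u + t *\<^sub>R w)) (t + 1))"
      by (simp add: fin_diff_Suc norm_triangle_ineq4)
    also have "\<dots> \<le> 2 ^ k * R + 2 ^ k * R"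
      using Suc.prems by (intro add_mono Suc.IH) auto
    finally show ?case by (simp add: mult_ac)
  qed
  from this[of t "m - r"] have *: "norm (fin_diff m (\<lambda>t. f (u + t *\<^sub>R w)) t) \<le> 2 ^ (m - r) * R"
    using assms by simp
  \<comment> \<open>The sign of \<open>R\<close>, needed to enlarge \<open>2 ^ (m - r)\<close> to
    \<open>2 ^ m\<close>, follows from the estimate just obtained, as it bounds a norm.\<close>
  have "0 \<le> (2::real) ^ (m - r) * R" using * norm_ge_zero order_trans by blast
  then have "0 \<le> R" using mult_pos_neg[of "2 ^ (m - r)" R] by (cases "R < 0") auto
  then have "2 ^ (m - r) * R \<le> 2 ^ m * R" by (intro mult_right_mono power_increasing) auto
  with * show ?thesis unfolding R_def by linarith
qed

section \<open>Gaussian regularization\<close>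

text \<open>The power is \<open>fact k\<close> times one term of the series of exp (1 + x), and the
  exponent 1 + x - x^2 is bounded.\<close>

lemma gauss_weight_bound:
  assumes "0 \<le> (x::real)"
  shows "(1 + x) ^ k * exp (- x\<^sup>2) \<le> fact k * exp 2"
proof -
  have "(1 + x) ^ k \<le> fact k * exp (1 + x)"
    using power_div_fact_le_exp[of "1 + x" k] assms by (simp add: field_simps)
  then have "(1 + x) ^ k * exp (- x\<^sup>2) \<le> fact k * exp (1 + x) * exp (- x\<^sup>2)" by (intro mult_right_mono) auto
  also have "\<dots> = fact k * exp (1 + x - x\<^sup>2)" by (simp add: exp_add[symmetric] mult.assoc)
  also have "\<dots> \<le> fact k * exp 2"
  proof -
    have "0 \<le> (x - 1 / 2)\<^sup>2" by simp
    then have "1 + x - x\<^sup>2 \<le> 2" by (simp add: power2_eq_square algebra_simps)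
    then show ?thesis by simp
  qed
  finally show ?thesis .
qed

lemma gauss_integral_bound:
  fixes g :: "'a::euclidean_space \<Rightarrow> 'b::{banach, second_countable_topology}"
  assumes "g \<in> borel_measurable borel" "\<And>v. norm (g v) \<le> M * (1 + norm v) ^ k * exp (- (norm v)\<^sup>2)" "0 \<le> M"
  shows "integrable lborel g"
    and "norm (\<integral>v. g v \<partial>lborel) \<le> M * (fact (DIM('a) + 2 + k) * exp 2) * weight_integral TYPE('a)"
proof -
  have "(1 + norm v) ^ (DIM('a) + 2) * norm (g v) \<le> M * (fact (DIM('a) + 2 + k) * exp 2)" for v
  proof -
    have "(1 + norm v) ^ (DIM('a) + 2) * norm (g v) \<le>
        (1 + norm v) ^ (DIM('a) + 2) * (M * (1 + norm v) ^ k * exp (- (norm v)\<^sup>2))"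
      by (intro mult_left_mono assms) auto
    also have "\<dots> = M * ((1 + norm v) ^ (DIM('a) + 2 + k) * exp (- (norm v)\<^sup>2))"
      by (simp add: power_add mult_ac)
    also have "\<dots> \<le> M * (fact (DIM('a) + 2 + k) * exp 2)"
      by (intro mult_left_mono gauss_weight_bound assms) auto
    finally show ?thesis .
  qed
  from weight_bound_integral[OF assms(1) this]
  show "integrable lborel g"
    "norm (\<integral>v. g v \<partial>lborel) \<le> M * (fact (DIM('a) + 2 + k) * exp 2) * weight_integral TYPE('a)"
    by auto
qed

definition gauss_mass :: "'a::euclidean_space itself \<Rightarrow> real" where
  "gauss_mass _ = (\<integral>v. exp (- (norm (v::'a))\<^sup>2) \<partial>lborel)"

lemma gauss_integrable: "integrable lborel (\<lambda>v::'a::euclidean_space. exp (- (norm v)\<^sup>2))"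
  by (rule gauss_integral_bound(1)[where M = 1 and k = 0]) auto

lemma gauss_mass_pos: "0 < gauss_mass TYPE('a::euclidean_space)"
proof -
  have "gauss_mass TYPE('a) \<noteq> 0"
  proof
    assume "gauss_mass TYPE('a) = 0"
    then have "AE v::'a in lborel. exp (- (norm v)\<^sup>2) = 0"
      unfolding gauss_mass_def by (subst (asm) integral_nonneg_eq_0_iff_AE[OF gauss_integrable]) auto
    then have "AE v::'a in lborel. False" by simp
    then obtain N where "N \<in> null_sets (lborel :: 'a measure)" "UNIV \<subseteq> N"
      by (auto simp: eventually_ae_filter)
    then have "emeasure (lborel :: 'a measure) UNIV = 0" by (auto simp: top.extremum_unique)
    then show False by simp
  qed
  moreover have "0 \<le> gauss_mass TYPE('a)" unfolding gauss_mass_def by (rule integral_nonneg_AE) auto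
  ultimately show ?thesis by simp
qed

text \<open>Convolution with the Gaussian of width \<open>s\<close>, written as a mean of
  translates: in this form \<open>f\<close> itself is the case of width 0, and the means for the
  widths j \<sigma> sample one line, as a finite difference requires.\<close>

definition gauss_smooth :: "real \<Rightarrow> ('a::euclidean_space \<Rightarrow> complex) \<Rightarrow> 'a \<Rightarrow> complex" where
  "gauss_smooth s f u = (\<integral>v. exp (- (norm v)\<^sup>2) *\<^sub>R f (u - s *\<^sub>R v) \<partial>lborel) /\<^sub>R gauss_mass TYPE('a)"

lemma gauss_smooth_integrable:
  assumes "smooth f" "\<And>x. norm (f x) \<le> B"
  shows "integrable lborel (\<lambda>v. exp (- (norm v)\<^sup>2) *\<^sub>R f (u - s *\<^sub>R v))"
proof (rule gauss_integral_bound(1)[where M = B and k = 0])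
  show "(\<lambda>v. exp (- (norm v)\<^sup>2) *\<^sub>R f (u - s *\<^sub>R v)) \<in> borel_measurable borel"
    by (intro borel_measurable_continuous_onI continuous_on_scaleR smooth_continuous_compose[OF assms(1)] continuous_intros)
  show "0 \<le> B" using assms(2)[of 0] norm_ge_zero order_trans by blast
  show "norm (exp (- (norm v)\<^sup>2) *\<^sub>R f (u - s *\<^sub>R v)) \<le> B * (1 + norm v) ^ 0 * exp (- (norm v)\<^sup>2)" for v
    using assms(2) by (simp add: mult.commute mult_left_mono)
qed

lemma lborel_integral_affine:
  fixes g :: "'a::euclidean_space \<Rightarrow> 'b::{banach, second_countable_topology}"
  assumes "c \<noteq> 0" and [measurable]: "g \<in> borel_measurable borel"
  shows "(\<integral>x. g x \<partial>lborel) = \<bar>c\<bar> ^ DIM('a) *\<^sub>R (\<integral>x. g (t + c *\<^sub>R x) \<partial>lborel)"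
proof -
  have "(\<integral>x. g x \<partial>lborel) = (\<integral>x. g x \<partial>density (distr lborel borel (\<lambda>x. t + c *\<^sub>R x)) (\<lambda>_. ennreal (\<bar>c\<bar> ^ DIM('a))))"
    using lborel_affine[OF assms(1), of t] by (simp add: ennreal_power[symmetric])
  also have "\<dots> = (\<integral>x. \<bar>c\<bar> ^ DIM('a) *\<^sub>R g x \<partial>distr lborel borel (\<lambda>x. t + c *\<^sub>R x))"
    by (rule integral_density) auto
  also have "\<dots> = (\<integral>x. \<bar>c\<bar> ^ DIM('a) *\<^sub>R g (t + c *\<^sub>R x) \<partial>lborel)"
    by (rule integral_distr) auto
  finally show ?thesis by simp
qed

lemma gauss_smooth_convolution:
  fixes f :: "'a::euclidean_space \<Rightarrow> complex"
  assumes "0 < s" "smooth f"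
  shows "gauss_smooth s f u =
    (\<integral>y. exp (- (norm ((u - y) /\<^sub>R s))\<^sup>2) *\<^sub>R f y \<partial>lborel) /\<^sub>R (gauss_mass TYPE('a) * s ^ DIM('a))"
proof -
  have "(\<integral>y. exp (- (norm ((u - y) /\<^sub>R s))\<^sup>2) *\<^sub>R f y \<partial>lborel) =
      \<bar>- s\<bar> ^ DIM('a) *\<^sub>R (\<integral>v. exp (- (norm ((u - (u + (- s) *\<^sub>R v)) /\<^sub>R s))\<^sup>2) *\<^sub>R f (u + (- s) *\<^sub>R v) \<partial>lborel)"
    using assms
    by (intro lborel_integral_affine[where g = "\<lambda>y. exp (- (norm ((u - y) /\<^sub>R s))\<^sup>2) *\<^sub>R f y" and c = "- s" and t = u]
        borel_measurable_continuous_onI continuous_on_scaleR smooth_continuous_on)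
      (auto intro!: continuous_intros)
  also have "\<dots> = s ^ DIM('a) *\<^sub>R (\<integral>v. exp (- (norm v)\<^sup>2) *\<^sub>R f (u - s *\<^sub>R v) \<partial>lborel)"
    using assms(1) by simp
  finally show ?thesis using assms(1) by (simp add: gauss_smooth_def)
qed

lemma sum_abs_inner_le: "(\<Sum>b\<in>Basis. \<bar>(w::'a::euclidean_space) \<bullet> b\<bar>) \<le> real DIM('a) * norm w"
  using sum_bounded_above[of Basis "\<lambda>b. \<bar>w \<bullet> b\<bar>" "norm w"] by (simp add: Basis_le_norm)

text \<open>The combination of dilated Gaussian means with binomial weights is the mean of an \<open>m\<close>-th
  finite difference, so it reproduces \<open>f\<close> up to derivatives of order \<open>r \<le> m\<close>.\<close>

lemma gauss_smooth_richardson: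
  fixes f :: "'a::euclidean_space \<Rightarrow> complex"
  assumes f: "f \<in> schwartz" and s: "0 < \<sigma>" "real m * \<sigma> \<le> 1" and r: "r \<le> m"
    and F: "0 \<le> F" "mu (int q) (real r) f \<le> ennreal F"
  shows "(1 + norm u) ^ q * norm (f u - (\<Sum>j=1..m. (-1) ^ Suc j * of_nat (m choose j) * gauss_smooth (real j * \<sigma>) f u))
    \<le> 2 ^ m * \<sigma> ^ r * F * (real DIM('a) ^ r * (fact (DIM('a) + 2 + (r + q)) * exp 2) *
        weight_integral TYPE('a) / gauss_mass TYPE('a))"
proof -
  let ?Z = "gauss_mass TYPE('a)"
  note fs = schwartz_smooth[OF f]
  obtain B where B: "\<And>x. norm (f x) \<le> B"
    using schwartz_decay[OF f, of 0] by auto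
  let ?g = "\<lambda>v t. f (u + t *\<^sub>R (- \<sigma> *\<^sub>R v))"
  have gi: "integrable lborel (\<lambda>v. exp (- (norm v)\<^sup>2) *\<^sub>R f (u - s *\<^sub>R v))" for s
    by (rule gauss_smooth_integrable[OF fs B])
  have sp: "gauss_smooth (real j * \<sigma>) f u = (\<integral>v. exp (- (norm v)\<^sup>2) *\<^sub>R ?g v (real j) \<partial>lborel) /\<^sub>R ?Z" for j
    by (simp add: gauss_smooth_def mult.commute)
  \<comment> \<open>The term \<open>j = 0\<close> of the difference: without displacement the mean
    of the constant \<open>f u\<close> is \<open>f u\<close>.\<close>
  have f0: "f u = (\<integral>v. exp (- (norm v)\<^sup>2) *\<^sub>R ?g v (real 0) \<partial>lborel) /\<^sub>R ?Z"
    using gauss_mass_pos[where 'a = 'a] integral_scaleR_left[of "f u" lborel "\<lambda>v::'a. exp (- (norm v)\<^sup>2)"]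
    by (simp add: gauss_mass_def gauss_integrable)
  have "f u - (\<Sum>j=1..m. (-1) ^ Suc j * of_nat (m choose j) * gauss_smooth (real j * \<sigma>) f u) =
      (\<Sum>j\<le>m. (-1) ^ j * of_nat (m choose j) * ((\<integral>v. exp (- (norm v)\<^sup>2) *\<^sub>R ?g v (real j) \<partial>lborel) /\<^sub>R ?Z))"
  proof -
    have "{..m} = insert 0 {1..m}" by auto
    then show ?thesis unfolding sp by (simp add: f0[symmetric, simplified] sum_negf)
  qed
  also have "\<dots> = (\<integral>v. exp (- (norm v)\<^sup>2) *\<^sub>R fin_diff m (?g v) 0 \<partial>lborel) /\<^sub>R ?Z"
  proof -
    have "(\<integral>v. exp (- (norm v)\<^sup>2) *\<^sub>R fin_diff m (?g v) 0 \<partial>lborel) =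
       (\<integral>v. (\<Sum>j\<le>m. (-1) ^ j * of_nat (m choose j) * (exp (- (norm v)\<^sup>2) *\<^sub>R ?g v (real j))) \<partial>lborel)"
      by (rule Bochner_Integration.integral_cong)
        (auto simp: fin_diff_def scaleR_sum_right mult_scaleR_right)
    also have "\<dots> = (\<Sum>j\<le>m. (-1) ^ j * of_nat (m choose j) * (\<integral>v. exp (- (norm v)\<^sup>2) *\<^sub>R ?g v (real j) \<partial>lborel))"
    proof -
      have gi': "integrable lborel (\<lambda>v. exp (- (norm v)\<^sup>2) *\<^sub>R ?g v (real j))" for j
        using gi[of "real j * \<sigma>"] by simp
      show ?thesis
        by (subst Bochner_Integration.integral_sum)
          (rule integrable_mult_right, rule gi', simp only: integral_mult_right_zero)
    qed
    finally show ?thesis by (simp add: scaleR_sum_right)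
  qed
  finally have eq: "f u - (\<Sum>j=1..m. (-1) ^ Suc j * of_nat (m choose j) * gauss_smooth (real j * \<sigma>) f u) =
      (\<integral>v. exp (- (norm v)\<^sup>2) *\<^sub>R fin_diff m (?g v) 0 \<partial>lborel) /\<^sub>R ?Z" .
  define M where "M = 2 ^ m * ((\<sigma> * real DIM('a)) ^ r * (F / (1 + norm u) ^ q))"
  have M: "0 \<le> M" unfolding M_def using s F by simp
  have "norm (fin_diff m (?g v) 0) \<le> M * (1 + norm v) ^ (r + q)" for v
  proof -
    have "norm (fin_diff m (?g v) 0) \<le> 2 ^ m * ((\<Sum>b\<in>Basis. \<bar>(- \<sigma> *\<^sub>R v) \<bullet> b\<bar>) ^ r * (F * (1 + norm v) ^ q / (1 + norm u) ^ q))"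
    proof (rule fin_diff_bound_ge[OF fs r, where T = "real m"])
      fix bs and t :: real assume bs: "set bs \<subseteq> (Basis :: 'a set)" "length bs = r" and t: "t \<in> {0..real m}"
      let ?x = "u + t *\<^sub>R (- \<sigma> *\<^sub>R v)"
      \<comment> \<open>The assumption on \<open>real m * \<sigma>\<close> keeps every displacement
        within \<open>norm v\<close>, so that exchanging the weight at \<open>u\<close> for that at
        the displaced point costs only powers of \<open>1 + norm v\<close>, which the Gaussian
        absorbs.\<close>
      have ts: "t * \<sigma> \<le> 1" using t s by (intro order_trans[OF mult_right_mono s(2)]) auto
      have "(1 + norm u) ^ q \<le> ((1 + norm ?x) * (1 + norm v)) ^ q"
      proof (rule power_mono)
        have "norm u \<le> norm ?x + norm (t *\<^sub>R (\<sigma> *\<^sub>R v))"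
          using norm_triangle_ineq[of ?x "t *\<^sub>R (\<sigma> *\<^sub>R v)"] by simp
        also have "norm (t *\<^sub>R (\<sigma> *\<^sub>R v)) \<le> norm v"
          using t s ts mult_right_mono[of "t * \<sigma>" 1 "norm v"] by (simp add: mult.assoc)
        finally have "norm u \<le> norm ?x + norm v" by simp
        moreover have "0 \<le> norm ?x * norm v" by simp
        ultimately show "1 + norm u \<le> (1 + norm ?x) * (1 + norm v)" unfolding distrib_left distrib_right by linarith
      qed simp
      then have "(1 + norm u) ^ q * norm (iter_deriv bs f ?x) \<le> ((1 + norm ?x) * (1 + norm v)) ^ q * norm (iter_deriv bs f ?x)"
        by (rule mult_right_mono) simp
      also have "\<dots> = (1 + norm v) ^ q * ((1 + norm ?x) ^ q * norm (iter_deriv bs f ?x))"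
        by (simp only: power_mult_distrib mult_ac)
      also have "\<dots> \<le> (1 + norm v) ^ q * F"
        using F(2) bs unfolding mu_pos_le_ennreal_iff[OF fs F(1)] by (intro mult_left_mono) auto
      finally show "norm (iter_deriv bs f ?x) \<le> F * (1 + norm v) ^ q / (1 + norm u) ^ q"
        by (simp add: le_divide_eq mult.commute add_pos_nonneg)
    qed auto
    also have "\<dots> \<le> 2 ^ m * ((\<sigma> * real DIM('a) * (1 + norm v)) ^ r * (F * (1 + norm v) ^ q / (1 + norm u) ^ q))"
    proof (intro mult_left_mono mult_right_mono power_mono)
      have "(\<Sum>b\<in>Basis. \<bar>(- \<sigma> *\<^sub>R v) \<bullet> b\<bar>) \<le> real DIM('a) * norm (- \<sigma> *\<^sub>R v)" by (rule sum_abs_inner_le)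
      also have "\<dots> = \<sigma> * real DIM('a) * norm v" using s by simp
      also have "\<dots> \<le> \<sigma> * real DIM('a) * (1 + norm v)" using s by (intro mult_left_mono) auto
      finally show "(\<Sum>b\<in>Basis. \<bar>(- \<sigma> *\<^sub>R v) \<bullet> b\<bar>) \<le> \<sigma> * real DIM('a) * (1 + norm v)" .
    qed (use F in \<open>auto intro: sum_nonneg\<close>)
    also have "\<dots> = M * (1 + norm v) ^ (r + q)" by (simp add: M_def power_add power_mult_distrib)
    finally show ?thesis .
  qed
  then have "norm (exp (- (norm v)\<^sup>2) *\<^sub>R fin_diff m (?g v) 0) \<le> M * (1 + norm v) ^ (r + q) * exp (- (norm v)\<^sup>2)" for v
    by (simp add: mult.commute mult_left_mono)
  moreover have "(\<lambda>v. exp (- (norm v)\<^sup>2) *\<^sub>R fin_diff m (?g v) 0) \<in> borel_measurable borel"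
    unfolding fin_diff_def
    by (intro borel_measurable_continuous_onI continuous_on_scaleR continuous_on_sum continuous_on_mult
        smooth_continuous_compose[OF fs] continuous_intros)
  ultimately have "norm (\<integral>v. exp (- (norm v)\<^sup>2) *\<^sub>R fin_diff m (?g v) 0 \<partial>lborel)
      \<le> M * (fact (DIM('a) + 2 + (r + q)) * exp 2) * weight_integral TYPE('a)"
    using gauss_integral_bound(2)[OF _ _ M] by blast
  then have "(1 + norm u) ^ q * norm (\<integral>v. exp (- (norm v)\<^sup>2) *\<^sub>R fin_diff m (?g v) 0 \<partial>lborel) / ?Z
      \<le> (1 + norm u) ^ q * (M * (fact (DIM('a) + 2 + (r + q)) * exp 2) * weight_integral TYPE('a)) / ?Z"
    using gauss_mass_pos[where 'a = 'a] by (intro divide_right_mono mult_left_mono) auto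
  also have "\<dots> = 2 ^ m * \<sigma> ^ r * F * (real DIM('a) ^ r * (fact (DIM('a) + 2 + (r + q)) * exp 2) *
        weight_integral TYPE('a) / ?Z)"
  proof -
    have "(1 + norm u) ^ q * M = 2 ^ m * \<sigma> ^ r * F * real DIM('a) ^ r"
    proof -
      have "1 + norm u \<noteq> 0" using norm_ge_zero[of u] by linarith
      then show ?thesis unfolding M_def by (simp add: power_mult_distrib)
    qed
    then show ?thesis by (simp add: mult.assoc[symmetric])
  qed
  finally show ?thesis unfolding eq using gauss_mass_pos[where 'a = 'a] by (simp add: divide_inverse mult_ac)
qed

section \<open>Finite-rank approximation of the Gaussian kernel\<close>

definition exp_tail :: "nat \<Rightarrow> real \<Rightarrow> real" where
  "exp_tail n a = exp a - (\<Sum>k<n. a ^ k / fact k)"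

lemma exp_tail_sums: "(\<lambda>i. a ^ (i + n) / fact (i + n)) sums exp_tail n a"
proof -
  have "(\<lambda>k. a ^ k / fact k) sums exp a"
    using exp_converges[of a] by (simp add: divide_inverse mult.commute)
  then show ?thesis unfolding exp_tail_def by (rule sums_split_initial_segment)
qed

lemma abs_exp_minus_partial_sum_le: "\<bar>exp z - (\<Sum>k<n. z ^ k / fact k)\<bar> \<le> exp_tail n \<bar>z\<bar>"
proof -
  note s = exp_tail_sums[of z n] and t = exp_tail_sums[of "\<bar>z\<bar>" n]
  have "\<bar>exp_tail n z\<bar> = \<bar>\<Sum>i. z ^ (i + n) / fact (i + n)\<bar>" using sums_unique[OF s] by simp
  also have "\<dots> \<le> (\<Sum>i. \<bar>z ^ (i + n) / fact (i + n)\<bar>)"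
    using sums_summable[OF t] by (intro summable_rabs) (simp add: power_abs)
  also have "\<dots> = exp_tail n \<bar>z\<bar>" using sums_unique[OF t] by (simp add: power_abs)
  finally show ?thesis by (simp add: exp_tail_def)
qed

text \<open>Termwise comparison of consecutive tails: starting one index later multiplies each term
  by \<open>a\<close> over its index, which is at most a / (n + 1). For fixed \<open>r\<close> this
  is algebraic decay in \<open>n\<close>, sufficient for a degree that is a power of
  1/\<epsilon>.\<close>

lemma exp_tail_le:
  assumes a: "0 \<le> a"
  shows "exp_tail (n + r) a \<le> (a / (real n + 1)) ^ r * exp a"
proof (induction r)
  case 0
  have "0 \<le> (\<Sum>k<n. a ^ k / fact k)" using a by (intro sum_nonneg) auto
  then show ?case by (simp add: exp_tail_def)
next
  case (Suc r)
  have "exp_tail (n + Suc r) a \<le> a / (real n + 1) * exp_tail (n + r) a"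
  proof (rule sums_le[OF _ exp_tail_sums sums_mult[OF exp_tail_sums]])
    fix i
    have "real n + 1 \<le> real (i + (n + Suc r))" by simp
    then have "a / real (i + (n + Suc r)) * (a ^ (i + (n + r)) / fact (i + (n + r))) \<le>
        a / (real n + 1) * (a ^ (i + (n + r)) / fact (i + (n + r)))"
      using a by (intro mult_right_mono divide_left_mono) auto
    moreover have "a ^ (i + (n + Suc r)) / fact (i + (n + Suc r)) =
        a / real (i + (n + Suc r)) * (a ^ (i + (n + r)) / fact (i + (n + r)))"
      by simp
    ultimately show "a ^ (i + (n + Suc r)) / fact (i + (n + Suc r)) \<le>
        a / (real n + 1) * (a ^ (i + (n + r)) / fact (i + (n + r)))" by simp
  qed
  also have "\<dots> \<le> a / (real n + 1) * ((a / (real n + 1)) ^ r * exp a)"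
    using a Suc by (intro mult_left_mono) auto
  finally show ?case by simp
qed

lemma gauss_monomial_kernel_sum:
  "(\<Sum>k\<le>K. gauss_monomial k x * gauss_monomial k y) =
    exp (- x\<^sup>2) * exp (- y\<^sup>2) * (\<Sum>k<Suc K. (2 * x * y) ^ k / fact k)"
proof -
  have "gauss_monomial k x * gauss_monomial k y = exp (- x\<^sup>2) * exp (- y\<^sup>2) * ((2 * x * y) ^ k / fact k)" for k
  proof -
    have "gauss_monomial k x * gauss_monomial k y =
        (sqrt (2 ^ k / fact k) * sqrt (2 ^ k / fact k)) * x ^ k * y ^ k * (exp (- x\<^sup>2) * exp (- y\<^sup>2))"
      by (simp add: gauss_monomial_def mult_ac)
    also have "sqrt (2 ^ k / fact k) * sqrt (2 ^ k / fact k) = 2 ^ k / fact k" by simp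
    finally show ?thesis by (simp add: power_mult_distrib)
  qed
  then show ?thesis by (simp only: sum_distrib_left lessThan_Suc_atMost)
qed

text \<open>Replacing 2 x y by its absolute value in the exponential completes the square to
  \<open>g\<close>. So the kernel, its truncation and the error share one Gaussian majorant in the
  difference of \<bar>x\<bar> and \<bar>y\<bar>, although the truncated series has mixed
  signs.\<close>

lemma gauss_monomial_kernel_bounds:
  fixes x y :: real
  defines "g \<equiv> exp (- (\<bar>x\<bar> - \<bar>y\<bar>)\<^sup>2)"
  shows "\<bar>\<Sum>k\<le>K. gauss_monomial k x * gauss_monomial k y\<bar> \<le> g" and "exp (- (x - y)\<^sup>2) \<le> g"
    and "2 * r \<le> K \<Longrightarrow> 1 \<le> K \<Longrightarrow> \<bar>exp (- (x - y)\<^sup>2) - (\<Sum>k\<le>K. gauss_monomial k x * gauss_monomial k y)\<bar>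
      \<le> (4 * \<bar>x\<bar> * \<bar>y\<bar> / real K) ^ r * g"
proof -
  let ?a = "\<bar>2 * x * y\<bar>"
  have g: "g = exp (- x\<^sup>2) * exp (- y\<^sup>2) * exp ?a"
    unfolding g_def exp_add[symmetric] by (simp add: power2_diff abs_mult)
  have "\<bar>\<Sum>k<Suc K. (2 * x * y) ^ k / fact k\<bar> \<le> (\<Sum>k<Suc K. ?a ^ k / fact k)"
    by (rule order_trans[OF sum_abs]) (simp add: power_abs)
  also have "\<dots> \<le> exp ?a"
  proof -
    have "0 \<le> exp_tail (Suc K) ?a"
      by (rule sums_le[OF _ sums_zero exp_tail_sums]) simp
    then show ?thesis by (simp add: exp_tail_def)
  qed
  finally show "\<bar>\<Sum>k\<le>K. gauss_monomial k x * gauss_monomial k y\<bar> \<le> g"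
    unfolding gauss_monomial_kernel_sum g abs_mult by (intro mult_mono) auto
  have e: "exp (- (x - y)\<^sup>2) = exp (- x\<^sup>2) * exp (- y\<^sup>2) * exp (2 * x * y)"
    unfolding exp_add[symmetric] by (simp add: power2_diff)
  show "exp (- (x - y)\<^sup>2) \<le> g" unfolding e g by (intro mult_left_mono) auto
  assume K: "2 * r \<le> K" "1 \<le> K"
  \<comment> \<open>\<open>r\<close> of the \<open>Suc K\<close> summands are set aside to gain the
    power \<open>r\<close>; as \<open>2 * r \<le> K\<close>, the denominator n + 1 is still at least
    K / 2. This doubles the factor 2 of \<open>2 * x * y\<close> to 4.\<close>
  define n where "n = Suc K - r"
  have n: "Suc K = n + r" "real K / 2 \<le> real n + 1" using K unfolding n_def by auto
  have "\<bar>exp (2 * x * y) - (\<Sum>k<Suc K. (2 * x * y) ^ k / fact k)\<bar> \<le> exp_tail (n + r) ?a"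
    unfolding n(1) by (rule abs_exp_minus_partial_sum_le)
  also have "\<dots> \<le> (?a / (real n + 1)) ^ r * exp ?a" by (rule exp_tail_le) simp
  also have "\<dots> \<le> (?a / (real K / 2)) ^ r * exp ?a"
    using K n by (intro mult_right_mono power_mono divide_left_mono) auto
  also have "?a / (real K / 2) = 4 * \<bar>x\<bar> * \<bar>y\<bar> / real K" by (simp add: abs_mult)
  finally have "exp (- x\<^sup>2) * exp (- y\<^sup>2) * \<bar>exp (2 * x * y) - (\<Sum>k<Suc K. (2 * x * y) ^ k / fact k)\<bar>
      \<le> exp (- x\<^sup>2) * exp (- y\<^sup>2) * ((4 * \<bar>x\<bar> * \<bar>y\<bar> / real K) ^ r * exp ?a)"
    by (intro mult_left_mono) auto
  moreover have "\<bar>exp (- (x - y)\<^sup>2) - (\<Sum>k\<le>K. gauss_monomial k x * gauss_monomial k y)\<bar> =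
      exp (- x\<^sup>2) * exp (- y\<^sup>2) * \<bar>exp (2 * x * y) - (\<Sum>k<Suc K. (2 * x * y) ^ k / fact k)\<bar>"
    unfolding gauss_monomial_kernel_sum e right_diff_distrib[symmetric] abs_mult by simp
  ultimately show "\<bar>exp (- (x - y)\<^sup>2) - (\<Sum>k\<le>K. gauss_monomial k x * gauss_monomial k y)\<bar>
      \<le> (4 * \<bar>x\<bar> * \<bar>y\<bar> / real K) ^ r * g" unfolding g by (simp only: mult_ac)
qed

text \<open>After division by \<open>g\<close> all factors have absolute value at most 1, and for
  such factors a difference of products is bounded by the sum of the differences.\<close>

lemma abs_prod_diff_le:
  fixes A B g :: "'i \<Rightarrow> real"
  assumes "finite I" "\<And>i. i \<in> I \<Longrightarrow> \<bar>A i\<bar> \<le> g i" "\<And>i. i \<in> I \<Longrightarrow> \<bar>B i\<bar> \<le> g i" "\<And>i. i \<in> I \<Longrightarrow> 0 < g i"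
    and "\<And>i. i \<in> I \<Longrightarrow> \<bar>A i - B i\<bar> \<le> d * g i"
  shows "\<bar>(\<Prod>i\<in>I. A i) - (\<Prod>i\<in>I. B i)\<bar> \<le> real (card I) * d * (\<Prod>i\<in>I. g i)"
proof -
  have g: "0 < (\<Prod>i\<in>I. g i)" using assms(4) by (rule prod_pos)
  have "norm ((\<Prod>i\<in>I. A i / g i) - (\<Prod>i\<in>I. B i / g i)) \<le> (\<Sum>i\<in>I. norm (A i / g i - B i / g i))"
    using assms(2-4) by (intro norm_prod_diff) (simp_all add: abs_divide divide_le_eq abs_of_pos)
  also have "\<dots> \<le> (\<Sum>i\<in>I. d)"
  proof (rule sum_mono)
    fix i assume i: "i \<in> I"
    show "norm (A i / g i - B i / g i) \<le> d"
      using assms(5)[OF i] assms(4)[OF i] by (simp add: diff_divide_distrib[symmetric] abs_divide divide_le_eq)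
  qed
  finally have "\<bar>(\<Prod>i\<in>I. A i) / (\<Prod>i\<in>I. g i) - (\<Prod>i\<in>I. B i) / (\<Prod>i\<in>I. g i)\<bar> \<le> real (card I) * d"
    by (simp add: prod_dividef)
  then show ?thesis
    using g by (simp add: diff_divide_distrib[symmetric] abs_divide divide_le_eq)
qed

abbreviation index_box :: "nat \<Rightarrow> ('a::euclidean_space \<Rightarrow> nat) set" where
  "index_box K \<equiv> PiE Basis (\<lambda>_. {..K})"

lemma finite_index_box: "finite (index_box K)"
  by (intro finite_PiE) auto

lemma card_index_box: "card (index_box K :: ('a::euclidean_space \<Rightarrow> nat) set) = Suc K ^ DIM('a)"
  by (simp add: card_PiE)

text \<open>Truncated in each coordinate separately rather than by total degree: the kernel remains
  a product and one-dimensional estimates apply factor by factor.\<close>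

definition gauss_kernel :: "real \<Rightarrow> nat \<Rightarrow> 'a::euclidean_space \<Rightarrow> 'a \<Rightarrow> real" where
  "gauss_kernel s K u y = (\<Prod>b\<in>Basis. \<Sum>k\<le>K. gauss_monomial k (u \<bullet> b / s) * gauss_monomial k (y \<bullet> b / s))"

lemma gauss_kernel_expand:
  "complex_of_real (gauss_kernel s K u y) = (\<Sum>\<alpha>\<in>index_box K. gauss_tensor s \<alpha> u * gauss_tensor s \<alpha> y)"
proof -
  have "gauss_kernel s K u y = (\<Sum>\<alpha>\<in>index_box K. \<Prod>b\<in>Basis.
      gauss_monomial (\<alpha> b) (u \<bullet> b / s) * gauss_monomial (\<alpha> b) (y \<bullet> b / s))"
    unfolding gauss_kernel_def by (rule prod_sum_PiE) auto
  then show ?thesis by (simp add: gauss_tensor_def prod.distrib)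
qed

text \<open>The majorants multiply to exp (-T^2), where \<open>T\<close> is the Euclidean distance
  between the vectors of absolute coordinates of \<open>U\<close> and \<open>Y\<close>. Since
  \<open>norm U \<le> norm Y + T\<close>, all growth in \<open>u\<close> is moved to
  \<open>y\<close>, where the decay of \<open>f\<close> can pay for it: \<open>r\<close> powers from
  each norm in \<open>d\<close> and \<open>q\<close> from the weight make 2 r + q.\<close>

lemma gauss_kernel_error:
  fixes u y :: "'a::euclidean_space"
  assumes s: "0 < s" "s \<le> 1" and K: "2 * r \<le> K" "1 \<le> K"
  shows "(1 + norm u) ^ q * \<bar>exp (- (norm ((u - y) /\<^sub>R s))\<^sup>2) - gauss_kernel s K u y\<bar>
    \<le> real DIM('a) * (4 / real K) ^ r * (fact (r + q) * exp 2) * ((1 + norm y) / s) ^ (2 * r + q)"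
proof -
  define U Y where "U = u /\<^sub>R s" and "Y = y /\<^sub>R s"
  define t where "t b = \<bar>U \<bullet> b\<bar> - \<bar>Y \<bullet> b\<bar>" for b
  define T where "T = L2_set t Basis"
  define d where "d = (4 * norm U * norm Y / real K) ^ r"
  have T0: "0 \<le> T" unfolding T_def by (rule L2_set_nonneg)
  have L2: "norm x = L2_set (\<lambda>b. \<bar>x \<bullet> b\<bar>) Basis" for x :: 'a
    using euclidean_dist_l2[of x 0] by (simp add: dist_norm)
  have prod_exp: "(\<Prod>b\<in>Basis. exp (- (f b)\<^sup>2)) = exp (- (L2_set f Basis)\<^sup>2)" for f :: "'a \<Rightarrow> real"
    by (simp add: exp_sum[symmetric] sum_negf L2_set_def sum_nonneg)
  have e: "exp (- (norm ((u - y) /\<^sub>R s))\<^sup>2) = (\<Prod>b\<in>Basis. exp (- (U \<bullet> b - Y \<bullet> b)\<^sup>2))"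
  proof -
    have "norm ((u - y) /\<^sub>R s) = L2_set (\<lambda>b. U \<bullet> b - Y \<bullet> b) Basis"
      unfolding L2 by (simp add: U_def Y_def L2_set_def inner_diff_left right_diff_distrib)
    then show ?thesis by (simp add: prod_exp)
  qed
  have k: "gauss_kernel s K u y = (\<Prod>b\<in>Basis. \<Sum>k\<le>K. gauss_monomial k (U \<bullet> b) * gauss_monomial k (Y \<bullet> b))"
    by (simp add: gauss_kernel_def U_def Y_def divide_inverse mult.commute)
  have "\<bar>exp (- (norm ((u - y) /\<^sub>R s))\<^sup>2) - gauss_kernel s K u y\<bar> \<le>
      real DIM('a) * d * (\<Prod>b\<in>Basis. exp (- (t b)\<^sup>2))"
    unfolding e k
  proof (rule abs_prod_diff_le)
    fix b :: 'a assume b: "b \<in> Basis"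
    note bd = gauss_monomial_kernel_bounds[where x = "U \<bullet> b" and y = "Y \<bullet> b"]
    show "\<bar>exp (- (U \<bullet> b - Y \<bullet> b)\<^sup>2)\<bar> \<le> exp (- (t b)\<^sup>2)" using bd(2) by (simp add: t_def)
    show "\<bar>\<Sum>k\<le>K. gauss_monomial k (U \<bullet> b) * gauss_monomial k (Y \<bullet> b)\<bar> \<le> exp (- (t b)\<^sup>2)"
      using bd(1) by (simp add: t_def)
    have "(4 * \<bar>U \<bullet> b\<bar> * \<bar>Y \<bullet> b\<bar> / real K) ^ r \<le> d"
      unfolding d_def using b by (intro power_mono divide_right_mono mult_mono Basis_le_norm) auto
    then have "(4 * \<bar>U \<bullet> b\<bar> * \<bar>Y \<bullet> b\<bar> / real K) ^ r * exp (- (t b)\<^sup>2) \<le> d * exp (- (t b)\<^sup>2)"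
      by (rule mult_right_mono) simp
    then show "\<bar>exp (- (U \<bullet> b - Y \<bullet> b)\<^sup>2) - (\<Sum>k\<le>K. gauss_monomial k (U \<bullet> b) * gauss_monomial k (Y \<bullet> b))\<bar> \<le> d * exp (- (t b)\<^sup>2)"
      using bd(3)[OF K] unfolding t_def by (rule order_trans[rotated])
  qed auto
  also have "(\<Prod>b\<in>Basis. exp (- (t b)\<^sup>2)) = exp (- T\<^sup>2)" unfolding T_def by (rule prod_exp)
  finally have main: "\<bar>exp (- (norm ((u - y) /\<^sub>R s))\<^sup>2) - gauss_kernel s K u y\<bar> \<le> real DIM('a) * d * exp (- T\<^sup>2)" .
  have UY: "norm U \<le> norm Y + T"
  proof -
    have "norm U \<le> L2_set (\<lambda>b. \<bar>Y \<bullet> b\<bar> + t b) Basis" unfolding L2 t_def by simp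
    also have "\<dots> \<le> L2_set (\<lambda>b. \<bar>Y \<bullet> b\<bar>) Basis + T" unfolding T_def by (rule L2_set_triangle_ineq)
    finally show ?thesis by (simp add: L2)
  qed
  have "(1 + norm U) ^ (r + q) * exp (- T\<^sup>2) \<le> ((1 + norm Y) * (1 + T)) ^ (r + q) * exp (- T\<^sup>2)"
  proof (intro mult_right_mono power_mono)
    have "0 \<le> norm Y * T" using T0 by simp
    then show "1 + norm U \<le> (1 + norm Y) * (1 + T)" using UY unfolding distrib_left distrib_right by linarith
  qed auto
  also have "\<dots> = (1 + norm Y) ^ (r + q) * ((1 + T) ^ (r + q) * exp (- T\<^sup>2))"
    by (simp add: power_mult_distrib mult.assoc)
  also have "\<dots> \<le> (1 + norm Y) ^ (r + q) * (fact (r + q) * exp 2)"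
    by (intro mult_left_mono gauss_weight_bound T0) auto
  finally have wt: "(1 + norm U) ^ (r + q) * exp (- T\<^sup>2) \<le> (1 + norm Y) ^ (r + q) * (fact (r + q) * exp 2)" .
  \<comment> \<open>Since \<open>s \<le> 1\<close>, rescaling only enlarges the weight in
    \<open>u\<close>; undoing it for \<open>y\<close> is what costs the powers of 1 / s.\<close>
  have xs: "1 + norm (x /\<^sub>R s) \<le> (1 + norm x) / s" "1 + norm x \<le> 1 + norm (x /\<^sub>R s)" for x :: 'a
    using s mult_right_mono[of s 1 "norm x"] by (simp_all add: field_simps)
  have d_le: "d \<le> (4 / real K) ^ r * (1 + norm U) ^ r * (1 + norm Y) ^ r"
  proof -
    have "d = (4 / real K) ^ r * norm U ^ r * norm Y ^ r" unfolding d_def by (simp add: power_mult_distrib power_divide)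
    also have "\<dots> \<le> (4 / real K) ^ r * (1 + norm U) ^ r * (1 + norm Y) ^ r"
      by (intro mult_mono power_mono) auto
    finally show ?thesis .
  qed
  have "(1 + norm u) ^ q * \<bar>exp (- (norm ((u - y) /\<^sub>R s))\<^sup>2) - gauss_kernel s K u y\<bar> \<le>
      (1 + norm U) ^ q * (real DIM('a) * ((4 / real K) ^ r * (1 + norm U) ^ r * (1 + norm Y) ^ r) * exp (- T\<^sup>2))"
  proof (intro mult_mono power_mono)
    show "\<bar>exp (- (norm ((u - y) /\<^sub>R s))\<^sup>2) - gauss_kernel s K u y\<bar> \<le>
        real DIM('a) * ((4 / real K) ^ r * (1 + norm U) ^ r * (1 + norm Y) ^ r) * exp (- T\<^sup>2)"
      by (rule order_trans[OF main]) (intro mult_right_mono mult_left_mono d_le, auto)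
  qed (use xs in \<open>auto simp: U_def\<close>)
  also have "\<dots> = real DIM('a) * (4 / real K) ^ r * (1 + norm Y) ^ r * ((1 + norm U) ^ (r + q) * exp (- T\<^sup>2))"
    by (simp add: power_add mult_ac)
  also have "\<dots> \<le> real DIM('a) * (4 / real K) ^ r * (1 + norm Y) ^ r * ((1 + norm Y) ^ (r + q) * (fact (r + q) * exp 2))"
    by (intro mult_left_mono wt) auto
  also have "\<dots> = real DIM('a) * (4 / real K) ^ r * (fact (r + q) * exp 2) * (1 + norm Y) ^ (2 * r + q)"
  proof -
    have "(1 + norm Y) ^ (2 * r + q) = (1 + norm Y) ^ r * (1 + norm Y) ^ (r + q)"
      by (simp add: power_add[symmetric] mult_2 add.assoc)
    then show ?thesis by (simp only: mult_ac)
  qed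
  also have "\<dots> \<le> real DIM('a) * (4 / real K) ^ r * (fact (r + q) * exp 2) * ((1 + norm y) / s) ^ (2 * r + q)"
    using xs[of y] by (intro mult_left_mono power_mono) (auto simp: Y_def)
  finally show ?thesis .
qed

text \<open>The integral operator with kernel \<open>gauss_kernel\<close>, normalized as
  \<open>gauss_smooth\<close> is, but in finite-rank form: coefficients times fixed functions, so
  that a linear map passes through the sum.\<close>

definition gauss_proj :: "real \<Rightarrow> nat \<Rightarrow> ('a::euclidean_space \<Rightarrow> complex) \<Rightarrow> 'a \<Rightarrow> complex" where
  "gauss_proj s K f u = (\<Sum>\<alpha>\<in>index_box K. (\<integral>y. gauss_tensor s \<alpha> y * f y \<partial>lborel) * gauss_tensor s \<alpha> u) /\<^sub>R
     (gauss_mass TYPE('a) * s ^ DIM('a))"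

lemma gauss_tensor_integrable:
  assumes "f \<in> schwartz"
  shows "integrable lborel (\<lambda>y. gauss_tensor s \<alpha> y * f y)"
proof -
  obtain B where "\<And>y. (1 + norm y) ^ (0 + (DIM('a) + 2)) * norm (f y) \<le> B"
    using schwartz_decay[OF assms] by blast
  then show ?thesis
    by (intro kernel_int_weight_bound(1)[where A = 1 and q = 0])
      (auto simp: norm_gauss_tensor_le intro: smooth_continuous_on smooth_gauss_tensor schwartz_smooth[OF assms])
qed

text \<open>Of the powers of 1 / s, \<open>DIM('a)\<close> stem from the normalization and
  \<open>2 * r + q\<close> from the kernel error. No derivative of \<open>f\<close> is involved,
  only a weight that grows with \<open>r\<close>.\<close>

lemma gauss_proj_error:
  fixes f :: "'a::euclidean_space \<Rightarrow> complex"
  assumes s: "0 < s" "s \<le> 1" and K: "2 * r \<le> K" "1 \<le> K" and f: "f \<in> schwartz"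
    and G: "0 \<le> G" "mu (int (2 * r + q + (DIM('a) + 2))) 0 f \<le> ennreal G"
  shows "(1 + norm u) ^ q * norm (gauss_smooth s f u - gauss_proj s K f u) \<le>
    G * (1 / s) ^ (DIM('a) + 2 * r + q) * (1 / real K) ^ r *
    (real DIM('a) * 4 ^ r * (fact (r + q) * exp 2) * weight_integral TYPE('a) / gauss_mass TYPE('a))"
proof -
  let ?Z = "gauss_mass TYPE('a)"
  note fs = schwartz_smooth[OF f]
  have Gb: "(1 + norm y) ^ (2 * r + q + (DIM('a) + 2)) * norm (f y) \<le> G" for y
    using G(2) mu_pos_le_ennreal_iff[OF fs G(1), of "2 * r + q + (DIM('a) + 2)" 0] by (auto dest: spec[of _ "[]"])
  obtain B where B: "\<And>y. (1 + norm y) ^ (0 + (DIM('a) + 2)) * norm (f y) \<le> B"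
    using schwartz_decay[OF f] by blast
  let ?e = "\<lambda>y. exp (- (norm ((u - y) /\<^sub>R s))\<^sup>2)"
  have int_e: "integrable lborel (\<lambda>y. complex_of_real (?e y) * f y)"
    by (rule kernel_int_weight_bound(1)[where A = 1 and q = 0, OF _ _ _ _ B])
      (use fs in \<open>auto intro!: continuous_intros smooth_continuous_on\<close>)
  have int_k: "integrable lborel (\<lambda>y. complex_of_real (gauss_kernel s K u y) * f y)"
    unfolding gauss_kernel_expand sum_distrib_right mult.assoc
    by (intro Bochner_Integration.integrable_sum integrable_mult_right gauss_tensor_integrable[OF f])
  have "gauss_proj s K f u = (\<integral>y. gauss_kernel s K u y * f y \<partial>lborel) /\<^sub>R (?Z * s ^ DIM('a))"
  proof -
    have "(\<integral>y. (\<Sum>\<alpha>\<in>index_box K. gauss_tensor s \<alpha> u * (gauss_tensor s \<alpha> y * f y)) \<partial>lborel) =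
        (\<Sum>\<alpha>\<in>index_box K. gauss_tensor s \<alpha> u * (\<integral>y. gauss_tensor s \<alpha> y * f y \<partial>lborel))"
      by (subst Bochner_Integration.integral_sum)
        (rule integrable_mult_right, rule gauss_tensor_integrable[OF f], simp only: integral_mult_right_zero)
    then show ?thesis
      unfolding gauss_proj_def gauss_kernel_expand sum_distrib_right mult.assoc by (simp add: mult.commute)
  qed
  moreover have "gauss_smooth s f u = (\<integral>y. ?e y * f y \<partial>lborel) /\<^sub>R (?Z * s ^ DIM('a))"
    using gauss_smooth_convolution[OF s(1) fs] by (simp add: scaleR_conv_of_real)
  ultimately have eq: "gauss_smooth s f u - gauss_proj s K f u =
      (\<integral>y. (?e y - gauss_kernel s K u y) * f y \<partial>lborel) /\<^sub>R (?Z * s ^ DIM('a))"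
    using int_e int_k by (simp add: scaleR_diff_right left_diff_distrib)
  define M where "M = real DIM('a) * (4 / real K) ^ r * (fact (r + q) * exp 2) * (1 / s) ^ (2 * r + q) / (1 + norm u) ^ q"
  have M: "0 \<le> M" unfolding M_def using s by simp
  have nz: "1 + norm u \<noteq> 0" "0 < 1 + norm u" using norm_ge_zero[of u] by linarith+
  have "norm (complex_of_real (?e y - gauss_kernel s K u y)) \<le> M * (1 + norm y) ^ (2 * r + q)" for y
    unfolding norm_of_real
  proof -
    have "(1 + norm u) ^ q * \<bar>?e y - gauss_kernel s K u y\<bar> \<le>
        real DIM('a) * (4 / real K) ^ r * (fact (r + q) * exp 2) * ((1 + norm y) / s) ^ (2 * r + q)"
      by (rule gauss_kernel_error[OF s K])
    also have "\<dots> = (1 + norm u) ^ q * (M * (1 + norm y) ^ (2 * r + q))"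
      by (simp add: M_def power_divide nz)
    finally show "\<bar>?e y - gauss_kernel s K u y\<bar> \<le> M * (1 + norm y) ^ (2 * r + q)"
      by (simp add: nz)
  qed
  then have "norm (\<integral>y. complex_of_real (?e y - gauss_kernel s K u y) * f y \<partial>lborel) \<le> M * G * weight_integral TYPE('a)"
  proof (rule kernel_int_weight_bound(2)[OF _ smooth_continuous_on[OF fs] M _ Gb, rotated])
    have "continuous_on UNIV (\<lambda>y. complex_of_real (?e y) - (\<Sum>\<alpha>\<in>index_box K. gauss_tensor s \<alpha> u * gauss_tensor s \<alpha> y))"
      by (intro continuous_intros smooth_continuous_on smooth_gauss_tensor)
    then show "continuous_on UNIV (\<lambda>y. complex_of_real (?e y - gauss_kernel s K u y))"
      by (simp add: gauss_kernel_expand)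
  qed
  then have "(1 + norm u) ^ q * (norm (\<integral>y. complex_of_real (?e y - gauss_kernel s K u y) * f y \<partial>lborel) / (?Z * s ^ DIM('a)))
    \<le> (1 + norm u) ^ q * (M * G * weight_integral TYPE('a) / (?Z * s ^ DIM('a)))"
    using s gauss_mass_pos[where 'a = 'a] by (intro mult_left_mono divide_right_mono) auto
  also have "\<dots> = G * (1 / s) ^ (DIM('a) + 2 * r + q) * (1 / real K) ^ r *
    (real DIM('a) * 4 ^ r * (fact (r + q) * exp 2) * weight_integral TYPE('a) / ?Z)"
  proof -
    have "(1 + norm u) ^ q * M = real DIM('a) * (4 / real K) ^ r * (fact (r + q) * exp 2) * (1 / s) ^ (2 * r + q)"
      by (simp add: M_def nz)
    then have "(1 + norm u) ^ q * (M * G * weight_integral TYPE('a) / (?Z * s ^ DIM('a))) =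
        real DIM('a) * (4 / real K) ^ r * (fact (r + q) * exp 2) * (1 / s) ^ (2 * r + q) * G * weight_integral TYPE('a) / (?Z * s ^ DIM('a))"
      by (simp only: times_divide_eq_right mult.assoc[symmetric])
    then show ?thesis by (simp add: power_divide power_add mult_ac)
  qed
  finally show ?thesis
    unfolding eq using s gauss_mass_pos[where 'a = 'a] by (simp add: divide_inverse mult_ac)
qed

definition gauss_approx :: "real \<Rightarrow> nat \<Rightarrow> nat \<Rightarrow> ('a::euclidean_space \<Rightarrow> complex) \<Rightarrow> 'a \<Rightarrow> complex" where
  "gauss_approx \<sigma> m K f u = (\<Sum>j=1..m. (-1) ^ Suc j * of_nat (m choose j) * gauss_proj (real j * \<sigma>) K f u)"

text \<open>The constant depends on \<open>r\<close>, \<open>q\<close> and the dimension alone, so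
  \<open>m\<close>, \<open>K\<close> and \<sigma> may vary with \<epsilon>. The smallest width is
  \<sigma> because the sum starts at \<open>j = 1\<close>, and the binomial weights add up to at
  most 2^m.\<close>

lemma gauss_approx_error:
  obtains C where "0 \<le> C"
    and "\<And>(f :: 'a::euclidean_space \<Rightarrow> complex) \<sigma> m K F G u. f \<in> schwartz \<Longrightarrow> 0 < \<sigma> \<Longrightarrow> real m * \<sigma> \<le> 1 \<Longrightarrow> r \<le> m \<Longrightarrow> 2 * r \<le> K \<Longrightarrow> 1 \<le> K \<Longrightarrow>
      0 \<le> F \<Longrightarrow> mu (int q) (real r) f \<le> ennreal F \<Longrightarrow>
      0 \<le> G \<Longrightarrow> mu (int (2 * r + q + (DIM('a) + 2))) 0 f \<le> ennreal G \<Longrightarrow>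
      (1 + norm u) ^ q * norm (f u - gauss_approx \<sigma> m K f u) \<le>
        C * (2 ^ m * \<sigma> ^ r * F + 2 ^ m * (1 / \<sigma>) ^ (DIM('a) + 2 * r + q) * (1 / real K) ^ r * G)"
proof -
  define C1 where "C1 = real DIM('a) ^ r * (fact (DIM('a) + 2 + (r + q)) * exp 2) *
        weight_integral TYPE('a) / gauss_mass TYPE('a)"
  define C2 where "C2 = real DIM('a) * 4 ^ r * (fact (r + q) * exp 2) * weight_integral TYPE('a) / gauss_mass TYPE('a)"
  have C: "0 \<le> C1" "0 \<le> C2"
    unfolding C1_def C2_def using weight_integral_nonneg[where 'a = 'a] gauss_mass_pos[where 'a = 'a] by auto
  show ?thesis
  proof (rule that[of "C1 + C2"])
    show "0 \<le> C1 + C2" using C by simp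
    fix f :: "'a \<Rightarrow> complex" and \<sigma> F G :: real and m K :: nat and u :: 'a
    assume f: "f \<in> schwartz" and s: "0 < \<sigma>" "real m * \<sigma> \<le> 1" and r: "r \<le> m" and K: "2 * r \<le> K" "1 \<le> K"
      and F: "0 \<le> F" "mu (int q) (real r) f \<le> ennreal F"
      and G: "0 \<le> G" "mu (int (2 * r + q + (DIM('a) + 2))) 0 f \<le> ennreal G"
    let ?p = "DIM('a) + 2 * r + q"
    let ?E = "\<lambda>j. gauss_smooth (real j * \<sigma>) f u - gauss_proj (real j * \<sigma>) K f u"
    let ?S = "\<Sum>j=1..m. (-1) ^ Suc j * of_nat (m choose j) * gauss_smooth (real j * \<sigma>) f u"
    let ?D = "\<Sum>j=1..m. (-1) ^ Suc j * of_nat (m choose j) * ?E j"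
    define P where "P = (1 / \<sigma>) ^ ?p * (1 / real K) ^ r * G * C2"
    have P: "0 \<le> P" unfolding P_def using s G C by simp
    have "f u - gauss_approx \<sigma> m K f u = (f u - ?S) + ?D"
    proof -
      have "a - A = (a - S) + (S - A)" for a A S :: complex by simp
      then show ?thesis by (simp only: gauss_approx_def right_diff_distrib sum_subtractf)
    qed
    then have "(1 + norm u) ^ q * norm (f u - gauss_approx \<sigma> m K f u) \<le> (1 + norm u) ^ q * (norm (f u - ?S) + norm ?D)"
      by (simp only:) (intro mult_left_mono norm_triangle_ineq zero_le_power, simp)
    also have "\<dots> = (1 + norm u) ^ q * norm (f u - ?S) + (1 + norm u) ^ q * norm ?D"
      by (rule distrib_left)
    also have "(1 + norm u) ^ q * norm (f u - ?S) \<le> 2 ^ m * \<sigma> ^ r * F * C1"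
      unfolding C1_def by (rule gauss_smooth_richardson[OF f s r F])
    also have "(1 + norm u) ^ q * norm ?D \<le> 2 ^ m * P"
    proof -
      have "(1 + norm u) ^ q * norm ?D \<le> (1 + norm u) ^ q * (\<Sum>j=1..m. real (m choose j) * norm (?E j))"
        by (intro mult_left_mono order_trans[OF norm_sum]) (simp_all add: norm_mult norm_power)
      also have "\<dots> = (\<Sum>j=1..m. real (m choose j) * ((1 + norm u) ^ q * norm (?E j)))"
        by (simp add: sum_distrib_left mult.left_commute)
      also have "\<dots> \<le> (\<Sum>j=1..m. real (m choose j) * P)"
      proof (intro sum_mono mult_left_mono)
        fix j assume j: "j \<in> {1..m}"
        have js: "0 < real j * \<sigma>" "real j * \<sigma> \<le> 1" "\<sigma> \<le> real j * \<sigma>"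
          using j s order_trans[OF mult_right_mono[of "real j" "real m" \<sigma>] s(2)] by auto
        have "(1 + norm u) ^ q * norm (?E j) \<le> G * (1 / (real j * \<sigma>)) ^ ?p * (1 / real K) ^ r * C2"
          unfolding C2_def by (rule gauss_proj_error[OF js(1,2) K f G])
        also have "\<dots> \<le> G * (1 / \<sigma>) ^ ?p * (1 / real K) ^ r * C2"
          using js s G C by (intro mult_right_mono mult_left_mono power_mono divide_left_mono) auto
        finally show "(1 + norm u) ^ q * norm (?E j) \<le> P" by (simp add: P_def mult_ac)
      qed simp
      also have "\<dots> = real (\<Sum>j=1..m. m choose j) * P" by (simp add: sum_distrib_right)
      also have "\<dots> \<le> real (2 ^ m) * P"
      proof (intro mult_right_mono P of_nat_mono)
        have "(\<Sum>j=1..m. m choose j) \<le> (\<Sum>j\<le>m. m choose j)" by (rule sum_mono2) auto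
        then show "(\<Sum>j=1..m. m choose j) \<le> 2 ^ m" by (simp add: choose_row_sum)
      qed
      finally show ?thesis by simp
    qed
    also have "2 ^ m * \<sigma> ^ r * F * C1 + 2 ^ m * P \<le>
        2 ^ m * \<sigma> ^ r * F * (C1 + C2) + 2 ^ m * ((1 / \<sigma>) ^ ?p * (1 / real K) ^ r * G * (C1 + C2))"
      unfolding P_def using s F G C by (intro add_mono mult_left_mono) auto
    also have "\<dots> = (C1 + C2) * (2 ^ m * \<sigma> ^ r * F + 2 ^ m * (1 / \<sigma>) ^ ?p * (1 / real K) ^ r * G)"
      by (simp only: distrib_left mult_ac)
    finally show "(1 + norm u) ^ q * norm (f u - gauss_approx \<sigma> m K f u) \<le>
        (C1 + C2) * (2 ^ m * \<sigma> ^ r * F + 2 ^ m * (1 / \<sigma>) ^ ?p * (1 / real K) ^ r * G)"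
      by simp
  qed
qed

section \<open>Nets\<close>

lemma eventually_at_right_less: "0 < c \<Longrightarrow> \<forall>\<^sub>F \<epsilon> in at_right (0::real). \<epsilon> \<in> {0<..<c}"
  by (rule eventually_at_right_real)

lemma inverse_power_powr: "0 < \<epsilon> \<Longrightarrow> (1 / \<epsilon>) ^ N = \<epsilon> powr (- real N)"
  by (simp add: powr_minus powr_realpow power_one_over inverse_eq_divide)

lemma negligible_of_order_zero:
  fixes g :: "real \<Rightarrow> 'a::euclidean_space \<Rightarrow> complex"
  assumes g: "\<And>\<epsilon>. \<epsilon> \<in> {0<..1} \<Longrightarrow> smooth (g \<epsilon>)"
    and mod: "\<And>l. \<exists>N::nat. bigO_eps (\<lambda>\<epsilon>. mu (int q) (real l) (g \<epsilon>)) (- real N)"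
    and zero: "\<And>p. bigO_eps (\<lambda>\<epsilon>. mu (int q) 0 (g \<epsilon>)) (real p)"
  shows "bigO_eps (\<lambda>\<epsilon>. mu (int q) (real l) (g \<epsilon>)) (real p)"
proof (induction l arbitrary: p)
  case 0
  show ?case using zero by simp
next
  case (Suc l)
  obtain N where "bigO_eps (\<lambda>\<epsilon>. mu (int q) (real (l + 2)) (g \<epsilon>)) (- real N)" using mod by blast
  then obtain C2 where C2: "0 \<le> C2" "\<forall>\<^sub>F \<epsilon> in at_right 0. mu (int q) (real (l + 2)) (g \<epsilon>) \<le> ennreal (C2 * \<epsilon> powr (- real N))"
    unfolding bigO_eps_def by blast
  obtain C1 where C1: "0 \<le> C1" "\<forall>\<^sub>F \<epsilon> in at_right 0. mu (int q) (real l) (g \<epsilon>) \<le> ennreal (C1 * \<epsilon> powr real (2 * p + N))"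
    using Suc[of "2 * p + N"] unfolding bigO_eps_def by blast
  have "\<forall>\<^sub>F \<epsilon> in at_right 0. mu (int q) (real (Suc l)) (g \<epsilon>) \<le> ennreal (2 ^ q * (2 * C1 + C2) * \<epsilon> powr real p)"
    using C1(2) C2(2) eventually_at_right_less[OF zero_less_one]
  proof eventually_elim
    case (elim \<epsilon>)
    then have e: "0 < \<epsilon>" "\<epsilon> < 1" by auto
    \<comment> \<open>The step balances the two terms of the interpolation: t \<epsilon>^(-N) =
      \<epsilon>^p for the moderate order l + 2, and \<epsilon>^(2p + N) / t = \<epsilon>^p for the
      negligible order l. This is why the induction hypothesis is used with
      \<open>2 * p + N\<close>.\<close>
    let ?t = "\<epsilon> powr real (p + N)"
    have t: "0 < ?t" "?t \<le> 1" using e by (auto intro: powr_le1)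
    have "mu (int q) (real (l + 1)) (g \<epsilon>) \<le>
        ennreal (2 ^ q * (2 * (C1 * \<epsilon> powr real (2 * p + N)) / ?t + ?t * (C2 * \<epsilon> powr (- real N))))"
      by (rule mu_interpolation) (use elim g e t C1(1) C2(1) in auto)
    also have "2 * (C1 * \<epsilon> powr real (2 * p + N)) / ?t = 2 * C1 * \<epsilon> powr real p"
      using e by (simp add: powr_diff[symmetric] times_divide_eq_right[symmetric] del: times_divide_eq_right)
    also have "?t * (C2 * \<epsilon> powr (- real N)) = C2 * \<epsilon> powr real p"
      using e by (simp add: powr_add[symmetric] mult.left_commute)
    also have "2 ^ q * (2 * C1 * \<epsilon> powr real p + C2 * \<epsilon> powr real p) = 2 ^ q * (2 * C1 + C2) * \<epsilon> powr real p"
      by (simp add: algebra_simps)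
    finally show ?case by (simp add: add.commute)
  qed
  then show ?case unfolding bigO_eps_def using C1(1) C2(1) by (intro exI[of _ "2 ^ q * (2 * C1 + C2)"]) auto
qed

section \<open>Integral operators on nets and on their classes\<close>

lemma bigO_kernel_int:
  fixes h :: "real \<Rightarrow> 'b::euclidean_space \<times> 'a::euclidean_space \<Rightarrow> complex"
  assumes hm: "\<And>\<epsilon>. \<epsilon> \<in> {0<..1} \<Longrightarrow> h \<epsilon> \<in> mult_space" and fs: "\<And>\<epsilon>. \<epsilon> \<in> {0<..1} \<Longrightarrow> f \<epsilon> \<in> schwartz"
    and h: "bigO_eps (\<lambda>\<epsilon>. mu (- int q) (real l) (h \<epsilon>)) s"
    and f: "bigO_eps (\<lambda>\<epsilon>. mu (int (q + (DIM('a) + 2))) (real 0) (f \<epsilon>)) t"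
  shows "bigO_eps (\<lambda>\<epsilon>. mu (- int q) (real l) (kernel_int (h \<epsilon>) (f \<epsilon>))) (s + t)"
proof -
  obtain A where A: "0 \<le> A" "\<forall>\<^sub>F \<epsilon> in at_right 0. mu (- int q) (real l) (h \<epsilon>) \<le> ennreal (A * \<epsilon> powr s)"
    using h unfolding bigO_eps_def by blast
  obtain B where B: "0 \<le> B" "\<forall>\<^sub>F \<epsilon> in at_right 0. mu (int (q + (DIM('a) + 2))) (real 0) (f \<epsilon>) \<le> ennreal (B * \<epsilon> powr t)"
    using f unfolding bigO_eps_def by blast
  let ?W = "weight_integral TYPE('a)"
  have "\<forall>\<^sub>F \<epsilon> in at_right 0. mu (- int q) (real l) (kernel_int (h \<epsilon>) (f \<epsilon>)) \<le> ennreal (A * B * ?W * \<epsilon> powr (s + t))"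
    using A(2) B(2) eventually_at_right_less[OF zero_less_one]
  proof eventually_elim
    case (elim \<epsilon>)
    then have e: "0 < \<epsilon>" "\<epsilon> \<in> {0<..1}" by auto
    have "mu (- int q) (real l) (kernel_int (h \<epsilon>) (f \<epsilon>)) \<le> ennreal ((A * \<epsilon> powr s) * (B * \<epsilon> powr t) * ?W)"
      using A(1) B(1) elim(1,2) by (intro mu_kernel_int_le hm fs e) simp_all
    also have "(A * \<epsilon> powr s) * (B * \<epsilon> powr t) * ?W = A * B * ?W * \<epsilon> powr (s + t)"
      by (simp add: powr_add mult_ac)
    finally show ?case .
  qed
  moreover have "0 \<le> A * B * ?W" using A(1) B(1) weight_integral_nonneg[where 'a = 'a] by simp
  ultimately show ?thesis unfolding bigO_eps_def by blast
qed

lemma kernel_int_E_tau: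
  fixes h :: "('b::euclidean_space \<times> 'a::euclidean_space) fnet"
  assumes "h \<in> E_tau" "f \<in> E_S"
  shows "(\<lambda>\<epsilon>. kernel_int (h \<epsilon>) (f \<epsilon>)) \<in> E_tau"
  unfolding E_tau_def
proof (intro CollectI conjI ballI allI)
  have m: "h \<epsilon> \<in> mult_space" "f \<epsilon> \<in> schwartz" if "\<epsilon> \<in> {0<..1}" for \<epsilon>
    using assms that unfolding E_tau_def E_S_def by auto
  then show "kernel_int (h \<epsilon>) (f \<epsilon>) \<in> mult_space" if "\<epsilon> \<in> {0<..1}" for \<epsilon>
    using that by (intro kernel_int_mult_space) auto
  fix l :: nat
  obtain q N where h: "bigO_eps (\<lambda>\<epsilon>. mu (- int q) (real l) (h \<epsilon>)) (- real N)"
    using assms(1) unfolding E_tau_def by blast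
  obtain M where f: "bigO_eps (\<lambda>\<epsilon>. mu (int (q + (DIM('a) + 2))) (real 0) (f \<epsilon>)) (- real M)"
    using assms(2) unfolding E_S_def by blast
  have "bigO_eps (\<lambda>\<epsilon>. mu (- int q) (real l) (kernel_int (h \<epsilon>) (f \<epsilon>))) (- real N + - real M)"
    by (rule bigO_kernel_int[OF m h f])
  then have "bigO_eps (\<lambda>\<epsilon>. mu (- int q) (real l) (kernel_int (h \<epsilon>) (f \<epsilon>))) (- real (N + M))" by simp
  then show "\<exists>q N. bigO_eps (\<lambda>\<epsilon>. mu (- int q) (real l) (kernel_int (h \<epsilon>) (f \<epsilon>))) (- real N)" by blast
qed

lemma kernel_int_N_tau:
  fixes h :: "('b::euclidean_space \<times> 'a::euclidean_space) fnet"
  assumes hE: "h \<in> E_tau" and fE: "f \<in> E_S" and neg: "h \<in> N_tau \<or> f \<in> N_S"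
  shows "(\<lambda>\<epsilon>. kernel_int (h \<epsilon>) (f \<epsilon>)) \<in> N_tau"
  unfolding N_tau_def
proof (intro CollectI conjI ballI allI)
  have m: "h \<epsilon> \<in> mult_space" "f \<epsilon> \<in> schwartz" if "\<epsilon> \<in> {0<..1}" for \<epsilon>
    using hE fE that unfolding E_tau_def E_S_def by auto
  then show "kernel_int (h \<epsilon>) (f \<epsilon>) \<in> mult_space" if "\<epsilon> \<in> {0<..1}" for \<epsilon>
    using that by (intro kernel_int_mult_space) auto
  fix l :: nat
  show "\<exists>q. \<forall>p. bigO_eps (\<lambda>\<epsilon>. mu (- int q) (real l) (kernel_int (h \<epsilon>) (f \<epsilon>))) (real p)"
    using neg
  proof
    assume "h \<in> N_tau"
    then obtain q where h: "\<And>p. bigO_eps (\<lambda>\<epsilon>. mu (- int q) (real l) (h \<epsilon>)) (real p)"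
      unfolding N_tau_def by blast
    obtain M where f: "bigO_eps (\<lambda>\<epsilon>. mu (int (q + (DIM('a) + 2))) (real 0) (f \<epsilon>)) (- real M)"
      using fE unfolding E_S_def by blast
    have "bigO_eps (\<lambda>\<epsilon>. mu (- int q) (real l) (kernel_int (h \<epsilon>) (f \<epsilon>))) (real (p + M) + - real M)" for p
      by (rule bigO_kernel_int[OF m h f])
    then have "\<forall>p. bigO_eps (\<lambda>\<epsilon>. mu (- int q) (real l) (kernel_int (h \<epsilon>) (f \<epsilon>))) (real p)" by simp
    then show ?thesis by blast
  next
    assume f: "f \<in> N_S"
    obtain q N where h: "bigO_eps (\<lambda>\<epsilon>. mu (- int q) (real l) (h \<epsilon>)) (- real N)"
      using hE unfolding E_tau_def by blast
    have f': "bigO_eps (\<lambda>\<epsilon>. mu (int (q + (DIM('a) + 2))) (real 0) (f \<epsilon>)) (real p)" for p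
      using f unfolding N_S_def by blast
    have "bigO_eps (\<lambda>\<epsilon>. mu (- int q) (real l) (kernel_int (h \<epsilon>) (f \<epsilon>))) (- real N + real (p + N))" for p
      by (rule bigO_kernel_int[OF m h f'])
    then have "\<forall>p. bigO_eps (\<lambda>\<epsilon>. mu (- int q) (real l) (kernel_int (h \<epsilon>) (f \<epsilon>))) (real p)" by simp
    then show ?thesis by blast
  qed
qed

lemma N_tau_cong:
  assumes "f \<in> N_tau" "\<And>\<epsilon>. \<epsilon> \<in> {0<..1} \<Longrightarrow> f \<epsilon> = g \<epsilon>"
  shows "g \<in> N_tau"
  unfolding N_tau_def
proof (intro CollectI conjI ballI allI)
  show "g \<epsilon> \<in> mult_space" if "\<epsilon> \<in> {0<..1}" for \<epsilon>
    using assms that unfolding N_tau_def by (metis (no_types, lifting) mem_Collect_eq)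
  have ev: "\<forall>\<^sub>F \<epsilon> in at_right (0::real). f \<epsilon> = g \<epsilon>"
    by (rule eventually_mono[OF eventually_at_right_less[OF zero_less_one]]) (use assms(2) in auto)
  fix l :: nat
  obtain q where "\<And>p. bigO_eps (\<lambda>\<epsilon>. mu (- int q) (real l) (f \<epsilon>)) (real p)"
    using assms(1) unfolding N_tau_def by blast
  then have "bigO_eps (\<lambda>\<epsilon>. mu (- int q) (real l) (g \<epsilon>)) (real p)" for p
    by (rule bigO_eps_mono) (use ev in \<open>auto elim: eventually_mono\<close>)
  then show "\<exists>q. \<forall>p. bigO_eps (\<lambda>\<epsilon>. mu (- int q) (real l) (g \<epsilon>)) (real p)" by blast
qed

text \<open>Independence of the representatives of the kernel and of the argument together: the
  difference is \<open>h - k\<close> applied to \<open>f\<close> plus \<open>k\<close> applied to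
  \<open>f - g\<close>, and each part has one negligible entry.\<close>

lemma kernel_int_rel_tau:
  fixes h k :: "('b::euclidean_space \<times> 'a::euclidean_space) fnet"
  assumes hk: "(h, k) \<in> rel_tau" and fg: "(f, g) \<in> rel_S"
  shows "(\<lambda>\<epsilon>. kernel_int (h \<epsilon>) (f \<epsilon>), \<lambda>\<epsilon>. kernel_int (k \<epsilon>) (g \<epsilon>)) \<in> rel_tau"
proof -
  have E: "h \<in> E_tau" "k \<in> E_tau" "f \<in> E_S" "g \<in> E_S"
    and N: "(\<lambda>\<epsilon> x. h \<epsilon> x - k \<epsilon> x) \<in> N_tau" "(\<lambda>\<epsilon> x. f \<epsilon> x - g \<epsilon> x) \<in> N_S"
    using assms by (auto simp: rel_tau_def rel_S_def)
  note 1 = E_tau_minus[OF E(1,2)] and 2 = E_S_minus[OF E(3,4)]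
  let ?a = "\<lambda>\<epsilon>. kernel_int (\<lambda>x. h \<epsilon> x - k \<epsilon> x) (f \<epsilon>)" and ?b = "\<lambda>\<epsilon>. kernel_int (k \<epsilon>) (\<lambda>x. f \<epsilon> x - g \<epsilon> x)"
  have "?a \<in> N_tau" "?b \<in> N_tau" "?a \<in> E_tau" "?b \<in> E_tau"
    using kernel_int_N_tau[OF 1 E(3)] kernel_int_N_tau[OF E(2) 2] N
      kernel_int_E_tau[OF 1 E(3)] kernel_int_E_tau[OF E(2) 2] by blast+
  then have "(\<lambda>\<epsilon> x. 1 * ?a \<epsilon> x + 1 * ?b \<epsilon> x) \<in> N_tau"
    by (intro N_tau_lincomb E_C_const) auto
  moreover have "(\<lambda>x. 1 * ?a \<epsilon> x + 1 * ?b \<epsilon> x) = (\<lambda>x. kernel_int (h \<epsilon>) (f \<epsilon>) x - kernel_int (k \<epsilon>) (g \<epsilon>) x)"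
    if e: "\<epsilon> \<in> {0<..1}" for \<epsilon>
  proof
    fix x
    have "h \<epsilon> \<in> mult_space" "k \<epsilon> \<in> mult_space" "f \<epsilon> \<in> schwartz" "g \<epsilon> \<in> schwartz"
      using E e unfolding E_tau_def E_S_def by auto
    note i = kernel_int_integrable[OF this(1,3)] kernel_int_integrable[OF this(2,3)] kernel_int_integrable[OF this(2,4)]
    show "1 * ?a \<epsilon> x + 1 * ?b \<epsilon> x = kernel_int (h \<epsilon>) (f \<epsilon>) x - kernel_int (k \<epsilon>) (g \<epsilon>) x"
      using i[of x] by (simp add: kernel_int_def left_diff_distrib right_diff_distrib)
  qed
  ultimately have "(\<lambda>\<epsilon> x. kernel_int (h \<epsilon>) (f \<epsilon>) x - kernel_int (k \<epsilon>) (g \<epsilon>) x) \<in> N_tau"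
    by (rule N_tau_cong)
  then show ?thesis
    using kernel_int_E_tau[OF E(1,3)] kernel_int_E_tau[OF E(2,4)] unfolding rel_tau_def by blast
qed

lemma mu_sum_le:
  fixes g :: "'i \<Rightarrow> 'a::euclidean_space \<Rightarrow> complex"
  assumes I: "finite I" and g: "\<And>i. i \<in> I \<Longrightarrow> smooth (g i)"
    and B: "0 \<le> B" "\<And>i. i \<in> I \<Longrightarrow> mu r (real l) (g i) \<le> ennreal B"
    and D: "0 \<le> D" "\<And>i. i \<in> I \<Longrightarrow> norm (z i) \<le> D"
  shows "mu r (real l) (\<lambda>x. \<Sum>i\<in>I. z i * g i x) \<le> ennreal (real (card I) * D * B)"
proof (subst mu_le_ennreal_iff)
  show "smooth (\<lambda>x. \<Sum>i\<in>I. z i * g i x)" by (rule smooth_sum[OF I g])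
  show "0 \<le> real (card I) * D * B" using B(1) D(1) by simp
  show "\<forall>bs x. set bs \<subseteq> Basis \<longrightarrow> length bs \<le> l \<longrightarrow>
      (1 + norm x) powi r * norm (iter_deriv bs (\<lambda>x. \<Sum>i\<in>I. z i * g i x) x) \<le> real (card I) * D * B"
  proof (intro allI impI)
    fix bs and x :: 'a assume bs: "set bs \<subseteq> (Basis :: 'a set)" "length bs \<le> l"
    have "iter_deriv bs (\<lambda>x. \<Sum>i\<in>I. z i * g i x) x = (\<Sum>i\<in>I. z i * iter_deriv bs (g i) x)"
      by (rule fun_cong[OF iter_deriv_sum[OF I g bs(1)]])
    then have "norm (iter_deriv bs (\<lambda>x. \<Sum>i\<in>I. z i * g i x) x) \<le> (\<Sum>i\<in>I. norm (z i) * norm (iter_deriv bs (g i) x))"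
      using norm_sum[of "\<lambda>i. z i * iter_deriv bs (g i) x" I] by (simp add: norm_mult)
    then have "(1 + norm x) powi r * norm (iter_deriv bs (\<lambda>x. \<Sum>i\<in>I. z i * g i x) x) \<le>
        (1 + norm x) powi r * (\<Sum>i\<in>I. norm (z i) * norm (iter_deriv bs (g i) x))"
      by (intro mult_left_mono) (auto simp: zero_le_power_int)
    also have "\<dots> = (\<Sum>i\<in>I. norm (z i) * ((1 + norm x) powi r * norm (iter_deriv bs (g i) x)))"
      by (simp add: sum_distrib_left mult.left_commute)
    also have "\<dots> \<le> (\<Sum>i\<in>I. D * B)"
    proof (intro sum_mono mult_mono D)
      fix i assume i: "i \<in> I"
      then show "(1 + norm x) powi r * norm (iter_deriv bs (g i) x) \<le> B"
        using B(2)[OF i] bs unfolding mu_le_ennreal_iff[OF g[OF i] B(1)] by blast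
    qed (auto simp: zero_le_power_int)
    finally show "(1 + norm x) powi r * norm (iter_deriv bs (\<lambda>x. \<Sum>i\<in>I. z i * g i x) x) \<le> real (card I) * D * B"
      by (simp add: mult.assoc)
  qed
qed

section \<open>The parameters of the approximation\<close>

text \<open>\<open>2 ^ depth \<epsilon> \<le> 1 / \<epsilon>\<close> keeps the binomial weights moderate while the order of the finite
  differences tends to infinity.\<close>

definition depth :: "real \<Rightarrow> nat" where
  "depth \<epsilon> = nat \<lfloor>log 2 (1 / \<epsilon>)\<rfloor>"

text \<open>The exponent must exceed 4, since with \<sigma> = \<epsilon>^2 the truncation error
  contains \<sigma>^(-2r) = \<epsilon>^(-4r) against \<open>trunc \<epsilon>\<close> to the power
  -r; with 6 a factor \<epsilon>^(2r) remains.\<close>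

definition trunc :: "real \<Rightarrow> nat" where
  "trunc \<epsilon> = nat \<lceil>(1 / \<epsilon>) ^ 6\<rceil>"

lemma power_depth_le:
  assumes "0 < \<epsilon>" "\<epsilon> \<le> 1"
  shows "2 ^ depth \<epsilon> \<le> 1 / \<epsilon>"
proof -
  have "0 \<le> log 2 (1 / \<epsilon>)" using assms by simp
  then have "real (depth \<epsilon>) \<le> log 2 (1 / \<epsilon>)" unfolding depth_def by linarith
  then have "2 powr real (depth \<epsilon>) \<le> 1 / \<epsilon>" using assms by (subst (asm) le_log_iff) auto
  then show ?thesis by (simp add: powr_realpow)
qed

lemma le_depth:
  assumes "0 < \<epsilon>" "2 ^ r \<le> 1 / \<epsilon>"
  shows "r \<le> depth \<epsilon>"
proof -
  have "real r \<le> log 2 (1 / \<epsilon>)" using assms by (subst le_log_iff) (auto simp: powr_realpow)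
  then show ?thesis unfolding depth_def by linarith
qed

lemma depth_le:
  assumes "0 < \<epsilon>" "\<epsilon> \<le> 1"
  shows "real (depth \<epsilon>) \<le> 1 / \<epsilon>"
proof -
  have "real (depth \<epsilon>) < 2 ^ depth \<epsilon>" using of_nat_less_two_power[of "depth \<epsilon>"] by simp
  then show ?thesis using power_depth_le[OF assms] by linarith
qed

lemma depth_step_le: "0 < \<epsilon> \<Longrightarrow> \<epsilon> \<le> 1 \<Longrightarrow> real (depth \<epsilon>) * \<epsilon>\<^sup>2 \<le> 1"
proof -
  assume e: "0 < \<epsilon>" "\<epsilon> \<le> 1"
  have "real (depth \<epsilon>) * \<epsilon>\<^sup>2 \<le> 1 / \<epsilon> * \<epsilon>\<^sup>2" using e by (intro mult_right_mono depth_le) auto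
  also have "\<dots> = \<epsilon>" using e by (simp add: power2_eq_square)
  finally show ?thesis using e by simp
qed

lemma trunc_bounds:
  assumes "0 < \<epsilon>" "\<epsilon> \<le> 1"
  shows "(1 / \<epsilon>) ^ 6 \<le> real (trunc \<epsilon>)" "real (trunc \<epsilon>) \<le> 2 * (1 / \<epsilon>) ^ 6" "1 / \<epsilon> \<le> real (trunc \<epsilon>)"
proof -
  have 1: "1 \<le> (1 / \<epsilon>) ^ 6" using assms by (intro one_le_power) simp
  then show 2: "(1 / \<epsilon>) ^ 6 \<le> real (trunc \<epsilon>)" "real (trunc \<epsilon>) \<le> 2 * (1 / \<epsilon>) ^ 6"
    unfolding trunc_def by linarith+
  have "(1 / \<epsilon>) ^ 1 \<le> (1 / \<epsilon>) ^ 6" using assms by (intro power_increasing) auto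
  then show "1 / \<epsilon> \<le> real (trunc \<epsilon>)" using 2 by simp
qed

abbreviation approx_index :: "real \<Rightarrow> (nat \<times> ('a::euclidean_space \<Rightarrow> nat)) set" where
  "approx_index \<epsilon> \<equiv> {1..depth \<epsilon>} \<times> index_box (trunc \<epsilon>)"

definition approx_weight :: "'a::euclidean_space itself \<Rightarrow> real \<Rightarrow> nat \<Rightarrow> complex" where
  "approx_weight _ \<epsilon> j = (-1) ^ Suc j * of_nat (depth \<epsilon> choose j) / of_real (gauss_mass TYPE('a) * (real j * \<epsilon>\<^sup>2) ^ DIM('a))"

definition approx_fun :: "real \<Rightarrow> nat \<times> ('a::euclidean_space \<Rightarrow> nat) \<Rightarrow> 'a \<Rightarrow> complex" where
  "approx_fun \<epsilon> i = gauss_tensor (real (fst i) * \<epsilon>\<^sup>2) (snd i)"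

definition approx_op :: "real \<Rightarrow> ('a::euclidean_space \<Rightarrow> complex) \<Rightarrow> 'a \<Rightarrow> complex" where
  "approx_op \<epsilon> f u = (\<Sum>i\<in>approx_index \<epsilon>. (approx_weight TYPE('a) \<epsilon> (fst i) * (\<integral>y. approx_fun \<epsilon> i y * f y \<partial>lborel)) * approx_fun \<epsilon> i u)"

lemma finite_approx_index: "finite (approx_index \<epsilon>)"
  by (simp add: finite_index_box)

lemma approx_op_eq_gauss_approx: "approx_op \<epsilon> f = gauss_approx (\<epsilon>\<^sup>2) (depth \<epsilon>) (trunc \<epsilon>) f"
proof
  fix u :: 'a
  show "approx_op \<epsilon> f u = gauss_approx (\<epsilon>\<^sup>2) (depth \<epsilon>) (trunc \<epsilon>) f u"
  proof -
    have prod: "(\<Sum>i\<in>A \<times> B. h (fst i) (snd i)) = (\<Sum>j\<in>A. \<Sum>\<alpha>\<in>B. h j \<alpha>)"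
      for A B and h :: "nat \<Rightarrow> ('a \<Rightarrow> nat) \<Rightarrow> complex"
      by (simp add: sum.cartesian_product case_prod_beta)
    show ?thesis
      unfolding approx_op_def gauss_approx_def gauss_proj_def approx_fun_def
      by (subst prod) (simp add: approx_weight_def scaleR_conv_of_real sum_distrib_left divide_inverse mult_ac)
  qed
qed

text \<open>The base of the estimate \<open>mu_gauss_tensor_le\<close> at the smallest width
  \<epsilon>^2 and the largest degree \<open>trunc \<epsilon>\<close>; \<open>k\<close> leaves room
  for the indices raised by derivatives and weights.\<close>

definition fun_bound :: "'a::euclidean_space itself \<Rightarrow> real \<Rightarrow> nat \<Rightarrow> real" where
  "fun_bound _ \<epsilon> k = 4 * (real DIM('a) + 1) * (real (trunc \<epsilon> + k) + 1) / \<epsilon>\<^sup>2"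

lemma fun_bound_ge_1:
  assumes "0 < \<epsilon>" "\<epsilon> \<le> 1"
  shows "1 \<le> fun_bound TYPE('a::euclidean_space) \<epsilon> k"
proof -
  have "1 * 1 \<le> 4 * (real DIM('a) + 1) * (real (trunc \<epsilon> + k) + 1)" by (intro mult_mono) auto
  moreover have "\<epsilon>\<^sup>2 \<le> 1" using assms by (simp add: power_le_one)
  ultimately show ?thesis using assms unfolding fun_bound_def by (simp add: le_divide_eq)
qed

lemma approx_step_bounds:
  assumes "0 < \<epsilon>" "\<epsilon> \<le> 1" "j \<in> {1..depth \<epsilon>}"
  shows "0 < real j * \<epsilon>\<^sup>2" "real j * \<epsilon>\<^sup>2 \<le> 1" "\<epsilon>\<^sup>2 \<le> real j * \<epsilon>\<^sup>2"
proof -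
  show "0 < real j * \<epsilon>\<^sup>2" "\<epsilon>\<^sup>2 \<le> real j * \<epsilon>\<^sup>2" using assms by auto
  have "real j * \<epsilon>\<^sup>2 \<le> real (depth \<epsilon>) * \<epsilon>\<^sup>2" using assms by (intro mult_right_mono) auto
  then show "real j * \<epsilon>\<^sup>2 \<le> 1" using depth_step_le[OF assms(1,2)] by linarith
qed

lemma mu_approx_fun_le:
  fixes i :: "nat \<times> ('a::euclidean_space \<Rightarrow> nat)"
  assumes e: "0 < \<epsilon>" "\<epsilon> \<le> 1" and i: "i \<in> approx_index \<epsilon>" and k: "l + q \<le> k"
  shows "mu (int q) (real l) (approx_fun \<epsilon> i) \<le> ennreal (fun_bound TYPE('a) \<epsilon> k ^ (l + q))"
proof -
  let ?s = "real (fst i) * \<epsilon>\<^sup>2"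
  have s: "0 < ?s" "?s \<le> 1" "\<epsilon>\<^sup>2 \<le> ?s" using approx_step_bounds[OF e, of "fst i"] i by auto
  have "mu (int q) (real l) (approx_fun \<epsilon> i) \<le>
      ennreal ((4 * (real DIM('a) + 1) * (real (trunc \<epsilon> + l + q) + 1) / ?s) ^ (l + q))"
    unfolding approx_fun_def using i by (intro mu_gauss_tensor_le s) (auto simp: PiE_def Pi_def)
  also have "\<dots> \<le> ennreal (fun_bound TYPE('a) \<epsilon> k ^ (l + q))"
    unfolding fun_bound_def using s e k
    by (intro ennreal_leI power_mono frac_le mult_left_mono) auto
  finally show ?thesis .
qed

lemma approx_fun_schwartz:
  "0 < \<epsilon> \<Longrightarrow> \<epsilon> \<le> 1 \<Longrightarrow> i \<in> approx_index \<epsilon> \<Longrightarrow> approx_fun \<epsilon> i \<in> schwartz"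
  unfolding approx_fun_def using approx_step_bounds[of \<epsilon> "fst i"] by (intro gauss_tensor_schwartz) auto

definition weight_bound :: "'a::euclidean_space itself \<Rightarrow> real \<Rightarrow> real" where
  "weight_bound _ \<epsilon> = (1 / \<epsilon>) ^ (1 + 2 * DIM('a)) / gauss_mass TYPE('a)"

lemma norm_approx_weight_le:
  assumes e: "0 < \<epsilon>" "\<epsilon> \<le> 1" and j: "j \<in> {1..depth \<epsilon>}"
  shows "norm (approx_weight TYPE('a::euclidean_space) \<epsilon> j) \<le> weight_bound TYPE('a) \<epsilon>"
proof -
  note s = approx_step_bounds[OF e j] and Z = gauss_mass_pos[where 'a = 'a]
  have "real (depth \<epsilon> choose j) \<le> 2 ^ depth \<epsilon>"
    using binomial_le_pow2[of "depth \<epsilon>" j] by (metis of_nat_le_iff of_nat_numeral of_nat_power)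
  then have c: "real (depth \<epsilon> choose j) \<le> 1 / \<epsilon>" using power_depth_le[OF e] by linarith
  have "norm (approx_weight TYPE('a) \<epsilon> j) = real (depth \<epsilon> choose j) / (gauss_mass TYPE('a) * (real j * \<epsilon>\<^sup>2) ^ DIM('a))"
    using s(1) Z by (simp add: approx_weight_def norm_divide norm_mult norm_power)
  also have "\<dots> \<le> (1 / \<epsilon>) / (gauss_mass TYPE('a) * (\<epsilon>\<^sup>2) ^ DIM('a))"
    using s Z c e by (intro frac_le mult_left_mono power_mono mult_pos_pos) auto
  also have "\<dots> = weight_bound TYPE('a) \<epsilon>"
    using e by (simp add: weight_bound_def power_mult[symmetric] power_divide mult_ac)
  finally show ?thesis .
qed

definition total_bound :: "'a::euclidean_space itself \<Rightarrow> real \<Rightarrow> nat \<Rightarrow> real" where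
  "total_bound _ \<epsilon> k = real (card (approx_index \<epsilon> :: (nat \<times> ('a \<Rightarrow> nat)) set)) * weight_bound TYPE('a) \<epsilon> * fun_bound TYPE('a) \<epsilon> k ^ k"

lemma weight_bound_nonneg: "0 < \<epsilon> \<Longrightarrow> 0 \<le> weight_bound TYPE('a::euclidean_space) \<epsilon>"
  using gauss_mass_pos[where 'a = 'a] by (simp add: weight_bound_def)

text \<open>Everything is polynomial in 1/\<epsilon>, including the number of summands. The exponent
  consists of 1 + 6 n for the index set, 1 + 2 n for the weights, where \<open>n\<close> is the
  dimension, and 8 = 6 + 2 for each of the \<open>k\<close> factors
  \<open>fun_bound\<close>.\<close>

lemma total_bound_moderate:
  obtains C N where "0 \<le> C"
    "\<And>\<epsilon>. 0 < \<epsilon> \<Longrightarrow> \<epsilon> \<le> 1 \<Longrightarrow> total_bound TYPE('a::euclidean_space) \<epsilon> k \<le> C * (1 / \<epsilon>) ^ N"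
proof -
  let ?n = "DIM('a)" and ?Z = "gauss_mass TYPE('a)"
  note Z = gauss_mass_pos[where 'a = 'a]
  define A where "A = 4 * (real ?n + 1) * (real k + 3)"
  show ?thesis
  proof (rule that[of "3 ^ ?n * (1 / ?Z) * A ^ k" "1 + 6 * ?n + (1 + 2 * ?n) + 8 * k"])
    show "0 \<le> 3 ^ ?n * (1 / ?Z) * A ^ k" using Z by (simp add: A_def)
    fix \<epsilon> :: real assume e: "0 < \<epsilon>" "\<epsilon> \<le> 1"
    define x where "x = 1 / \<epsilon>"
    have x: "1 \<le> x" unfolding x_def using e by simp
    have x6: "1 \<le> x ^ 6" using x by (rule one_le_power)
    have t: "real (trunc \<epsilon>) \<le> 2 * x ^ 6" using trunc_bounds[OF e] by (simp add: x_def)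
    have "real (card (approx_index \<epsilon> :: (nat \<times> ('a \<Rightarrow> nat)) set)) = real (depth \<epsilon>) * (real (trunc \<epsilon>) + 1) ^ ?n"
      by (simp add: card_cartesian_product card_index_box add.commute)
    also have "\<dots> \<le> x * (3 * x ^ 6) ^ ?n"
    proof (intro mult_mono power_mono)
      show "real (depth \<epsilon>) \<le> x" using depth_le[OF e] by (simp add: x_def)
      show "real (trunc \<epsilon>) + 1 \<le> 3 * x ^ 6" using t x6 by linarith
    qed (use x in auto)
    finally have c: "real (card (approx_index \<epsilon> :: (nat \<times> ('a \<Rightarrow> nat)) set)) \<le> x * (3 * x ^ 6) ^ ?n" .
    have f: "fun_bound TYPE('a) \<epsilon> k \<le> A * x ^ 8"
    proof -
      have kx: "real k \<le> real k * x ^ 6" using x6 mult_left_mono[of 1 "x ^ 6" "real k"] by simp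
      have "real (trunc \<epsilon> + k) + 1 \<le> (real k + 3) * x ^ 6"
        using t x6 kx by (simp add: distrib_right)
      then have "4 * (real ?n + 1) * (real (trunc \<epsilon> + k) + 1) / \<epsilon>\<^sup>2 \<le> 4 * (real ?n + 1) * ((real k + 3) * x ^ 6) / \<epsilon>\<^sup>2"
        using e by (intro divide_right_mono mult_left_mono) auto
      also have "\<dots> = A * (x ^ 6 * x ^ 2)" by (simp add: A_def x_def power_divide)
      finally show ?thesis by (simp add: fun_bound_def power_add[symmetric])
    qed
    have f0: "0 \<le> fun_bound TYPE('a) \<epsilon> k" using fun_bound_ge_1[OF e, where 'a = 'a, of k] by linarith
    have "total_bound TYPE('a) \<epsilon> k \<le> (x * (3 * x ^ 6) ^ ?n) * (x ^ (1 + 2 * ?n) / ?Z) * (A * x ^ 8) ^ k"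
      unfolding total_bound_def weight_bound_def x_def[symmetric]
      using c f f0 x Z by (intro mult_mono power_mono) auto
    also have "\<dots> = (3 ^ ?n * (1 / ?Z) * A ^ k) * (x ^ 1 * x ^ (6 * ?n) * x ^ (1 + 2 * ?n) * x ^ (8 * k))"
      unfolding power_mult_distrib power_mult[of x 6] power_mult[of x 8] by simp
    also have "\<dots> = (3 ^ ?n * (1 / ?Z) * A ^ k) * x ^ (1 + 6 * ?n + (1 + 2 * ?n) + 8 * k)"
      by (simp only: power_add)
    finally show "total_bound TYPE('a) \<epsilon> k \<le> 3 ^ ?n * (1 / ?Z) * A ^ k * (1 / \<epsilon>) ^ (1 + 6 * ?n + (1 + 2 * ?n) + 8 * k)"
      by (simp add: x_def)
  qed
qed

lemma bigO_total_bound: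
  assumes "0 \<le> C"
  shows "\<exists>N::nat. bigO_eps (\<lambda>\<epsilon>. ennreal (total_bound TYPE('a::euclidean_space) \<epsilon> k * (C * \<epsilon> powr s))) (s - real N)"
proof -
  obtain D N where D: "0 \<le> D" "\<And>\<epsilon>. 0 < \<epsilon> \<Longrightarrow> \<epsilon> \<le> 1 \<Longrightarrow> total_bound TYPE('a) \<epsilon> k \<le> D * (1 / \<epsilon>) ^ N"
    using total_bound_moderate by blast
  have "\<forall>\<^sub>F \<epsilon> in at_right 0. ennreal (total_bound TYPE('a) \<epsilon> k * (C * \<epsilon> powr s)) \<le> ennreal (D * C * \<epsilon> powr (s - real N))"
    using eventually_at_right_less[OF zero_less_one]
  proof eventually_elim
    case (elim \<epsilon>)
    then have "total_bound TYPE('a) \<epsilon> k * (C * \<epsilon> powr s) \<le> D * (1 / \<epsilon>) ^ N * (C * \<epsilon> powr s)"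
      using assms D(2) by (intro mult_right_mono) auto
    also have "\<dots> = D * C * \<epsilon> powr (s - real N)"
    proof -
      have "(1 / \<epsilon>) ^ N * \<epsilon> powr s = \<epsilon> powr (s - real N)"
        using elim inverse_power_powr[of \<epsilon> N] powr_add[of \<epsilon> "- real N" s] by simp
      then show ?thesis by (metis mult.assoc mult.left_commute)
    qed
    finally show ?case by (rule ennreal_leI)
  qed
  then show ?thesis unfolding bigO_eps_def using assms D(1) by (intro exI[of _ N] exI[of _ "D * C"]) auto
qed

section \<open>Approximation of regular nets\<close>

lemma approx_op_schwartz: "0 < \<epsilon> \<Longrightarrow> \<epsilon> \<le> 1 \<Longrightarrow> approx_op \<epsilon> f \<in> schwartz"
  unfolding approx_op_def[abs_def] by (intro schwartz_sum finite_approx_index approx_fun_schwartz)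

text \<open>Derivatives and weights fall on the functions \<open>approx_fun\<close> alone, so
  \<open>f\<close> enters only through its coefficients and thus through one seminorm of order zero.
  Hence \<open>approx_op\<close> preserves moderateness of every net, regular or not.\<close>

lemma mu_approx_op_le:
  fixes f :: "'a::euclidean_space \<Rightarrow> complex"
  assumes e: "0 < \<epsilon>" "\<epsilon> \<le> 1" and f: "f \<in> schwartz"
    and B: "0 \<le> B" "mu (int (DIM('a) + 2)) (real 0) f \<le> ennreal B"
  shows "mu (int q) (real l) (approx_op \<epsilon> f) \<le>
    ennreal (total_bound TYPE('a) \<epsilon> (l + q) * (B * weight_integral TYPE('a)))"
proof -
  let ?W = "weight_integral TYPE('a)" and ?w = "weight_bound TYPE('a) \<epsilon>" and ?F = "fun_bound TYPE('a) \<epsilon> (l + q)"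
  have W: "0 \<le> ?W" by (rule weight_integral_nonneg)
  have Bf: "(1 + norm y) ^ (0 + (DIM('a) + 2)) * norm (f y) \<le> B" for y
    using B(2) mu_pos_le_ennreal_iff[OF schwartz_smooth[OF f] B(1), of "DIM('a) + 2" 0] by (auto dest: spec[of _ "[]"])
  have "mu (int q) (real l) (approx_op \<epsilon> f) \<le>
      ennreal (real (card (approx_index \<epsilon> :: (nat \<times> ('a \<Rightarrow> nat)) set)) * (?w * (B * ?W)) * ?F ^ (l + q))"
    unfolding approx_op_def[abs_def]
  proof (rule mu_sum_le[OF finite_approx_index])
    fix i :: "nat \<times> ('a \<Rightarrow> nat)" assume i: "i \<in> approx_index \<epsilon>"
    show s: "smooth (approx_fun \<epsilon> i)" using approx_fun_schwartz[OF e i] by (rule schwartz_smooth)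
    show "mu (int q) (real l) (approx_fun \<epsilon> i) \<le> ennreal (?F ^ (l + q))" by (rule mu_approx_fun_le[OF e i order_refl])
    have "norm (\<integral>y. approx_fun \<epsilon> i y * f y \<partial>lborel) \<le> 1 * B * ?W"
      by (rule kernel_int_weight_bound(2)[where q = 0, OF smooth_continuous_on[OF s]
            smooth_continuous_on[OF schwartz_smooth[OF f]] _ _ Bf])
        (simp_all add: approx_fun_def norm_gauss_tensor_le)
    then show "norm (approx_weight TYPE('a) \<epsilon> (fst i) * (\<integral>y. approx_fun \<epsilon> i y * f y \<partial>lborel)) \<le> ?w * (B * ?W)"
      unfolding norm_mult using i e B(1) W by (intro mult_mono norm_approx_weight_le weight_bound_nonneg) auto
  qed (use e B(1) W weight_bound_nonneg[of \<epsilon>, where 'a = 'a] fun_bound_ge_1[OF e, of "l + q", where 'a = 'a]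
        in simp_all)
  then show ?thesis by (simp add: total_bound_def mult_ac)
qed

lemma approx_op_E_S:
  fixes f :: "'a::euclidean_space fnet"
  assumes f: "f \<in> E_S"
  shows "(\<lambda>\<epsilon>. approx_op \<epsilon> (f \<epsilon>)) \<in> E_S"
  unfolding E_S_def
proof (intro CollectI conjI ballI allI)
  show "approx_op \<epsilon> (f \<epsilon>) \<in> schwartz" if "\<epsilon> \<in> {0<..1}" for \<epsilon>
    using that by (intro approx_op_schwartz) auto
  fix q l :: nat
  obtain M where "bigO_eps (\<lambda>\<epsilon>. mu (int (DIM('a) + 2)) (real 0) (f \<epsilon>)) (- real M)"
    using f unfolding E_S_def by blast
  then obtain B where B: "0 \<le> B" "\<forall>\<^sub>F \<epsilon> in at_right 0. mu (int (DIM('a) + 2)) (real 0) (f \<epsilon>) \<le> ennreal (B * \<epsilon> powr (- real M))"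
    unfolding bigO_eps_def by blast
  let ?W = "weight_integral TYPE('a)"
  have "0 \<le> B * ?W" using B(1) weight_integral_nonneg[where 'a = 'a] by simp
  from bigO_total_bound[OF this, of "l + q" "- real M", where 'a = 'a]
  obtain N where N: "bigO_eps (\<lambda>\<epsilon>. ennreal (total_bound TYPE('a) \<epsilon> (l + q) * (B * ?W * \<epsilon> powr (- real M)))) (- real M - real N)"
    by blast
  have ev: "\<forall>\<^sub>F \<epsilon> in at_right 0. mu (int q) (real l) (approx_op \<epsilon> (f \<epsilon>)) \<le>
      ennreal (total_bound TYPE('a) \<epsilon> (l + q) * (B * ?W * \<epsilon> powr (- real M)))"
    using B(2) eventually_at_right_less[OF zero_less_one]
  proof eventually_elim
    case (elim \<epsilon>)
    then have "f \<epsilon> \<in> schwartz" using f unfolding E_S_def by auto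
    then have "mu (int q) (real l) (approx_op \<epsilon> (f \<epsilon>)) \<le>
        ennreal (total_bound TYPE('a) \<epsilon> (l + q) * ((B * \<epsilon> powr (- real M)) * ?W))"
      using elim B(1) by (intro mu_approx_op_le) auto
    then show ?case by (simp add: mult_ac)
  qed
  have "bigO_eps (\<lambda>\<epsilon>. mu (int q) (real l) (approx_op \<epsilon> (f \<epsilon>))) (- real (M + N))"
    by (rule bigO_eps_mono[OF N _ ev]) simp
  then show "\<exists>N. bigO_eps (\<lambda>\<epsilon>. mu (int q) (real l) (approx_op \<epsilon> (f \<epsilon>))) (- real N)" by blast
qed

text \<open>This is where \<open>a \<le> 1\<close> enters: a limit 0, or a limit superior below
  \<open>a\<close>, brings the quotients eventually below 1.\<close>

lemma seq_set_eventually_le: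
  assumes "N \<in> seq_set a" "0 \<le> a" "a \<le> 1"
  shows "\<forall>\<^sub>F l in sequentially. N l \<le> real l"
proof -
  have "\<forall>\<^sub>F l in sequentially. N l / real l < 1"
  proof (cases "a = 0")
    case True
    then have "(\<lambda>l. N l / real l) \<longlonglongrightarrow> 0" using assms(1) by (simp add: seq_set_def)
    then show ?thesis by (rule order_tendstoD) simp
  next
    case False
    then have "limsup (\<lambda>l. ereal (N l / real l)) < ereal a" using assms(1) by (simp add: seq_set_def)
    also have "ereal a \<le> ereal 1" using assms(3) by simp
    finally have "\<forall>\<^sub>F l in sequentially. ereal (N l / real l) < ereal 1" by (rule Limsup_lessD)
    then show ?thesis by simp
  qed
  with eventually_gt_at_top[of 0] show ?thesis
    by eventually_elim (simp add: divide_less_eq)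
qed

lemma approx_op_order_zero:
  fixes f :: "'a::euclidean_space fnet"
  assumes f: "f \<in> E_S_reg a" and a: "0 \<le> a" "a \<le> 1"
  shows "bigO_eps (\<lambda>\<epsilon>. mu (int q) 0 (\<lambda>u. f \<epsilon> u - approx_op \<epsilon> (f \<epsilon>) u)) (real p)"
proof -
  have fE: "f \<in> E_S" using f unfolding E_S_reg_def by blast
  obtain N where N: "N \<in> seq_set a" "\<And>q l::nat. bigO_eps (\<lambda>\<epsilon>. mu (int q) (real l) (f \<epsilon>)) (- N l)"
    using f unfolding E_S_reg_def by blast
  let ?n = "DIM('a)"
  \<comment> \<open>The exponent \<open>N 0\<close> does not depend on the weight, so
    \<open>M\<close> is fixed before \<open>r\<close>, although the weight \<open>?Q\<close> used
    with it grows with \<open>r\<close>.\<close>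
  define M where "M = nat \<lceil>N 0\<rceil>"
  have M: "N 0 \<le> real M" unfolding M_def by linarith
  \<comment> \<open>The exponents to be brought above \<open>p\<close> are -1 + 2 r - N r, at least
    r - 1, for the regularization, and 2 r - 1 - 2 n - 2 q - N 0 for the truncation.\<close>
  obtain r where r: "N r \<le> real r" "p + 1 \<le> r" "1 + 2 * ?n + 2 * q + M + p \<le> r"
    using eventually_conj[OF seq_set_eventually_le[OF N(1) a] eventually_ge_at_top[of "(p + 1) + (1 + 2 * ?n + 2 * q + M + p)"]]
    unfolding eventually_sequentially by (metis (no_types, lifting) add_leE le_refl)
  let ?Q = "2 * r + q + (?n + 2)"
  obtain F where F: "0 \<le> F" "\<forall>\<^sub>F \<epsilon> in at_right 0. mu (int q) (real r) (f \<epsilon>) \<le> ennreal (F * \<epsilon> powr (- N r))"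
    using N(2)[of q r] unfolding bigO_eps_def by blast
  obtain G where G: "0 \<le> G" "\<forall>\<^sub>F \<epsilon> in at_right 0. mu (int ?Q) (real 0) (f \<epsilon>) \<le> ennreal (G * \<epsilon> powr (- N 0))"
    using N(2)[of ?Q 0] unfolding bigO_eps_def by blast
  obtain C where C: "0 \<le> C"
    "\<And>(g :: 'a \<Rightarrow> complex) \<sigma> m K F G u. g \<in> schwartz \<Longrightarrow> 0 < \<sigma> \<Longrightarrow> real m * \<sigma> \<le> 1 \<Longrightarrow> r \<le> m \<Longrightarrow> 2 * r \<le> K \<Longrightarrow> 1 \<le> K \<Longrightarrow>
      0 \<le> F \<Longrightarrow> mu (int q) (real r) g \<le> ennreal F \<Longrightarrow>
      0 \<le> G \<Longrightarrow> mu (int ?Q) 0 g \<le> ennreal G \<Longrightarrow>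
      (1 + norm u) ^ q * norm (g u - gauss_approx \<sigma> m K g u) \<le>
        C * (2 ^ m * \<sigma> ^ r * F + 2 ^ m * (1 / \<sigma>) ^ (?n + 2 * r + q) * (1 / real K) ^ r * G)"
    using gauss_approx_error[where ?'a = 'a and r = r and q = q] by blast
  have "\<forall>\<^sub>F \<epsilon> in at_right 0. mu (int q) 0 (\<lambda>u. f \<epsilon> u - approx_op \<epsilon> (f \<epsilon>) u) \<le> ennreal (C * (F + G) * \<epsilon> powr real p)"
    \<comment> \<open>Below this threshold 1/\<epsilon> is at least 2^(2r), which brings both
      \<open>r\<close> below \<open>depth \<epsilon>\<close> and \<open>2 * r\<close> below
      \<open>trunc \<epsilon>\<close>.\<close>
    using F(2) G(2) eventually_at_right_less[of "1 / 2 ^ (2 * r)", simplified] eventually_at_right_less[OF zero_less_one]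
  proof eventually_elim
    case (elim \<epsilon>)
    then have e: "0 < \<epsilon>" "\<epsilon> \<le> 1" and small: "2 ^ (2 * r) \<le> 1 / \<epsilon>"
      by (auto simp: field_simps)
    have fs: "f \<epsilon> \<in> schwartz" using fE e unfolding E_S_def by auto
    let ?m = "depth \<epsilon>" and ?K = "trunc \<epsilon>"
    have "(2::real) ^ r \<le> 2 ^ (2 * r)" by (rule power_increasing) auto
    then have rm: "r \<le> ?m" using small by (intro le_depth e) linarith
    have "real (2 * r) < 2 ^ (2 * r)" using of_nat_less_two_power[of "2 * r"] by simp
    then have K: "2 * r \<le> ?K" using small trunc_bounds(3)[OF e] by linarith
    have K1: "1 \<le> ?K" using trunc_bounds(3)[OF e] e by (cases ?K) (auto simp: field_simps)
    have m2: "2 ^ ?m \<le> \<epsilon> powr (- 1)" using power_depth_le[OF e] e by (simp add: powr_minus_divide)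
    have s: "(\<epsilon>\<^sup>2) ^ k = \<epsilon> powr (2 * real k)" for k
      using e powr_realpow[of \<epsilon> "2 * k"] by (simp add: power_mult[symmetric])
    have s': "(1 / \<epsilon>\<^sup>2) ^ k = \<epsilon> powr (- 2 * real k)" for k
      using s[of k] by (simp add: power_one_over powr_minus_divide)
    have Kr: "(1 / real ?K) ^ r \<le> \<epsilon> powr (6 * real r)"
    proof -
      have "(1 / real ?K) ^ r \<le> (1 / (1 / \<epsilon>) ^ 6) ^ r"
        using trunc_bounds(1)[OF e] e K1 by (intro power_mono divide_left_mono) auto
      also have "\<dots> = \<epsilon> ^ (6 * r)" by (simp add: power_one_over power_mult)
      also have "\<dots> = \<epsilon> powr (6 * real r)" using e powr_realpow[of \<epsilon> "6 * r"] by simp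
      finally show ?thesis .
    qed
    have le: "\<epsilon> powr x \<le> \<epsilon> powr real p" if "real p \<le> x" for x
      using e that by (intro powr_mono') auto
    have t1: "2 ^ ?m * (\<epsilon>\<^sup>2) ^ r * (F * \<epsilon> powr (- N r)) \<le> F * \<epsilon> powr real p"
    proof -
      have "2 ^ ?m * (\<epsilon>\<^sup>2) ^ r * (F * \<epsilon> powr (- N r)) \<le> \<epsilon> powr (- 1) * (\<epsilon>\<^sup>2) ^ r * (F * \<epsilon> powr (- N r))"
        using m2 F(1) by (intro mult_right_mono) auto
      also have "\<dots> = F * (\<epsilon> powr (- 1) * \<epsilon> powr (2 * real r) * \<epsilon> powr (- N r))" unfolding s by (simp only: mult_ac)
      also have "\<dots> = F * \<epsilon> powr (- 1 + 2 * real r + - N r)" by (simp only: powr_add)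
      also have "\<dots> \<le> F * \<epsilon> powr real p" using F(1) r by (intro mult_left_mono le) auto
      finally show ?thesis .
    qed
    have t2: "2 ^ ?m * (1 / \<epsilon>\<^sup>2) ^ (?n + 2 * r + q) * (1 / real ?K) ^ r * (G * \<epsilon> powr (- N 0)) \<le> G * \<epsilon> powr real p"
    proof -
      have "2 ^ ?m * (1 / \<epsilon>\<^sup>2) ^ (?n + 2 * r + q) * (1 / real ?K) ^ r * (G * \<epsilon> powr (- N 0)) \<le>
          \<epsilon> powr (- 1) * (1 / \<epsilon>\<^sup>2) ^ (?n + 2 * r + q) * \<epsilon> powr (6 * real r) * (G * \<epsilon> powr (- N 0))"
        using m2 Kr G(1) by (intro mult_right_mono mult_mono) auto
      also have "\<dots> = G * (\<epsilon> powr (- 1) * \<epsilon> powr (- 2 * real (?n + 2 * r + q)) * \<epsilon> powr (6 * real r) * \<epsilon> powr (- N 0))"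
        unfolding s' by (simp only: mult_ac)
      also have "\<dots> = G * \<epsilon> powr (- 1 + - 2 * real (?n + 2 * r + q) + 6 * real r + - N 0)" by (simp only: powr_add)
      also have "\<dots> \<le> G * \<epsilon> powr real p"
      proof (intro mult_left_mono le G(1))
        have "real (1 + 2 * ?n + 2 * q + M + p) \<le> real r" using r(3) by (simp only: of_nat_le_iff)
        then show "real p \<le> - 1 + - 2 * real (?n + 2 * r + q) + 6 * real r + - N 0" using M by simp
      qed
      finally show ?thesis .
    qed
    have "(1 + norm u) ^ q * norm (f \<epsilon> u - approx_op \<epsilon> (f \<epsilon>) u) \<le> C * (F + G) * \<epsilon> powr real p" for u
    proof -
      have "(1 + norm u) ^ q * norm (f \<epsilon> u - approx_op \<epsilon> (f \<epsilon>) u) \<le>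
          C * (2 ^ ?m * (\<epsilon>\<^sup>2) ^ r * (F * \<epsilon> powr (- N r)) +
            2 ^ ?m * (1 / \<epsilon>\<^sup>2) ^ (?n + 2 * r + q) * (1 / real ?K) ^ r * (G * \<epsilon> powr (- N 0)))"
        unfolding approx_op_eq_gauss_approx
        using e elim(1,2) F(1) G(1) rm K K1 fs depth_step_le[OF e] by (intro C(2)) auto
      also have "\<dots> \<le> C * (F * \<epsilon> powr real p + G * \<epsilon> powr real p)"
        by (intro mult_left_mono add_mono t1 t2 C(1))
      finally show ?thesis by (simp add: algebra_simps)
    qed
    moreover have "smooth (\<lambda>u. f \<epsilon> u - approx_op \<epsilon> (f \<epsilon>) u)"
      using smooth_lincomb[OF schwartz_smooth[OF fs] schwartz_smooth[OF approx_op_schwartz[OF e]], of 1 "- 1"] by simp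
    ultimately show ?case
      using mu_pos_le_ennreal_iff[of "\<lambda>u. f \<epsilon> u - approx_op \<epsilon> (f \<epsilon>) u" "C * (F + G) * \<epsilon> powr real p" q 0] C(1) F(1) G(1)
      by simp
  qed
  then show ?thesis unfolding bigO_eps_def using C(1) F(1) G(1) by (intro exI[of _ "C * (F + G)"]) auto
qed

lemma approx_op_rel_S:
  fixes f :: "'a::euclidean_space fnet"
  assumes f: "f \<in> E_S_reg a" and a: "0 \<le> a" "a \<le> 1"
  shows "(f, \<lambda>\<epsilon>. approx_op \<epsilon> (f \<epsilon>)) \<in> rel_S"
proof -
  have fE: "f \<in> E_S" using f unfolding E_S_reg_def by blast
  note AE = approx_op_E_S[OF fE]
  let ?d = "\<lambda>\<epsilon> u. f \<epsilon> u - approx_op \<epsilon> (f \<epsilon>) u"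
  have dE: "?d \<in> E_S" by (rule E_S_minus[OF fE AE])
  have "?d \<in> N_S"
    unfolding N_S_def
  proof (intro CollectI conjI ballI allI)
    have ds: "?d \<epsilon> \<in> schwartz" if "\<epsilon> \<in> {0<..1}" for \<epsilon> using dE that unfolding E_S_def by blast
    then show "?d \<epsilon> \<in> schwartz" if "\<epsilon> \<in> {0<..1}" for \<epsilon> using that by blast
    fix q l p :: nat
    have mod: "\<exists>N::nat. bigO_eps (\<lambda>\<epsilon>. mu (int q) (real l) (?d \<epsilon>)) (- real N)" for l
      using dE unfolding E_S_def by blast
    show "bigO_eps (\<lambda>\<epsilon>. mu (int q) (real l) (?d \<epsilon>)) (real p)"
      by (rule negligible_of_order_zero[OF schwartz_smooth[OF ds] mod approx_op_order_zero[OF f a]])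
  qed
  then show ?thesis using fE AE unfolding rel_S_def by blast
qed

section \<open>The kernel\<close>

definition finite_rank_kernel ::
  "(('a::euclidean_space \<Rightarrow> complex) \<Rightarrow> 'b::euclidean_space \<Rightarrow> complex) \<Rightarrow> real \<Rightarrow> 'b \<times> 'a \<Rightarrow> complex" where
  "finite_rank_kernel S \<epsilon> z = (\<Sum>i\<in>approx_index \<epsilon>.
     approx_weight TYPE('a) \<epsilon> (fst i) * tensor (S (approx_fun \<epsilon> i)) (approx_fun \<epsilon> i) z)"

lemma finite_rank_kernel_mult_space:
  assumes "S \<in> cont_linear_maps" "0 < \<epsilon>" "\<epsilon> \<le> 1"
  shows "finite_rank_kernel S \<epsilon> \<in> mult_space"
  unfolding finite_rank_kernel_def[abs_def]
  using assms
  by (intro mult_space_sum finite_approx_index tensor_mult_space cont_linear_maps_mem[OF assms(1)]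
      schwartz_imp_mult_space approx_fun_schwartz)

lemma cont_linear_sum:
  fixes S :: "('a::euclidean_space \<Rightarrow> complex) \<Rightarrow> 'b::euclidean_space \<Rightarrow> complex"
  assumes S: "S \<in> cont_linear_maps" and "finite I" "\<And>i. i \<in> I \<Longrightarrow> f i \<in> schwartz"
  shows "S (\<lambda>x. \<Sum>i\<in>I. z i * f i x) = (\<lambda>y. \<Sum>i\<in>I. z i * S (f i) y)"
  using assms(2,3)
proof (induction I)
  case empty
  have "(\<lambda>x::'a. 0) \<in> schwartz" using schwartz_sum[of "{}" _ "\<lambda>_. 0"] by simp
  from cont_linear_lincomb[OF S this this, of 0 0] show ?case by simp
next
  case (insert i I)
  then have "f i \<in> schwartz" "(\<lambda>x. \<Sum>i\<in>I. z i * f i x) \<in> schwartz" by (auto intro: schwartz_sum)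
  from cont_linear_lincomb[OF S this, of "z i" 1] show ?case using insert by simp
qed

lemma kernel_int_finite_rank_kernel:
  fixes S :: "('a::euclidean_space \<Rightarrow> complex) \<Rightarrow> 'b::euclidean_space \<Rightarrow> complex"
  assumes S: "S \<in> cont_linear_maps" and e: "0 < \<epsilon>" "\<epsilon> \<le> 1" and f: "f \<in> schwartz"
  shows "kernel_int (finite_rank_kernel S \<epsilon>) f = S (approx_op \<epsilon> f)"
proof
  fix x
  have int: "integrable lborel (\<lambda>y. approx_fun \<epsilon> i y * f y)" for i :: "nat \<times> ('a \<Rightarrow> nat)"
    unfolding approx_fun_def by (rule gauss_tensor_integrable[OF f])
  have "kernel_int (finite_rank_kernel S \<epsilon>) f x = (\<integral>y. (\<Sum>i\<in>approx_index \<epsilon>.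
      (approx_weight TYPE('a) \<epsilon> (fst i) * S (approx_fun \<epsilon> i) x) * (approx_fun \<epsilon> i y * f y)) \<partial>lborel)"
    unfolding kernel_int_def finite_rank_kernel_def tensor_def sum_distrib_right fst_conv snd_conv by (simp only: mult_ac)
  also have "\<dots> = (\<Sum>i\<in>approx_index \<epsilon>.
      (approx_weight TYPE('a) \<epsilon> (fst i) * S (approx_fun \<epsilon> i) x) * (\<integral>y. approx_fun \<epsilon> i y * f y \<partial>lborel))"
    by (subst Bochner_Integration.integral_sum) (rule integrable_mult_right, rule int, simp only: integral_mult_right_zero)
  also have "\<dots> = S (approx_op \<epsilon> f) x"
    unfolding approx_op_def[abs_def]
    by (subst cont_linear_sum[OF S finite_approx_index approx_fun_schwartz[OF e]]) (simp_all only: mult_ac)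
  finally show "kernel_int (finite_rank_kernel S \<epsilon>) f x = S (approx_op \<epsilon> f) x" .
qed

text \<open>The functions \<open>approx_fun\<close> change with \<epsilon> and their number is
  unbounded as \<epsilon> tends to 0, so the estimate of \<open>T\<close> must hold for all
  \<open>f\<close> below a common threshold. For fixed \<open>l\<close> it involves finitely many
  derivatives, each costing one moderate factor \<open>fun_bound\<close>.\<close>

lemma finite_rank_kernel_E_tau:
  fixes T :: "real \<Rightarrow> ('a::euclidean_space \<Rightarrow> complex) \<Rightarrow> 'b::euclidean_space \<Rightarrow> complex"
  assumes T: "\<forall>\<epsilon>\<in>{0<..1}. T \<epsilon> \<in> cont_linear_maps" and sm: "strongly_moderate b c T"
  shows "(\<lambda>\<epsilon>. finite_rank_kernel (T \<epsilon>) \<epsilon>) \<in> E_tau"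
  unfolding E_tau_def
proof (intro CollectI conjI ballI allI)
  show "finite_rank_kernel (T \<epsilon>) \<epsilon> \<in> mult_space" if "\<epsilon> \<in> {0<..1}" for \<epsilon>
    using T that by (intro finite_rank_kernel_mult_space) auto
  fix l :: nat
  obtain lam r where "\<forall>l::nat. \<exists>C\<ge>0. \<exists>p q::nat. \<forall>\<^sub>F \<epsilon> in at_right 0. \<forall>f\<in>schwartz.
       mu (- int p) (real l) (T \<epsilon> f) \<le> ennreal (C * \<epsilon> powr (- r l)) * mu (int q) (lam l) f"
    using sm unfolding strongly_moderate_def by (elim bexE)
  then obtain C p q where C: "0 \<le> C" and ev: "\<forall>\<^sub>F \<epsilon> in at_right 0. \<forall>f\<in>schwartz.
       mu (- int p) (real l) (T \<epsilon> f) \<le> ennreal (C * \<epsilon> powr (- r l)) * mu (int q) (lam l) f"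
    by meson
  define d where "d = nat \<lceil>lam l\<rceil>"
  have d: "lam l \<le> real d" unfolding d_def by linarith
  \<comment> \<open>\<open>d + q\<close> factors for the function inside \<open>T\<close>, with its
    order \<open>lam l\<close> rounded up to \<open>d\<close> and the weight \<open>q\<close>, and
    \<open>l\<close> factors for the second tensor factor.\<close>
  define k where "k = (d + q) + l"
  have bound: "\<forall>\<^sub>F \<epsilon> in at_right 0. mu (- int p) (real l) (finite_rank_kernel (T \<epsilon>) \<epsilon>) \<le>
      ennreal (total_bound TYPE('a) \<epsilon> k * (C * \<epsilon> powr (- r l)))"
    using ev eventually_at_right_less[OF zero_less_one]
  proof eventually_elim
    case (elim \<epsilon>)
    then have e: "0 < \<epsilon>" "\<epsilon> \<le> 1" and Te: "T \<epsilon> \<in> cont_linear_maps" using T by auto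
    let ?F = "fun_bound TYPE('a) \<epsilon> k" and ?c = "C * \<epsilon> powr (- r l)"
    have F: "1 \<le> ?F" by (rule fun_bound_ge_1[OF e])
    have c: "0 \<le> ?c" using C by simp
    have "mu (- int p) (real l) (finite_rank_kernel (T \<epsilon>) \<epsilon>) \<le>
        ennreal (real (card (approx_index \<epsilon> :: (nat \<times> ('a \<Rightarrow> nat)) set)) * weight_bound TYPE('a) \<epsilon> * (?c * ?F ^ k))"
      unfolding finite_rank_kernel_def[abs_def]
    proof (rule mu_sum_le[OF finite_approx_index])
      fix i :: "nat \<times> ('a \<Rightarrow> nat)" assume i: "i \<in> approx_index \<epsilon>"
      note S = approx_fun_schwartz[OF e i]
      have Ts: "smooth (T \<epsilon> (approx_fun \<epsilon> i))" by (rule mult_space_smooth[OF cont_linear_maps_mem[OF Te S]])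
      show "smooth (tensor (T \<epsilon> (approx_fun \<epsilon> i)) (approx_fun \<epsilon> i))"
        by (rule smooth_tensor[OF Ts schwartz_smooth[OF S]])
      show "norm (approx_weight TYPE('a) \<epsilon> (fst i)) \<le> weight_bound TYPE('a) \<epsilon>"
        using i by (intro norm_approx_weight_le e) auto
      have "mu (- int p) (real l) (T \<epsilon> (approx_fun \<epsilon> i)) \<le> ennreal ?c * mu (int q) (lam l) (approx_fun \<epsilon> i)"
        using elim(1) S by blast
      also have "\<dots> \<le> ennreal ?c * ennreal (?F ^ (d + q))"
      proof (rule mult_left_mono)
        have "mu (int q) (lam l) (approx_fun \<epsilon> i) \<le> mu (int q) (real d) (approx_fun \<epsilon> i)" by (rule mu_mono[OF order_refl d])
        also have "\<dots> \<le> ennreal (?F ^ (d + q))" by (rule mu_approx_fun_le[OF e i]) (simp add: k_def)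
        finally show "mu (int q) (lam l) (approx_fun \<epsilon> i) \<le> ennreal (?F ^ (d + q))" .
      qed simp
      also have "\<dots> = ennreal (?c * ?F ^ (d + q))" using c F by (simp add: ennreal_mult)
      finally have 1: "mu (- int p) (real l) (T \<epsilon> (approx_fun \<epsilon> i)) \<le> ennreal (?c * ?F ^ (d + q))" .
      \<comment> \<open>A rapidly decreasing factor is bounded with growth exponent 0, so the tensor
        product keeps the exponent \<open>p\<close> of \<open>T\<close>.\<close>
      have 2: "mu (- int 0) (real l) (approx_fun \<epsilon> i) \<le> ennreal (?F ^ (l + 0))"
        using mu_approx_fun_le[OF e i, of l 0 k] by (simp add: k_def)
      have "mu (- int (p + 0)) (real l) (tensor (T \<epsilon> (approx_fun \<epsilon> i)) (approx_fun \<epsilon> i)) \<le>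
          ennreal (?c * ?F ^ (d + q) * ?F ^ (l + 0))"
        using c F by (intro mu_tensor_le Ts schwartz_smooth[OF S] 1 2) auto
      then show "mu (- int p) (real l) (tensor (T \<epsilon> (approx_fun \<epsilon> i)) (approx_fun \<epsilon> i)) \<le> ennreal (?c * ?F ^ k)"
        by (simp add: k_def power_add mult_ac)
    qed (use c F e weight_bound_nonneg[of \<epsilon>, where 'a = 'a] in simp_all)
    then show ?case by (simp add: total_bound_def mult_ac)
  qed
  obtain N where N: "bigO_eps (\<lambda>\<epsilon>. ennreal (total_bound TYPE('a) \<epsilon> k * (C * \<epsilon> powr (- r l)))) (- r l - real N)"
    using bigO_total_bound[OF C] by blast
  have "bigO_eps (\<lambda>\<epsilon>. mu (- int p) (real l) (finite_rank_kernel (T \<epsilon>) \<epsilon>)) (- real (N + nat \<lceil>r l\<rceil>))"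
    by (rule bigO_eps_mono[OF N _ bound]) (use real_nat_ceiling_ge[of "r l"] in simp)
  then show "\<exists>q N. bigO_eps (\<lambda>\<epsilon>. mu (- int q) (real l) (finite_rank_kernel (T \<epsilon>) \<epsilon>)) (- real N)" by blast
qed

theorem theorem17:
  fixes a b c :: real
    and T :: "real \<Rightarrow> (real ^ 'n \<Rightarrow> complex) \<Rightarrow> (real ^ 'm \<Rightarrow> complex)"
    and L :: "(real ^ 'n) fnet set \<Rightarrow> (real ^ 'm) fnet set"
  assumes "0 \<le> a" and "0 \<le> b" and "0 \<le> c"
    and "a \<le> 1" and "a * b + c \<le> 1"
    and "\<forall>\<epsilon>\<in>{0<..1}. T \<epsilon> \<in> cont_linear_maps"
    and "strongly_moderate b c T"
    and "L \<in> C_bar_linear_maps"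
    and "canonical_extension T L"
  shows "\<exists>H \<in> (G_tau :: ((real ^ 'm) \<times> (real ^ 'n)) fnet set set).
    \<forall>F \<in> G_S_reg a. \<forall>h \<in> H. \<forall>f \<in> F.
      L F = class_tau (\<lambda>\<epsilon> x. \<integral>y. h \<epsilon> (x, y) * f \<epsilon> y \<partial>lborel)"
proof -
  note T = assms(6,7)
  define k where "k \<epsilon> = finite_rank_kernel (T \<epsilon>) \<epsilon>" for \<epsilon>
  have k: "k \<in> E_tau" using finite_rank_kernel_E_tau[OF T] by (simp add: k_def[abs_def])
  show ?thesis
  proof (intro bexI[of _ "class_tau k"] ballI)
    show "class_tau k \<in> G_tau" using k unfolding class_tau_def G_tau_def by (rule quotientI)
    fix F :: "(real ^ 'n) fnet set" and h f
    assume F: "F \<in> G_S_reg a" and h: "h \<in> class_tau k" and f: "f \<in> F"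
    \<comment> \<open>A representative \<open>f\<close> of \<open>F\<close> need not lie in
      \<open>E_S_reg a\<close>. The approximation is therefore applied to a regular representative
      \<open>g\<close>, and \<open>kernel_int_rel_tau\<close> passes from \<open>k\<close> and
      \<open>g\<close> to arbitrary \<open>h\<close> and \<open>f\<close>.\<close>
    obtain g where g: "g \<in> E_S_reg a" and Fg: "F = rel_S `` {g}"
      using F unfolding G_S_reg_def by (auto elim: quotientE)
    have gE: "g \<in> E_S" using g unfolding E_S_reg_def by blast
    have F': "F \<in> G_S" unfolding Fg G_S_def by (rule quotientI[OF gE])
    have gF: "g \<in> F" unfolding Fg using equiv_class_self[OF equiv_rel_S gE] .
    have "(\<lambda>\<epsilon>. T \<epsilon> (g \<epsilon>), \<lambda>\<epsilon>. T \<epsilon> (approx_op \<epsilon> (g \<epsilon>))) \<in> rel_tau"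
      by (rule image_rel_tau[OF T approx_op_rel_S[OF g assms(1,4)]])
    moreover have "(\<lambda>\<epsilon>. T \<epsilon> (approx_op \<epsilon> (g \<epsilon>)), \<lambda>\<epsilon>. kernel_int (k \<epsilon>) (g \<epsilon>)) \<in> rel_tau"
    proof (rule E_tau_cong[OF image_E_tau[OF T approx_op_E_S[OF gE]]], rule ballI)
      fix \<epsilon> :: real assume e: "\<epsilon> \<in> {0<..1}"
      then have "g \<epsilon> \<in> schwartz" using gE unfolding E_S_def by blast
      then show "T \<epsilon> (approx_op \<epsilon> (g \<epsilon>)) = kernel_int (k \<epsilon>) (g \<epsilon>)"
        unfolding k_def using T(1) e by (subst kernel_int_finite_rank_kernel) auto
    qed
    moreover have "(\<lambda>\<epsilon>. kernel_int (k \<epsilon>) (g \<epsilon>), \<lambda>\<epsilon>. kernel_int (h \<epsilon>) (f \<epsilon>)) \<in> rel_tau"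
      by (rule kernel_int_rel_tau) (use h f in \<open>auto simp: class_tau_def Fg\<close>)
    moreover have "trans (rel_tau :: (real ^ 'm) fnet rel)" using equiv_rel_tau unfolding equiv_def by blast
    ultimately have "(\<lambda>\<epsilon>. T \<epsilon> (g \<epsilon>), \<lambda>\<epsilon>. kernel_int (h \<epsilon>) (f \<epsilon>)) \<in> rel_tau"
      by (meson transD)
    then have "class_tau (\<lambda>\<epsilon>. T \<epsilon> (g \<epsilon>)) = class_tau (\<lambda>\<epsilon>. kernel_int (h \<epsilon>) (f \<epsilon>))"
      unfolding class_tau_def by (rule equiv_class_eq[OF equiv_rel_tau])
    moreover have "L F = class_tau (\<lambda>\<epsilon>. T \<epsilon> (g \<epsilon>))"
      using assms(9) F' gF unfolding canonical_extension_def by blast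
    ultimately show "L F = class_tau (\<lambda>\<epsilon> x. \<integral>y. h \<epsilon> (x, y) * f \<epsilon> y \<partial>lborel)"
      by (simp add: kernel_int_def[abs_def])
  qed
qed

end
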